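(* For a finite set $A \subseteq \mathbb{N}\cup\{0\}$, the cosine polynomial $$f_A(\theta) = \sum_{a\in A}\cos(a\theta)$$ has at least $(\log\log\log|A|)^{1/2+o(1)}$ distinct roots in $[0,2\pi]$, where $o(1)$ denotes a quantity depending only on $|A|$ and tending to $0$ as $|A|\to\infty$. Explicitly: for every $\varepsilon>0$ there is $N_0$ such that for every finite $A\subseteq\mathbb{N}\cup\{0\}$ with $|A|\ge N_0$, the function $f_A$ has at least $(\log\log\log|A|)^{1/2-\varepsilon}$ distinct roots in $[0,2\pi]$.
   Context: $\mathbb{N}=\{1,2,3,\dots\}$. All logarithms are to base $2$. *)

theory Defs
  imports "HOL-Analysis.Analysis"
begin

definition cosine_poly :: "nat set \<Rightarrow> real \<Rightarrow> real" where
  "cosine_poly A \<theta> = (\<Sum>a\<in>A. cos (real a * \<theta>))"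

end

theory Submission
  imports Defs "HOL-Complex_Analysis.Complex_Analysis" "HOL-Real_Asymp.Real_Asymp"
begin

text \<open>
Write $2f_A(\theta) = \sum_n c_n e^{in\theta}$ with $c_n \in \{0,1,2\}$, and let
$\theta_1, \dots, \theta_K$ be the sign changes of $f_A$ in $(0,\pi)$. Then
$f_A \prod_i (\cos\theta - \cos\theta_i)$ has constant sign, so its $L^1$ norm is one of its
Fourier coefficients and is at most $2^K$. By Dirichlet's theorem there is $m \le 256^K$ for which
all $m\theta_i$ are close to $2\pi\mathbb{Z}$. Put $X = 2 - 2\cos m\theta$. Since $X$ is small at
each $\theta_i$, for $q = (K+3)^2$ the power $X^q$ is the sum of a bounded multiple of
$\prod_i (\cos\theta - \cos\theta_i)$ and a polynomial in $X$ with tiny coefficients. Hence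
$2f_A X^{q+1}$, whose coefficients are integers, is close to a function of $L^1$ norm
$2^{O(K^2)}$, and the argument of McGehee, Pigno and Smith bounds the number of its nonzero
coefficients by $2^{2^{O(K^2)}}$. Away from these, a high difference of the bounded integer
sequence $c$ with step $m$ vanishes, which forces $c$ to be $m$-periodic there.

So $4\sin(m\theta/2) f_A(\theta) = \sum_x \tau_x \sin(x\theta)$ is a sum of few sines with bounded
integer coefficients, while $\sum_x \tau_x x = 2m|A|$. If $|A|$ is huge there is a scale
$H \le |A|$ far from all frequencies $x$, all their differences and all reciprocals of zeros. On
$[1/(2H), 1/H]$ the sum does not change sign and has mean nearly $0$; but the frequencies above
$H$ form tight, well separated clusters, one of which has nonzero total weight (otherwise
$\sum_x \tau_x x$ would be smaller than $H$), and this contradicts the small mean.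
\<close>

section \<open>Exponential sums on the unit interval\<close>

text \<open>The obstacle: the remainder in X has tiny coefficients but could have about as many as A
  has elements, so smallness alone gives no bound free of |A|. The exponent q + 1 answers this. The
  spare factor X annihilates the stretches on which c is m-periodic, so the remainder lives within a
  distance L = 2^O(q) of the support of the integer polynomial. A test function built from blocks of
  4^j frequencies then meets, in block j, at most 4^j (2L + 2)^2 coefficients of the remainder, and
  their size beats L. Since L grows like 4^q, the divisor needs roots as small as 2^-10. The K^2
  comes from the Lipschitz constant of cos(m theta) as a function of cos(theta), which is m^2 with m
  up to 256^K, taken once per sign change; a q of order K^2 therefore costs nothing more. This
  square is the source of the exponent 1/2. As for the three logarithms: the L^1 norm is 2^O(K^2),
  the number d of breaks of periodicity is exponential in a power of that norm, and the scale H is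
  found by pigeonhole among about d^2 candidates, which allows |A| to be as large as
  d^O(d^2).\<close>

definition ee :: "int \<Rightarrow> real \<Rightarrow> complex" where
  "ee n t = cis (2 * pi * of_int n * t)"

lemma ee_0 [simp]: "ee 0 t = 1"
  by (simp add: ee_def)

lemma ee_add: "ee (m + n) t = ee m t * ee n t"
  by (simp add: ee_def cis_mult algebra_simps)

lemma cnj_ee [simp]: "cnj (ee n t) = ee (- n) t"
  by (simp add: ee_def cis_cnj)

lemma norm_ee [simp]: "norm (ee n t) = 1"
  by (simp add: ee_def)

lemma continuous_on_ee [continuous_intros]: "continuous_on S (ee n)"
  unfolding ee_def by (intro continuous_intros)

lemma has_integral_ee: "(ee n has_integral (if n = 0 then 1 else 0)) {0..1}"
proof (cases "n = 0")
  case True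
  have "((\<lambda>t::real. 1::complex) has_integral (1 - 0) *\<^sub>R 1) {0..1}"
    using has_integral_const_real[of "1::complex" 0 1] by simp
  moreover have "ee 0 = (\<lambda>t. 1)" by (auto simp: fun_eq_iff)
  ultimately show ?thesis using True by simp
next
  case False
  define w where "w = 2 * pi * of_int n"
  have w: "w \<noteq> 0" using False by (simp add: w_def)
  have "integral {0..1} (\<lambda>t. exp (\<i> * w * of_real t)) = (exp (\<i> * w * of_real 1) - 1) / (\<i> * w)"
    using w by (intro integral_exp) auto
  moreover have "(\<lambda>t. exp (\<i> * w * of_real t)) integrable_on {0..1::real}"
    by (intro integrable_continuous_interval continuous_intros)
  ultimately have "((\<lambda>t. cis (w * t)) has_integral (cis (w * 1) - 1) / (\<i> * w)) {0..1}"
    by (simp add: has_integral_iff cis_conv_exp mult_ac)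
  moreover have "cis (w * 1) = 1"
    using cis_multiple_2pi[of "of_int n"] by (simp add: w_def)
  ultimately show ?thesis using False by (simp add: ee_def[abs_def] w_def mult_ac)
qed

lemma has_integral_sum_ee:
  assumes "finite S"
  shows "((\<lambda>t. \<Sum>i\<in>S. c i * ee (k i) t) has_integral (\<Sum>i\<in>S. if k i = 0 then c i else 0)) {0..1}"
proof (rule has_integral_sum[OF assms])
  fix i
  show "((\<lambda>t. c i * ee (k i) t) has_integral (if k i = 0 then c i else 0)) {0..1}"
    using has_integral_mult_right[OF has_integral_ee[of "k i"], of "c i"] by (auto split: if_splits)
qed

text \<open>For infinite support the sum takes its default value 0, so finiteness of the support is
  assumed wherever sequences are added.\<close>

definition tp :: "(int \<Rightarrow> real) \<Rightarrow> real \<Rightarrow> complex" where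
  "tp a t = (\<Sum>n | a n \<noteq> 0. of_real (a n) * ee n t)"

lemma tp_eq_sum:
  assumes "finite S" "\<And>n. a n \<noteq> 0 \<Longrightarrow> n \<in> S"
  shows "tp a t = (\<Sum>n\<in>S. of_real (a n) * ee n t)"
  unfolding tp_def by (rule sum.mono_neutral_left) (use assms in auto)

lemma continuous_on_tp [continuous_intros]: "continuous_on S (tp a)"
  unfolding tp_def[abs_def] by (intro continuous_intros)

lemma integral_mult_ee:
  assumes "finite S"
  shows "integral {0..1} (\<lambda>t. (\<Sum>n\<in>S. c n * ee n t) * ee (- k) t) = (if k \<in> S then c k else 0)"
proof -
  have "((\<lambda>t. \<Sum>n\<in>S. c n * ee (n - k) t) has_integral (\<Sum>n\<in>S. if n - k = 0 then c n else 0)) {0..1}"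
    by (rule has_integral_sum_ee[OF assms])
  moreover have "(\<Sum>n\<in>S. c n * ee (n - k) t) = (\<Sum>n\<in>S. c n * ee n t) * ee (- k) t" for t
    using ee_add[of _ "-k"] by (simp add: sum_distrib_right sum_distrib_left mult_ac)
  moreover have "(\<Sum>n\<in>S. if n - k = 0 then c n else 0) = (if k \<in> S then c k else 0)"
    using assms by (simp add: sum.delta)
  ultimately show ?thesis by (simp add: integral_unique)
qed

lemma has_integral_norm_sq_ee_sum:
  assumes "finite S"
  shows "((\<lambda>t. (norm (\<Sum>n\<in>S. of_real (c n) * ee n t))\<^sup>2) has_integral (\<Sum>n\<in>S. (c n)\<^sup>2)) {0..1}"
proof -
  have fin: "finite (S \<times> S)" using assms by simp
  have "((\<lambda>t. \<Sum>p\<in>S \<times> S. of_real (c (fst p) * c (snd p)) * ee (fst p - snd p) t) has_integral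
      (\<Sum>p\<in>S \<times> S. if fst p - snd p = 0 then of_real (c (fst p) * c (snd p)) else 0)) {0..1}"
    by (rule has_integral_sum_ee[OF fin])
  moreover have "(\<Sum>p\<in>S \<times> S. of_real (c (fst p) * c (snd p)) * ee (fst p - snd p) t)
      = of_real ((norm (\<Sum>n\<in>S. of_real (c n) * ee n t))\<^sup>2)" for t
  proof -
    have "of_real ((norm (\<Sum>n\<in>S. of_real (c n) * ee n t))\<^sup>2)
        = (\<Sum>n\<in>S. of_real (c n) * ee n t) * cnj (\<Sum>n\<in>S. of_real (c n) * ee n t)"
      by (simp only: complex_norm_square of_real_power [symmetric])
    also have "\<dots> = (\<Sum>n\<in>S. \<Sum>m\<in>S. of_real (c n * c m) * ee (n - m) t)"
      by (simp add: sum_product ee_add[of _ "- _", simplified] mult_ac)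
    finally show ?thesis by (simp add: sum.cartesian_product case_prod_beta)
  qed
  moreover have "(\<Sum>p\<in>S \<times> S. if fst p - snd p = 0 then complex_of_real (c (fst p) * c (snd p)) else 0)
     = of_real (\<Sum>n\<in>S. (c n)\<^sup>2)"
  proof -
    have "(\<Sum>p\<in>S \<times> S. if fst p - snd p = 0 then complex_of_real (c (fst p) * c (snd p)) else 0)
       = (\<Sum>n\<in>S. \<Sum>m\<in>S. if n = m then complex_of_real (c n * c m) else 0)"
      by (simp add: sum.cartesian_product case_prod_beta)
    also have "\<dots> = (\<Sum>n\<in>S. complex_of_real (c n * c n))"
      using assms by (intro sum.cong) (auto simp: sum.delta)
    finally show ?thesis by (simp add: power2_eq_square)
  qed
  ultimately have "((\<lambda>t. complex_of_real ((norm (\<Sum>n\<in>S. of_real (c n) * ee n t))\<^sup>2))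
      has_integral of_real (\<Sum>n\<in>S. (c n)\<^sup>2)) {0..1}"
    by simp
  from has_integral_Re[OF this] show ?thesis by simp
qed

lemma parseval_tp:
  assumes "finite S" "\<And>n. a n \<noteq> 0 \<Longrightarrow> n \<in> S"
  shows "integral {0..1} (\<lambda>t. (norm (tp a t))\<^sup>2) = (\<Sum>n\<in>S. (a n)\<^sup>2)"
  using has_integral_norm_sq_ee_sum[OF assms(1), of a] by (simp add: tp_eq_sum[OF assms] integral_unique)

text \<open>Cauchy-Schwarz, obtained by integrating the weighted inequality between arithmetic and
  geometric mean. The weights B / A and A / B make both terms equal to A B / 2, so only continuous
  integrands and given bounds for the two norms are involved.\<close>

lemma integral_norm_mult_le:
  fixes F G :: "real \<Rightarrow> complex"
  assumes cF: "continuous_on {0..1} F" and cG: "continuous_on {0..1} G"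
    and F: "integral {0..1} (\<lambda>t. (norm (F t))\<^sup>2) \<le> A\<^sup>2"
    and G: "integral {0..1} (\<lambda>t. (norm (G t))\<^sup>2) \<le> B\<^sup>2"
    and A: "A > 0" and B: "B > 0"
  shows "integral {0..1} (\<lambda>t. norm (F t * G t)) \<le> A * B"
proof -
  note ic = integrable_continuous_interval continuous_on_norm continuous_on_power continuous_on_mult
      continuous_on_add continuous_on_const cF cG
  have "integral {0..1} (\<lambda>t. norm (F t * G t))
      \<le> integral {0..1} (\<lambda>t. (B / (2 * A)) * (norm (F t))\<^sup>2 + (A / (2 * B)) * (norm (G t))\<^sup>2)"
  proof (rule integral_le)
    fix t
    define x y where "x = norm (F t)" and "y = norm (G t)"
    have "0 \<le> (B * x - A * y)\<^sup>2" by simp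
    then have "2 * A * B * (x * y) \<le> B\<^sup>2 * x\<^sup>2 + A\<^sup>2 * y\<^sup>2"
      by (simp add: power2_eq_square algebra_simps)
    then have "x * y \<le> (B\<^sup>2 * x\<^sup>2 + A\<^sup>2 * y\<^sup>2) / (2 * A * B)"
      using A B by (simp add: field_simps)
    also have "\<dots> = (B / (2 * A)) * x\<^sup>2 + (A / (2 * B)) * y\<^sup>2"
      using A B by (simp add: field_simps power2_eq_square)
    finally show "norm (F t * G t) \<le> (B / (2 * A)) * (norm (F t))\<^sup>2 + (A / (2 * B)) * (norm (G t))\<^sup>2"
      by (simp add: x_def y_def norm_mult)
  qed (intro ic)+
  also have "\<dots> = (B / (2 * A)) * integral {0..1} (\<lambda>t. (norm (F t))\<^sup>2)
      + (A / (2 * B)) * integral {0..1} (\<lambda>t. (norm (G t))\<^sup>2)"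
    by (subst integral_add; (intro ic)?; simp)
  also have "\<dots> \<le> (B / (2 * A)) * A\<^sup>2 + (A / (2 * B)) * B\<^sup>2"
    using A B F G by (intro add_mono mult_left_mono) auto
  also have "\<dots> = A * B" using A B by (simp add: power2_eq_square field_simps)
  finally show ?thesis .
qed

section \<open>A perturbed form of Littlewood's $L^1$ inequality\<close>

lemma ee_minus_eq_power: "ee (- int k) t = (ee (-1) t) ^ k"
  by (simp add: ee_def Complex.DeMoivre mult_ac)

text \<open>On the unit circle the conjugate of the integrand is z g(z) with g entire, and the
  factor z is the one supplied by dz; so this is Cauchy's theorem. It shows that the exponential of
  a sum of nonpositive frequencies has no positive frequency, without expanding it into a
  series.\<close>

lemma integral_ee_exp_eq_0:
  fixes k :: "'a \<Rightarrow> nat"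
  assumes "finite I" "p > 0"
  shows "integral {0..1} (\<lambda>t. ee (- int p) t * exp (- (\<Sum>i\<in>I. c i * ee (- int (k i)) t))) = 0"
proof -
  define g where "g z = z ^ (p - 1) * exp (- (\<Sum>i\<in>I. cnj (c i) * z ^ k i))" for z :: complex
  have "g holomorphic_on UNIV"
    unfolding g_def by (intro holomorphic_intros)
  then have "(g has_contour_integral 0) (circlepath 0 1)"
    by (intro Cauchy_theorem_convex_simple[of _ UNIV]) auto
  then have "((\<lambda>x. g (circlepath 0 1 x) * vector_derivative (circlepath 0 1) (at x within {0..1}))
      has_integral 0) {0..1}"
    by (simp add: has_contour_integral_def)
  then have "((\<lambda>x. (2 * pi * \<i>) * (ee 1 x * g (ee 1 x))) has_integral 0) {0..1}"
  proof (rule has_integral_eq[rotated])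
    fix x :: real assume "x \<in> {0..1}"
    have e: "exp (2 * complex_of_real pi * \<i> * complex_of_real x) = ee 1 x"
      by (simp add: ee_def cis_conv_exp mult_ac)
    have "circlepath 0 1 x = ee 1 x" by (simp add: circlepath e)
    moreover have "vector_derivative (circlepath 0 1) (at x within {0..1}) = 2 * pi * \<i> * ee 1 x"
      using \<open>x \<in> {0..1}\<close> vector_derivative_circlepath01[of x 0 1] e by (simp add: mult_ac)
    ultimately show "g (circlepath 0 1 x) * vector_derivative (circlepath 0 1) (at x within {0..1})
        = (2 * pi * \<i>) * (ee 1 x * g (ee 1 x))"
      by (simp only: mult_ac)
  qed
  then have "((\<lambda>x. ee 1 x * g (ee 1 x)) has_integral 0) {0..1}"
    by (subst (asm) has_integral_mult_right_iff) auto
  then have "(cnj \<circ> (\<lambda>x. ee 1 x * g (ee 1 x)) has_integral cnj 0) {0..1}"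
    by (simp only: has_integral_cnj)
  moreover have "cnj \<circ> (\<lambda>x. ee 1 x * g (ee 1 x)) =
     (\<lambda>t. ee (- int p) t * exp (- (\<Sum>i\<in>I. c i * ee (- int (k i)) t)))"
  proof
    fix t
    have "ee (-1) t * ee (-1) t ^ (p - 1) = ee (-1) t ^ p"
      using \<open>p > 0\<close> by (simp add: power_eq_if)
    then show "(cnj \<circ> (\<lambda>x. ee 1 x * g (ee 1 x))) t =
        ee (- int p) t * exp (- (\<Sum>i\<in>I. c i * ee (- int (k i)) t))"
      by (simp add: g_def exp_cnj ee_minus_eq_power mult.assoc [symmetric])
  qed
  ultimately show ?thesis by (simp add: integral_unique)
qed

lemma norm_exp_minus_minus_1_le:
  fixes z :: complex
  assumes "Re z \<ge> 0"
  shows "norm (exp (- z) - 1) \<le> norm z"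
proof -
  have "norm (exp (- z) - exp (- 0)) \<le> 1 * norm (z - 0)"
  proof (rule field_differentiable_bound[where S = "{z. Re z \<ge> 0}" and f' = "\<lambda>z. - exp (- z)"])
    show "convex {z. Re z \<ge> 0}" by (rule convex_halfspace_Re_ge)
  qed (use assms in \<open>auto intro!: derivative_eq_intros\<close>)
  then show ?thesis by simp
qed

text \<open>One step of the induction in \<open>norm_F_le\<close>: C is the bound so far, x the
  modulus of the new block. The exponential gains at least C x^2 / 16, and completing the square
  shows that this pays for x up to 4 / C. A quadratic gain cannot absorb small x, hence the loss 4 /
  S per block.\<close>

lemma damping_step:
  fixes C S x :: real
  assumes "S > 0" "C \<ge> S" "0 \<le> x" "x \<le> 1"
  shows "C * exp (- (x\<^sup>2 / 8)) + x \<le> C + 4 / S"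
proof -
  define y where "y = x\<^sup>2 / 8"
  have x2: "x\<^sup>2 \<le> 1" using assms by (simp add: power_le_one)
  have y: "0 \<le> y" "y \<le> 1" using x2 by (auto simp: y_def)
  have "exp (- y) \<le> 1 / (1 + y)"
    using exp_ge_add_one_self[of y] y by (simp add: exp_minus field_simps)
  also have "\<dots> \<le> 1 - y / 2"
  proof -
    have "y * y \<le> y * 1" using y by (intro mult_left_mono) auto
    then show ?thesis using y by (simp add: field_simps)
  qed
  finally have "C * exp (- y) \<le> C * (1 - y / 2)"
    using assms by (intro mult_left_mono) auto
  moreover have "x \<le> C * x\<^sup>2 / 16 + 4 / C"
  proof -
    have "0 \<le> (C * x / 4 - 2)\<^sup>2" by simp
    then have "x * C \<le> C\<^sup>2 * x\<^sup>2 / 16 + 4"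
      by (simp add: power2_eq_square field_simps)
    then have "x \<le> (C\<^sup>2 * x\<^sup>2 / 16 + 4) / C"
      using assms by (simp add: pos_le_divide_eq)
    also have "\<dots> = C * x\<^sup>2 / 16 + 4 / C"
      using assms by (simp add: power2_eq_square add_divide_distrib)
    finally show ?thesis .
  qed
  moreover have "4 / C \<le> 4 / S" using assms by (intro divide_left_mono) auto
  ultimately show ?thesis by (simp add: y_def algebra_simps)
qed

lemma sum_symmetric_int_interval:
  fixes g :: "int \<Rightarrow> 'a :: ab_group_add"
  shows "(\<Sum>n\<in>{- int d..int d}. g n) = g 0 + (\<Sum>k=1..d. g (int k) + g (- int k))"
proof (induction d)
  case (Suc d)
  have "{- int (Suc d)..int (Suc d)} = insert (int (Suc d)) (insert (- int (Suc d)) {- int d..int d})"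
    by auto
  then show ?case using Suc by (simp add: add_ac)
qed auto

text \<open>
  Multiplying by \<open>exp (- h)\<close> for a multiple \<open>h\<close> of this completion damps where the block \<open>f\<close> is
  large, and as only nonpositive frequencies occur it leaves the coefficients of later blocks at \<open>0\<close>.
  McGehee, Pigno and Smith use the modulus of \<open>f\<close>; its square keeps everything a trigonometric polynomial
  and costs only a power in the final bound.
\<close>
lemma one_sided_completion:
  fixes a :: "int \<Rightarrow> real"
  assumes E: "finite E"
  defines "f \<equiv> \<lambda>t. \<Sum>n\<in>E. of_real (a n) * ee n t"
  shows "\<exists>d c. (\<forall>t. Re (\<Sum>k\<le>d. of_real (c k) * ee (- int k) t) = (norm (f t))\<^sup>2) \<and>
    integral {0..1} (\<lambda>t. (norm (\<Sum>k\<le>d. of_real (c k) * ee (- int k) t))\<^sup>2)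
      \<le> 4 * integral {0..1} (\<lambda>t. (norm (f t)) ^ 4)"
proof -
  define P where "P = E \<times> E"
  have P: "finite P" using E by (simp add: P_def)
  define D where "D = Max ((\<lambda>p. \<bar>fst p - snd p\<bar>) ` P)"
  have D: "\<bar>fst p - snd p\<bar> \<le> D" if "p \<in> P" for p
    unfolding D_def using P that by (intro Max_ge) auto
  define d where "d = nat D"
  have d: "fst p - snd p \<in> {- int d..int d}" if "p \<in> P" for p
    using D[OF that] by (auto simp: d_def)
  define \<gamma> where "\<gamma> n = (\<Sum>p\<in>{p\<in>P. fst p - snd p = n}. a (fst p) * a (snd p))" for n
  have sq: "of_real ((norm (f t))\<^sup>2) = (\<Sum>n\<in>{- int d..int d}. of_real (\<gamma> n) * ee n t)" for t
  proof -
    have "of_real ((norm (f t))\<^sup>2) = f t * cnj (f t)"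
      by (simp only: complex_norm_square of_real_power [symmetric])
    also have "\<dots> = (\<Sum>n\<in>E. \<Sum>m\<in>E. of_real (a n * a m) * ee (n - m) t)"
      using ee_add[of _ "- _"] by (simp add: f_def sum_product mult_ac)
    also have "\<dots> = (\<Sum>p\<in>P. of_real (a (fst p) * a (snd p)) * ee (fst p - snd p) t)"
      by (simp add: sum.cartesian_product case_prod_beta P_def)
    also have "\<dots> = (\<Sum>n\<in>{- int d..int d}. \<Sum>p\<in>{p\<in>P. fst p - snd p = n}.
        of_real (a (fst p) * a (snd p)) * ee (fst p - snd p) t)"
      by (rule sum.group[symmetric]) (use P d in auto)
    also have "\<dots> = (\<Sum>n\<in>{- int d..int d}. of_real (\<gamma> n) * ee n t)"
      by (intro sum.cong) (auto simp: \<gamma>_def sum_distrib_right)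
    finally show ?thesis .
  qed
  have sym: "\<gamma> (- n) = \<gamma> n" for n
    unfolding \<gamma>_def
    by (rule sum.reindex_bij_witness[of _ prod.swap prod.swap]) (auto simp: P_def)
  \<comment> \<open>The coefficients of |f|^2 are symmetric. Keeping the constant one and doubling
    those of negative frequency in place of the positive ones leaves the real part unchanged, while
    each square grows by at most 4.\<close>
  define c where "c k = (if k = 0 then \<gamma> 0 else 2 * \<gamma> (int k))" for k :: nat
  have split0: "{..d} = insert 0 {1..d}" by auto
  have "Re (\<Sum>k\<le>d. of_real (c k) * ee (- int k) t) = (norm (f t))\<^sup>2" for t
  proof -
    have "Re (\<Sum>k\<le>d. of_real (c k) * ee (- int k) t)
        = \<gamma> 0 + (\<Sum>k=1..d. 2 * \<gamma> (int k) * cos (2 * pi * real k * t))"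
      unfolding split0 by (simp add: c_def ee_def)
    also have "\<dots> = (\<Sum>n\<in>{- int d..int d}. \<gamma> n * cos (2 * pi * of_int n * t))"
      by (subst sum_symmetric_int_interval) (simp add: sym mult.assoc)
    also have "\<dots> = Re (\<Sum>n\<in>{- int d..int d}. of_real (\<gamma> n) * ee n t)"
      by (simp add: ee_def)
    also have "\<dots> = (norm (f t))\<^sup>2" by (simp add: sq[symmetric])
    finally show ?thesis .
  qed
  moreover have "integral {0..1} (\<lambda>t. (norm (\<Sum>k\<le>d. of_real (c k) * ee (- int k) t))\<^sup>2)
      \<le> 4 * integral {0..1} (\<lambda>t. (norm (f t)) ^ 4)"
  proof -
    define b where "b n = c (nat (- n))" for n
    have "(\<Sum>k\<le>d. of_real (c k) * ee (- int k) t) = (\<Sum>n\<in>{- int d..0}. of_real (b n) * ee n t)" for t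
      by (rule sum.reindex_bij_witness[of _ "\<lambda>n. nat (- n)" "\<lambda>k. - int k"]) (auto simp: b_def)
    then have "integral {0..1} (\<lambda>t. (norm (\<Sum>k\<le>d. of_real (c k) * ee (- int k) t))\<^sup>2)
        = (\<Sum>n\<in>{- int d..0}. (b n)\<^sup>2)"
      using has_integral_norm_sq_ee_sum[of "{- int d..0}" b] by (simp add: integral_unique)
    also have "\<dots> \<le> (\<Sum>n\<in>{- int d..0}. 4 * (\<gamma> n)\<^sup>2)"
      by (intro sum_mono) (auto simp: b_def c_def sym power_mult_distrib)
    also have "\<dots> \<le> (\<Sum>n\<in>{- int d..int d}. 4 * (\<gamma> n)\<^sup>2)"
      by (intro sum_mono2) auto
    also have "\<dots> = 4 * integral {0..1} (\<lambda>t. (norm (f t)) ^ 4)"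
    proof -
      have "(norm (\<Sum>n\<in>{- int d..int d}. of_real (\<gamma> n) * ee n t))\<^sup>2 = (norm (f t)) ^ 4" for t
        unfolding sq[symmetric] by (simp add: norm_power flip: power_mult)
      then show ?thesis
        using has_integral_norm_sq_ee_sum[of "{- int d..int d}" \<gamma>] by (simp add: integral_unique sum_distrib_left)
    qed
    finally show ?thesis .
  qed
  ultimately show ?thesis by blast
qed

section \<open>Splitting the spectrum into blocks of 1, 4, 16, ... frequencies\<close>

lemma initial_segment_card:
  fixes E :: "int set"
  assumes "finite E" "k \<le> card E"
  shows "\<exists>b. card {n\<in>E. n \<le> b} = k"
  using assms(2)
proof (induction k)
  case 0
  show ?case
  proof (cases "E = {}")
    case False
    have "Min E \<le> n" if "n \<in> E" for n
      using assms(1) that by simp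
    then have "{n\<in>E. n \<le> Min E - 1} = {}" by fastforce
    then show ?thesis by (metis card.empty)
  qed auto
next
  case (Suc k)
  then obtain b where b: "card {n\<in>E. n \<le> b} = k" by auto
  define R where "R = {n\<in>E. n > b}"
  have "finite R" using assms(1) by (simp add: R_def)
  have "E = {n\<in>E. n \<le> b} \<union> R" by (auto simp: R_def)
  have "R \<noteq> {}"
  proof
    assume "R = {}"
    then have "E = {n\<in>E. n \<le> b}" by (auto simp: R_def)
    with b Suc.prems show False by simp
  qed
  define m where "m = Min R"
  have m: "m \<in> R" "\<And>x. x \<in> R \<Longrightarrow> m \<le> x"
    using \<open>finite R\<close> \<open>R \<noteq> {}\<close> by (auto simp: m_def)
  have "{n\<in>E. n \<le> m} = insert m {n\<in>E. n \<le> b}"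
    using m by (fastforce simp: R_def)
  moreover have "m \<notin> {n\<in>E. n \<le> b}" using m by (auto simp: R_def)
  ultimately have "card {n\<in>E. n \<le> m} = Suc k" using assms(1) b by simp
  then show ?case by blast
qed

lemma sum_power4_le: "(\<Sum>i<Suc j. 4 ^ i) \<le> 2 * (4::nat) ^ j"
  by (induction j) auto

text \<open>The cut points \<open>\<tau> j\<close> separate consecutive blocks of 4^j elements,
  starting from the smallest element of E; what lies beyond \<open>\<tau> N\<close> belongs to no
  block below N. With weight 4^-j the polynomial \<open>f j\<close> has sup norm at most 1 and L^2
  norm 2^-j.\<close>

locale sign_blocks =
  fixes E :: "int set" and s :: "int \<Rightarrow> real" and N :: nat and \<tau> :: "nat \<Rightarrow> int"
  assumes finE: "finite E"
    and sign: "n \<in> E \<Longrightarrow> \<bar>s n\<bar> = 1"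
    and card_upto: "j \<le> N \<Longrightarrow> card {n\<in>E. n \<le> \<tau> j} = (\<Sum>i<j. 4 ^ i)"
begin

definition B where "B j = {n\<in>E. \<tau> j < n \<and> n \<le> \<tau> (Suc j)}"

definition f where "f j t = (\<Sum>n\<in>B j. of_real (s n / 4 ^ j) * ee n t)"

lemma finite_B [simp]: "finite (B j)"
  using finE by (simp add: B_def)

lemma \<tau>_less: "i < j \<Longrightarrow> j \<le> N \<Longrightarrow> \<tau> i < \<tau> j"
proof (rule ccontr)
  assume "i < j" "j \<le> N" "\<not> \<tau> i < \<tau> j"
  then have "card {n\<in>E. n \<le> \<tau> j} \<le> card {n\<in>E. n \<le> \<tau> i}"
    using finE by (intro card_mono) auto
  then have "(\<Sum>k<j. 4 ^ k) \<le> (\<Sum>k<i. (4::nat) ^ k)"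
    using card_upto[of i] card_upto[of j] \<open>i < j\<close> \<open>j \<le> N\<close> by simp
  moreover have "(\<Sum>k<i. (4::nat) ^ k) < (\<Sum>k<j. 4 ^ k)"
    using \<open>i < j\<close> by (intro sum_strict_mono2[of _ _ i]) auto
  ultimately show False by simp
qed

lemma \<tau>_le: "i \<le> j \<Longrightarrow> j \<le> N \<Longrightarrow> \<tau> i \<le> \<tau> j"
  using \<tau>_less[of i j] by (cases "i = j") auto

lemma card_B: "j < N \<Longrightarrow> card (B j) = 4 ^ j"
proof -
  assume "j < N"
  have "B j = {n\<in>E. n \<le> \<tau> (Suc j)} - {n\<in>E. n \<le> \<tau> j}" by (auto simp: B_def)
  also have "card \<dots> = card {n\<in>E. n \<le> \<tau> (Suc j)} - card {n\<in>E. n \<le> \<tau> j}"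
    using finE \<tau>_le[of j "Suc j"] \<open>j < N\<close> by (intro card_Diff_subset) auto
  finally show ?thesis using card_upto[of j] card_upto[of "Suc j"] \<open>j < N\<close> by simp
qed

lemma B_disjoint: "i < N \<Longrightarrow> j < N \<Longrightarrow> i \<noteq> j \<Longrightarrow> B i \<inter> B j = {}"
proof (induction i j rule: linorder_wlog)
  case (le a b)
  then have "\<tau> (Suc a) \<le> \<tau> b" by (intro \<tau>_le) auto
  then show ?case by (auto simp: B_def)
qed (auto simp: Int_commute)

lemma continuous_on_f [continuous_intros]: "continuous_on S (f j)"
  unfolding f_def[abs_def] by (intro continuous_intros)

lemma norm_f_le: "j < N \<Longrightarrow> norm (f j t) \<le> 1"
proof -
  assume "j < N"
  have "norm (f j t) \<le> (\<Sum>n\<in>B j. 1 / 4 ^ j)"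
    unfolding f_def using sign
    by (intro sum_norm_le) (auto simp: norm_mult B_def norm_divide norm_power)
  also have "\<dots> = 1" using card_B[OF \<open>j < N\<close>] by simp
  finally show ?thesis .
qed

lemma integral_f_sq: "j < N \<Longrightarrow> integral {0..1} (\<lambda>t. (norm (f j t))\<^sup>2) = (1 / 2 ^ j)\<^sup>2"
proof -
  assume "j < N"
  have "integral {0..1} (\<lambda>t. (norm (f j t))\<^sup>2) = (\<Sum>n\<in>B j. (s n / 4 ^ j)\<^sup>2)"
    unfolding f_def by (intro integral_unique has_integral_norm_sq_ee_sum) simp
  also have "\<dots> = (\<Sum>n\<in>B j. (1 / 4 ^ j)\<^sup>2)"
  proof (intro sum.cong refl)
    fix n assume "n \<in> B j"
    then have "(s n)\<^sup>2 = 1" using sign[of n] by (simp add: B_def abs_square_eq_1)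
    then show "(s n / 4 ^ j)\<^sup>2 = (1 / 4 ^ j)\<^sup>2" by (simp add: power_divide)
  qed
  also have "\<dots> = (1 / 2 ^ j)\<^sup>2"
  proof -
    have "(4::real) ^ j = 2 ^ j * 2 ^ j" by (simp flip: power_mult_distrib)
    then show ?thesis using card_B[OF \<open>j < N\<close>] by (simp add: power2_eq_square)
  qed
  finally show ?thesis .
qed

end

locale completed_blocks = sign_blocks +
  fixes d :: "nat \<Rightarrow> nat" and c :: "nat \<Rightarrow> nat \<Rightarrow> real"
  assumes Re_completion: "j < N \<Longrightarrow> Re (\<Sum>k\<le>d j. of_real (c j k) * ee (- int k) t) = (norm (f j t))\<^sup>2"
    and integral_completion: "j < N \<Longrightarrow>
      integral {0..1} (\<lambda>t. (norm (\<Sum>k\<le>d j. of_real (c j k) * ee (- int k) t))\<^sup>2)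
        \<le> 4 * integral {0..1} (\<lambda>t. (norm (f j t)) ^ 4)"
begin

text \<open>The factor 1/8 is a compromise: the real part is still large enough to damp, and the L^2
  norm of \<open>h j\<close> is at most 2^-j / 4, so that damping distorts each coefficient by at
  most a third of its weight.\<close>

definition h where "h j t = (\<Sum>k\<le>d j. of_real (c j k / 8) * ee (- int k) t)"

definition G where "G j t = f j t * exp (- (\<Sum>i\<in>{j<..<N}. h i t))"

text \<open>Closed form of the recursion F (k + 1) = F k exp(- h k) + f k with F 0 = 0. The
  recursion bounds the sup norm; the closed form writes \<open>F N\<close> as the sum of the
  \<open>G j\<close>, whose coefficients are estimated one block at a time.\<close>

definition F where "F k t = (\<Sum>j<k. f j t * exp (- (\<Sum>i\<in>{j<..<k}. h i t)))"

lemma h_eq: "h j t = (\<Sum>k\<le>d j. of_real (c j k) * ee (- int k) t) / 8"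
  by (simp add: h_def sum_divide_distrib)

lemma continuous_on_h [continuous_intros]: "continuous_on S (h j)"
  unfolding h_def[abs_def] by (intro continuous_intros)

lemma continuous_on_G [continuous_intros]: "continuous_on S (G j)"
  unfolding G_def[abs_def] by (intro continuous_intros)

lemma Re_h: "j < N \<Longrightarrow> Re (h j t) = (norm (f j t))\<^sup>2 / 8"
  using Re_completion[of j t] by (simp add: h_eq)

lemma integral_h_sq: 
  assumes "j < N"
  shows "integral {0..1} (\<lambda>t. (norm (h j t))\<^sup>2) \<le> (1 / (4 * 2 ^ j))\<^sup>2"
proof -
  have "integral {0..1} (\<lambda>t. (norm (h j t))\<^sup>2) =
      integral {0..1} (\<lambda>t. (norm (\<Sum>k\<le>d j. of_real (c j k) * ee (- int k) t))\<^sup>2) / 64"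
    by (simp add: h_eq norm_divide power_divide)
  also have "\<dots> \<le> 4 * integral {0..1} (\<lambda>t. (norm (f j t)) ^ 4) / 64"
    using integral_completion[OF assms] by (intro divide_right_mono) auto
  also have "integral {0..1} (\<lambda>t. (norm (f j t)) ^ 4) \<le> integral {0..1} (\<lambda>t. (norm (f j t))\<^sup>2)"
  proof (rule integral_le)
    fix t
    have "norm (f j t) ^ 4 = (norm (f j t))\<^sup>2 * (norm (f j t))\<^sup>2"
      by (simp flip: power_add)
    also have "\<dots> \<le> (norm (f j t))\<^sup>2 * 1"
      using norm_f_le[OF assms] by (intro mult_left_mono) (auto simp: power_le_one)
    finally show "norm (f j t) ^ 4 \<le> (norm (f j t))\<^sup>2" by simp
  qed (intro integrable_continuous_interval continuous_intros)+
  also have "\<dots> = (1 / 2 ^ j)\<^sup>2" by (rule integral_f_sq[OF assms])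
  finally show ?thesis by (simp add: power_divide power_mult_distrib field_simps)
qed

text \<open>Each new block multiplies the old sum by a factor of modulus exp(- |f k|^2 / 8) and adds
  f k, so \<open>damping_step\<close> applies pointwise. S stays free; the choice S = sqrt N
  balances S against 4 N / S.\<close>

lemma norm_F_le:
  assumes "S > 0" "k \<le> N"
  shows "norm (F k t) \<le> S + 4 * real k / S"
  using assms(2)
proof (induction k)
  case 0
  then show ?case using assms by (simp add: F_def)
next
  case (Suc k)
  have "{k<..<Suc k} = {}" by auto
  then have "F (Suc k) t = (\<Sum>j<k. f j t * exp (- (\<Sum>i\<in>{j<..<Suc k}. h i t))) + f k t"
    by (simp add: F_def)
  also have "(\<Sum>j<k. f j t * exp (- (\<Sum>i\<in>{j<..<Suc k}. h i t))) = F k t * exp (- h k t)"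
    unfolding F_def sum_distrib_right
  proof (intro sum.cong refl)
    fix j assume "j \<in> {..<k}"
    then have "{j<..<Suc k} = insert k {j<..<k}" by auto
    then have "(\<Sum>i\<in>{j<..<Suc k}. h i t) = h k t + (\<Sum>i\<in>{j<..<k}. h i t)" by simp
    then show "f j t * exp (- (\<Sum>i\<in>{j<..<Suc k}. h i t)) = f j t * exp (- (\<Sum>i\<in>{j<..<k}. h i t)) * exp (- h k t)"
      by (simp add: mult.assoc exp_add [symmetric] algebra_simps)
  qed
  finally have "norm (F (Suc k) t) \<le> norm (F k t) * exp (- Re (h k t)) + norm (f k t)"
    by (metis norm_triangle_ineq norm_mult norm_exp_eq_Re uminus_complex.sel(1))
  also have "\<dots> \<le> (S + 4 * real k / S) * exp (- ((norm (f k t))\<^sup>2 / 8)) + norm (f k t)"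
    using Suc by (simp add: Re_h)
  also have "\<dots> \<le> S + 4 * real k / S + 4 / S"
    using assms Suc norm_f_le by (intro damping_step) auto
  finally show ?case by (simp add: add_divide_distrib distrib_left)
qed

lemma Re_sum_h_nonneg: "Re (\<Sum>i\<in>{j<..<N}. h i t) \<ge> 0"
  by (simp add: Re_h sum_nonneg)

lemma norm_G_le: "norm (G j t) \<le> norm (f j t)"
  using Re_sum_h_nonneg[of t j] unfolding G_def norm_mult norm_exp_eq_Re
  by (intro mult_left_le) auto

text \<open>The completions have nonpositive frequencies only, so damping a block by later blocks
  can move its frequencies down but not up.\<close>

lemma G_spectrum:
  assumes "n > \<tau> (Suc j)"
  shows "integral {0..1} (\<lambda>t. G j t * ee (- n) t) = 0"
proof -
  \<comment> \<open>Flattening the double sum turns the damping factor into the exponential of a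
    single sum, the form required by \<open>integral_ee_exp_eq_0\<close>.\<close>
  define I where "I = (SIGMA i:{j<..<N}. {..d i})"
  define W where "W t = exp (- (\<Sum>p\<in>I. of_real (c (fst p) (snd p) / 8) * ee (- int (snd p)) t))" for t
  have W: "exp (- (\<Sum>i\<in>{j<..<N}. h i t)) = W t" for t
    by (simp add: W_def h_def I_def sum.Sigma case_prod_beta)
  have "G j t * ee (- n) t = (\<Sum>b\<in>B j. of_real (s b / 4 ^ j) * (ee (- int (nat (n - b))) t * W t))" for t
  proof -
    have "ee b t * ee (- n) t = ee (- int (nat (n - b))) t" if "b \<in> B j" for b
      using that assms by (simp add: ee_add[symmetric] B_def)
    then show ?thesis
      unfolding G_def W f_def sum_distrib_right by (intro sum.cong) (simp_all add: mult_ac)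
  qed
  then have "integral {0..1} (\<lambda>t. G j t * ee (- n) t) =
      (\<Sum>b\<in>B j. integral {0..1} (\<lambda>t. of_real (s b / 4 ^ j) * (ee (- int (nat (n - b))) t * W t)))"
    unfolding W_def by (simp only:, subst integral_sum) (auto intro!: integrable_continuous_interval continuous_intros)
  also have "\<dots> = 0"
  proof (intro sum.neutral ballI)
    fix b assume "b \<in> B j"
    then have "nat (n - b) > 0" using assms by (simp add: B_def)
    then have "integral {0..1} (\<lambda>t. ee (- int (nat (n - b))) t * W t) = 0"
      unfolding W_def by (intro integral_ee_exp_eq_0) (auto simp: I_def)
    then show "integral {0..1} (\<lambda>t. of_real (s b / 4 ^ j) * (ee (- int (nat (n - b))) t * W t)) = 0"
      by simp
  qed
  finally show ?thesis .
qed

text \<open>Since |exp(-H) - 1| is at most |H| when H has nonnegative real part, Cauchy-Schwarz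
  bounds the distortion by the products of the L^2 norms of \<open>f j\<close> and of the later
  \<open>h i\<close>. The resulting geometric series over i > j sums to at most 2^-j / 4.\<close>

lemma G_coeff:
  assumes "j < N"
  shows "norm (integral {0..1} (\<lambda>t. (G j t - f j t) * ee (- n) t)) \<le> 1 / (4 * 4 ^ j)"
proof -
  note ic = integrable_continuous_interval
  have "norm (integral {0..1} (\<lambda>t. (G j t - f j t) * ee (- n) t))
      \<le> integral {0..1} (\<lambda>t. \<Sum>i\<in>{j<..<N}. norm (f j t * h i t))"
  proof (rule integral_norm_bound_integral)
    fix t :: real
    let ?H = "\<Sum>i\<in>{j<..<N}. h i t"
    have "(G j t - f j t) * ee (- n) t = f j t * (exp (- ?H) - 1) * ee (- n) t"
      by (simp add: G_def algebra_simps)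
    then have "norm ((G j t - f j t) * ee (- n) t) = norm (f j t) * norm (exp (- ?H) - 1)"
      by (simp only: norm_mult norm_ee mult_1_right)
    also have "\<dots> \<le> norm (f j t) * norm ?H"
      by (intro mult_left_mono norm_exp_minus_minus_1_le Re_sum_h_nonneg) auto
    also have "\<dots> \<le> norm (f j t) * (\<Sum>i\<in>{j<..<N}. norm (h i t))"
      by (intro mult_left_mono norm_sum) auto
    finally show "norm ((G j t - f j t) * ee (- n) t) \<le> (\<Sum>i\<in>{j<..<N}. norm (f j t * h i t))"
      by (simp add: sum_distrib_left norm_mult)
  qed (intro ic continuous_intros)+
  also have "\<dots> = (\<Sum>i\<in>{j<..<N}. integral {0..1} (\<lambda>t. norm (f j t * h i t)))"
    by (intro integral_sum) (auto intro!: ic continuous_intros)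
  also have "\<dots> \<le> (\<Sum>i\<in>{j<..<N}. 1 / 2 ^ j * (1 / (4 * 2 ^ i)))"
    by (intro sum_mono integral_norm_mult_le continuous_intros)
       (use integral_h_sq integral_f_sq assms in auto)
  also have "\<dots> = 1 / 2 ^ j / 4 * (\<Sum>i\<in>{j<..<N}. 1 / 2 ^ i)"
    by (simp add: sum_distrib_left mult.assoc)
  also have "(\<Sum>i\<in>{j<..<N}. 1 / 2 ^ i) \<le> (1 / 2 ^ j :: real)"
  proof -
    have "(\<Sum>i\<in>{j<..<j + Suc k}. (1 / 2) ^ i) = (1 / 2) ^ j - (1 / 2 :: real) ^ (j + k)" for k
    proof (induction k)
      case (Suc k)
      have "{j<..<j + Suc (Suc k)} = insert (j + Suc k) {j<..<j + Suc k}" by auto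
      then show ?case using Suc by simp
    next
      case 0
      have "{j<..<j + Suc 0} = {}" by auto
      then show ?case by simp
    qed
    from this[of "N - j - 1"] show ?thesis using assms by (simp add: power_one_over)
  qed
  finally have "norm (integral {0..1} (\<lambda>t. (G j t - f j t) * ee (- n) t)) \<le> 1 / 2 ^ j / 4 * (1 / 2 ^ j)"
    by (simp add: divide_right_mono)
  also have "\<dots> = 1 / (4 * 4 ^ j)"
  proof -
    have "(4::real) ^ j = 2 ^ j * 2 ^ j" by (simp flip: power_mult_distrib)
    then show ?thesis by simp
  qed
  finally show ?thesis .
qed

lemma f_coeff:
  "integral {0..1} (\<lambda>t. f j t * ee (- n) t) = (if n \<in> B j then of_real (s n / 4 ^ j) else 0)"
  unfolding f_def by (rule integral_mult_ee) simp

text \<open>Blocks before i do not reach the frequency n, by \<open>G_spectrum\<close>. Block i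
  contributes the sign times 4^-i, and the distortions of the blocks j \<ge> i add up to at most
  (1/4) 4^-i (1 + 1/4 + ...), a third of that.\<close>

lemma F_coeff:
  assumes "n \<in> B i" "i < N"
  shows "Re (of_real (s n) * integral {0..1} (\<lambda>t. F N t * ee (- n) t)) \<ge> 2 / 3 / 4 ^ i"
proof -
  note ic = integrable_continuous_interval
  define I where "I j = integral {0..1} (\<lambda>t. (G j t - f j t) * ee (- n) t)" for j
  have n: "n \<in> E" using assms by (auto simp: B_def)
  have G: "integral {0..1} (\<lambda>t. G j t * ee (- n) t) = I j + integral {0..1} (\<lambda>t. f j t * ee (- n) t)" for j
    unfolding I_def left_diff_distrib
    by (subst integral_diff) (auto intro!: ic continuous_intros)
  have "F N t * ee (- n) t = (\<Sum>j<N. G j t * ee (- n) t)" for t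
    by (simp add: F_def G_def sum_distrib_right)
  then have "integral {0..1} (\<lambda>t. F N t * ee (- n) t) = (\<Sum>j<N. integral {0..1} (\<lambda>t. G j t * ee (- n) t))"
    by (simp only:, subst integral_sum) (auto intro!: ic continuous_intros)
  also have "\<dots> = (\<Sum>j\<in>{i..<N}. integral {0..1} (\<lambda>t. G j t * ee (- n) t))"
  proof (intro sum.mono_neutral_right ballI)
    fix j assume "j \<in> {..<N} - {i..<N}"
    then have "\<tau> (Suc j) \<le> \<tau> i" using assms by (intro \<tau>_le) auto
    then show "integral {0..1} (\<lambda>t. G j t * ee (- n) t) = 0"
      using assms by (intro G_spectrum) (auto simp: B_def)
  qed auto
  also have "\<dots> = (\<Sum>j\<in>{i..<N}. I j) + (\<Sum>j\<in>{i..<N}. if j = i then of_real (s n / 4 ^ i) else 0)"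
    unfolding G f_coeff sum.distrib[symmetric]
  proof (intro sum.cong refl)
    fix j assume "j \<in> {i..<N}"
    then show "I j + (if n \<in> B j then complex_of_real (s n / 4 ^ j) else 0) =
         I j + (if j = i then complex_of_real (s n / 4 ^ i) else 0)"
      using assms B_disjoint[of i j] by auto
  qed
  also have "(\<Sum>j\<in>{i..<N}. if j = i then complex_of_real (s n / 4 ^ i) else 0) = of_real (s n / 4 ^ i)"
    using assms by simp
  finally have eq: "of_real (s n) * integral {0..1} (\<lambda>t. F N t * ee (- n) t)
      = of_real (s n) * (\<Sum>j\<in>{i..<N}. I j) + of_real (s n * s n / 4 ^ i)"
    by (simp add: algebra_simps)
  have "s n * s n = 1"
    using sign[OF n] by (metis abs_mult_self_eq mult.right_neutral)
  then have "Re (of_real (s n) * integral {0..1} (\<lambda>t. F N t * ee (- n) t))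
      = Re (of_real (s n) * (\<Sum>j\<in>{i..<N}. I j)) + 1 / 4 ^ i"
    unfolding eq by simp
  moreover have "norm (of_real (s n) * (\<Sum>j\<in>{i..<N}. I j)) \<le> 1 / 3 / 4 ^ i"
  proof -
    have "norm (of_real (s n) * (\<Sum>j\<in>{i..<N}. I j)) \<le> (\<Sum>j\<in>{i..<N}. norm (I j))"
      using sign[OF n] by (simp add: norm_mult norm_sum)
    also have "\<dots> \<le> (\<Sum>j\<in>{i..<N}. 1 / (4 * 4 ^ j))"
      unfolding I_def using G_coeff by (intro sum_mono) auto
    also have "\<dots> = 1 / 3 / 4 ^ i - 1 / 3 / 4 ^ N"
    proof -
      have "(\<Sum>j\<in>{i..<i + k}. (1 / 4) * (1 / 4) ^ j) = (1 / 3) * (1 / 4) ^ i - (1 / 3) * (1 / 4 :: real) ^ (i + k)" for k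
        by (induction k) auto
      from this[of "N - i"] show ?thesis using assms by (simp add: power_one_over)
    qed
    also have "\<dots> \<le> 1 / 3 / 4 ^ i" by simp
    finally show ?thesis .
  qed
  moreover have "- norm (of_real (s n) * (\<Sum>j\<in>{i..<N}. I j)) \<le> Re (of_real (s n) * (\<Sum>j\<in>{i..<N}. I j))"
    using abs_Re_le_cmod[of "of_real (s n) * (\<Sum>j\<in>{i..<N}. I j)"] by linarith
  moreover have "1 / 4 ^ i - 1 / 3 / 4 ^ i = (2 / 3 / 4 ^ i :: real)" by simp
  ultimately show ?thesis by linarith
qed

end

section \<open>Pairing the test function with the polynomial and with the perturbation\<close>

lemma card_near_le:
  fixes E V :: "int set" and L :: nat
  assumes "finite E" "\<And>n. n \<in> V \<Longrightarrow> \<exists>e\<in>E. \<bar>n - e\<bar> \<le> int L"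
  shows "card V \<le> card E * (2 * L + 1)"
proof -
  have "V \<subseteq> (\<Union>e\<in>E. {e - int L..e + int L})" using assms(2) by fastforce
  then have "card V \<le> card (\<Union>e\<in>E. {e - int L..e + int L})"
    using assms(1) by (intro card_mono) auto
  also have "\<dots> \<le> (\<Sum>e\<in>E. card {e - int L..e + int L})"
    using assms(1) by (rule card_UN_le)
  also have "\<dots> = card E * (2 * L + 1)" by (simp add: nat_add_distrib nat_mult_distrib)
  finally show ?thesis .
qed

context completed_blocks
begin

text \<open>\<open>G j\<close> sees v only up to the cut point \<open>\<tau> (Suc j)\<close>, and
  there v has at most 4^j (2L + 2)^2 nonzero coefficients because they are near E. So the L^2 norm
  of the visible part is at most \<epsilon> 2^j (2L + 2), and the factor 2^j cancels against the L^2
  norm 2^-j of \<open>G j\<close>.\<close>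

lemma perturbation_le:
  assumes j: "j < N" and fin: "finite {n. v n \<noteq> 0}"
    and v: "\<And>n. \<bar>v n\<bar> \<le> \<epsilon>" and \<epsilon>: "\<epsilon> > 0"
    and near: "\<And>n. v n \<noteq> 0 \<Longrightarrow> \<exists>e\<in>E. \<bar>n - e\<bar> \<le> int L"
  shows "norm (integral {0..1} (\<lambda>t. G j t * cnj (tp v t))) \<le> \<epsilon> * (2 * real L + 2)"
proof -
  note ic = integrable_continuous_interval
  define V where "V = {n. v n \<noteq> 0 \<and> n \<le> \<tau> (Suc j)}"
  define v' where "v' n = (if n \<le> \<tau> (Suc j) then v n else 0)" for n
  have finV: "finite V" unfolding V_def using fin by (rule rev_finite_subset) auto
  have coeffs: "integral {0..1} (\<lambda>t. G j t * cnj (\<Sum>n\<in>S. of_real (w n) * ee n t)) =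
      (\<Sum>n\<in>S. of_real (w n) * integral {0..1} (\<lambda>t. G j t * ee (- n) t))" for w :: "int \<Rightarrow> real" and S
  proof (cases "finite S")
    case True
    have "G j t * cnj (\<Sum>n\<in>S. of_real (w n) * ee n t) = (\<Sum>n\<in>S. of_real (w n) * (G j t * ee (- n) t))" for t
      by (simp add: sum_distrib_left mult_ac)
    then show ?thesis
      by (simp only:, subst integral_sum) (auto intro!: ic continuous_intros True)
  qed simp
  have "integral {0..1} (\<lambda>t. G j t * cnj (tp v t)) =
      (\<Sum>n | v n \<noteq> 0. of_real (v n) * integral {0..1} (\<lambda>t. G j t * ee (- n) t))"
    unfolding tp_def by (rule coeffs)
  also have "\<dots> = (\<Sum>n\<in>V. of_real (v n) * integral {0..1} (\<lambda>t. G j t * ee (- n) t))"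
  proof (rule sum.mono_neutral_right[OF fin _ ballI])
    fix i assume "i \<in> {n. v n \<noteq> 0} - V"
    then have "\<tau> (Suc j) < i" by (auto simp: V_def)
    then show "of_real (v i) * integral {0..1} (\<lambda>t. G j t * ee (- i) t) = 0" by (simp add: G_spectrum)
  qed (auto simp: V_def)
  also have "\<dots> = (\<Sum>n\<in>V. of_real (v' n) * integral {0..1} (\<lambda>t. G j t * ee (- n) t))"
    by (intro sum.cong) (auto simp: V_def v'_def)
  also have "\<dots> = integral {0..1} (\<lambda>t. G j t * cnj (tp v' t))"
    unfolding coeffs[symmetric] by (subst tp_eq_sum[OF finV]) (auto simp: V_def v'_def split: if_splits)
  finally have "norm (integral {0..1} (\<lambda>t. G j t * cnj (tp v t)))
      = norm (integral {0..1} (\<lambda>t. G j t * cnj (tp v' t)))" by simp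
  also have "\<dots> \<le> integral {0..1} (\<lambda>t. norm (G j t * cnj (tp v' t)))"
    by (intro integral_norm_bound_integral ic continuous_intros) auto
  also have "\<dots> \<le> 1 / 2 ^ j * (\<epsilon> * 2 ^ j * (2 * real L + 2))"
  proof (rule integral_norm_mult_le)
    have "integral {0..1} (\<lambda>t. (norm (G j t))\<^sup>2) \<le> integral {0..1} (\<lambda>t. (norm (f j t))\<^sup>2)"
      using norm_G_le by (intro integral_le ic continuous_intros power_mono) auto
    then show "integral {0..1} (\<lambda>t. (norm (G j t))\<^sup>2) \<le> (1 / 2 ^ j)\<^sup>2"
      using integral_f_sq[OF j] by simp
  next
    have cV: "card V \<le> card {e\<in>E. e \<le> \<tau> (Suc j) + int L} * (2 * L + 1)"
    proof (rule card_near_le)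
      fix n assume "n \<in> V"
      with near[of n] obtain e where "e \<in> E" "\<bar>n - e\<bar> \<le> int L" "n \<le> \<tau> (Suc j)"
        by (auto simp: V_def)
      then show "\<exists>e\<in>{e\<in>E. e \<le> \<tau> (Suc j) + int L}. \<bar>n - e\<bar> \<le> int L"
        by (intro bexI[of _ e]) auto
    qed (use finE in auto)
    have cE: "card {e\<in>E. e \<le> \<tau> (Suc j) + int L} \<le> 2 * 4 ^ j + L"
    proof -
      \<comment> \<open>Just beyond the cut point E may be arbitrarily dense, but there are only L
        integers in that stretch.\<close>
      have "{e\<in>E. e \<le> \<tau> (Suc j) + int L} \<subseteq> {e\<in>E. e \<le> \<tau> (Suc j)} \<union> {\<tau> (Suc j)<..\<tau> (Suc j) + int L}"
        by auto
      then have "card {e\<in>E. e \<le> \<tau> (Suc j) + int L}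
          \<le> card ({e\<in>E. e \<le> \<tau> (Suc j)} \<union> {\<tau> (Suc j)<..\<tau> (Suc j) + int L})"
        using finE by (intro card_mono) auto
      also have "\<dots> \<le> card {e\<in>E. e \<le> \<tau> (Suc j)} + card {\<tau> (Suc j)<..\<tau> (Suc j) + int L}"
        by (rule card_Un_le)
      also have "card {e\<in>E. e \<le> \<tau> (Suc j)} \<le> 2 * 4 ^ j"
        using card_upto[of "Suc j"] j sum_power4_le[of j] by simp
      finally show ?thesis by simp
    qed
    have "real ((2 * 4 ^ j + L) * (2 * L + 1)) \<le> 4 ^ j * (2 * real L + 2)\<^sup>2"
    proof -
      have "real L * 1 \<le> real L * 4 ^ j" by (intro mult_left_mono) auto
      then have "(2 * 4 ^ j + real L) * (2 * real L + 1) \<le> (2 * 4 ^ j + real L * 4 ^ j) * (2 * real L + 1)"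
        by (intro mult_right_mono) auto
      also have "\<dots> = 4 ^ j * ((2 + real L) * (2 * real L + 1))" by (simp add: algebra_simps)
      also have "\<dots> \<le> 4 ^ j * ((2 * real L + 2) * (2 * real L + 2))"
        by (intro mult_left_mono) (auto simp: algebra_simps)
      finally show ?thesis by (simp add: power2_eq_square algebra_simps)
    qed
    moreover have "card V \<le> (2 * 4 ^ j + L) * (2 * L + 1)"
      using cV mult_right_mono[OF cE, of "2 * L + 1"] by linarith
    ultimately have cardV: "real (card V) \<le> 4 ^ j * (2 * real L + 2)\<^sup>2"
      by linarith
    have "integral {0..1} (\<lambda>t. (norm (cnj (tp v' t)))\<^sup>2) = (\<Sum>n\<in>V. (v' n)\<^sup>2)"
      using parseval_tp[OF finV, of v'] by (auto simp: V_def v'_def split: if_splits)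
    also have "\<dots> \<le> (\<Sum>n\<in>V. \<epsilon>\<^sup>2)"
      using v \<epsilon> by (intro sum_mono abs_le_square_iff[THEN iffD1]) (auto simp: v'_def)
    also have "\<dots> = real (card V) * \<epsilon>\<^sup>2" by simp
    also have "\<dots> \<le> 4 ^ j * (2 * real L + 2)\<^sup>2 * \<epsilon>\<^sup>2"
      using cardV by (intro mult_right_mono) auto
    also have "\<dots> = (\<epsilon> * 2 ^ j * (2 * real L + 2))\<^sup>2"
    proof -
      have "(4::real) ^ j = 2 ^ j * 2 ^ j" by (simp flip: power_mult_distrib)
      then show ?thesis by (simp add: power_mult_distrib power2_eq_square)
    qed
    finally show "integral {0..1} (\<lambda>t. (norm (cnj (tp v' t)))\<^sup>2) \<le> (\<epsilon> * 2 ^ j * (2 * real L + 2))\<^sup>2" .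
  qed (use \<epsilon> in \<open>auto intro!: continuous_intros\<close>)
  also have "\<dots> = \<epsilon> * (2 * real L + 2)" by simp
  finally show ?thesis .
qed

text \<open>Block i has 4^i elements, each contributing at least (2/3) 4^-i by
  \<open>F_coeff\<close>; so every block contributes 2/3, whatever its size.\<close>

lemma main_term_ge:
  assumes a: "\<And>n. n \<in> E \<Longrightarrow> a n = s n * \<bar>a n\<bar>" "\<And>n. n \<in> E \<Longrightarrow> \<bar>a n\<bar> \<ge> 1"
    "\<And>n. n \<notin> E \<Longrightarrow> a n = 0"
  shows "Re (integral {0..1} (\<lambda>t. F N t * cnj (tp a t))) \<ge> 2 / 3 * real N"
proof -
  note ic = integrable_continuous_interval
  define I where "I n = integral {0..1} (\<lambda>t. F N t * ee (- n) t)" for n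
  have contF: "continuous_on S (F k)" for S k
    unfolding F_def[abs_def] by (intro continuous_intros)
  have supp: "n \<in> E" if "a n \<noteq> 0" for n using that a(3) by blast
  have "F N t * cnj (tp a t) = (\<Sum>n\<in>E. of_real (a n) * (F N t * ee (- n) t))" for t
    by (simp add: tp_eq_sum[OF finE supp] sum_distrib_left mult_ac)
  then have "integral {0..1} (\<lambda>t. F N t * cnj (tp a t)) = (\<Sum>n\<in>E. of_real (a n) * I n)"
    unfolding I_def by (simp only:, subst integral_sum) (auto intro!: ic continuous_intros contF finE)
  then have "Re (integral {0..1} (\<lambda>t. F N t * cnj (tp a t))) = (\<Sum>n\<in>E. a n * Re (I n))"
    by simp
  also have "\<dots> = (\<Sum>n\<in>E. \<bar>a n\<bar> * Re (of_real (s n) * I n))"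
  proof (intro sum.cong refl)
    fix n assume "n \<in> E"
    from a(1)[OF this] have "a n * Re (I n) = (s n * \<bar>a n\<bar>) * Re (I n)" by (rule arg_cong)
    then show "a n * Re (I n) = \<bar>a n\<bar> * Re (of_real (s n) * I n)" by (simp add: mult_ac)
  qed
  finally have eq: "Re (integral {0..1} (\<lambda>t. F N t * cnj (tp a t))) = (\<Sum>n\<in>E. \<bar>a n\<bar> * Re (of_real (s n) * I n))" .
  have zero: "I n = 0" if "n \<in> E - (\<Union>i<N. B i)" for n
  proof -
    have gt: "n > \<tau> (Suc j)" if "j < N" for j
    proof (rule ccontr)
      assume "\<not> \<tau> (Suc j) < n"
      then have ex: "\<exists>k. n \<le> \<tau> k" by (auto simp: not_less)
      \<comment> \<open>The first cut point at or above n would either place n in a block or, if it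
        is \<open>\<tau> 0\<close>, contradict that no element of E lies at or below it.\<close>
      define k where "k = (LEAST k. n \<le> \<tau> k)"
      have k: "n \<le> \<tau> k" unfolding k_def using ex by (rule LeastI_ex)
      have "k \<le> Suc j" unfolding k_def using \<open>\<not> \<tau> (Suc j) < n\<close> by (intro Least_le) auto
      show False
      proof (cases k)
        case 0
        have "card {n\<in>E. n \<le> \<tau> 0} = 0" using card_upto[of 0] by simp
        then show False using k 0 \<open>n \<in> E - _\<close> finE by auto
      next
        case (Suc i)
        then have "\<not> n \<le> \<tau> i" using not_less_Least[of i "\<lambda>k. n \<le> \<tau> k"] by (simp add: k_def)
        then show False using k Suc \<open>n \<in> E - _\<close> \<open>k \<le> Suc j\<close> \<open>j < N\<close> by (auto simp: B_def)
      qed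
    qed
    have "integral {0..1} (\<lambda>t. G j t * ee (- n) t) = 0" if "j < N" for j
      by (rule G_spectrum) (rule gt[OF that])
    moreover have "F N t * ee (- n) t = (\<Sum>j<N. G j t * ee (- n) t)" for t
      by (simp add: F_def G_def sum_distrib_right)
    then have "I n = (\<Sum>j<N. integral {0..1} (\<lambda>t. G j t * ee (- n) t))"
      unfolding I_def by (simp only:, subst integral_sum) (auto intro!: ic continuous_intros)
    ultimately show ?thesis by simp
  qed
  have "2 / 3 * real N = (\<Sum>i<N. \<Sum>n\<in>B i. 2 / 3 / 4 ^ i)"
    by (simp add: card_B)
  also have "\<dots> \<le> (\<Sum>i<N. \<Sum>n\<in>B i. \<bar>a n\<bar> * Re (of_real (s n) * I n))"
  proof (intro sum_mono)
    fix i n assume "i \<in> {..<N}" "n \<in> B i"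
    then have "2 / 3 / 4 ^ i \<le> Re (of_real (s n) * I n)"
      unfolding I_def by (intro F_coeff) auto
    moreover have "1 \<le> \<bar>a n\<bar>" using \<open>n \<in> B i\<close> a(2) by (auto simp: B_def)
    ultimately have "1 * (2 / 3 / 4 ^ i) \<le> \<bar>a n\<bar> * Re (of_real (s n) * I n)"
      by (intro mult_mono) auto
    then show "2 / 3 / 4 ^ i \<le> \<bar>a n\<bar> * Re (of_real (s n) * I n)" by simp
  qed
  also have "\<dots> = (\<Sum>n\<in>(\<Union>i<N. B i). \<bar>a n\<bar> * Re (of_real (s n) * I n))"
    by (rule sum.UNION_disjoint[symmetric]) (use B_disjoint in auto)
  also have "\<dots> = (\<Sum>n\<in>E. \<bar>a n\<bar> * Re (of_real (s n) * I n))"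
    by (rule sum.mono_neutral_left) (use finE zero in \<open>auto simp: B_def\<close>)
  finally show ?thesis by (simp add: eq)
qed

end

text \<open>The test function \<open>F N\<close> has sup norm at most 5 sqrt N; its pairing with a
  has real part at least 2N/3, its pairing with v modulus at most N/6. Hence N/2 \<le> 5 sqrt N
  times the L^1 norm of the difference. How many coefficients v has does not enter, only their size
  and their distance from the support of a.\<close>

lemma littlewood_perturbed:
  fixes a v :: "int \<Rightarrow> real" and L N :: nat
  assumes fin: "finite {n. a n \<noteq> 0}" "finite {n. v n \<noteq> 0}"
    and a: "\<And>n. a n \<noteq> 0 \<Longrightarrow> \<bar>a n\<bar> \<ge> 1"
    and v: "\<And>n. \<bar>v n\<bar> \<le> \<epsilon>" and \<epsilon>: "\<epsilon> > 0" "\<epsilon> * (2 * real L + 2) \<le> 1 / 6"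
    and near: "\<And>n. v n \<noteq> 0 \<Longrightarrow> \<exists>e. a e \<noteq> 0 \<and> \<bar>n - e\<bar> \<le> int L"
    and N: "(\<Sum>i<N. 4 ^ i) \<le> card {n. a n \<noteq> 0}"
  shows "sqrt (real N) \<le> 10 * integral {0..1} (\<lambda>t. norm (tp a t - tp v t))"
proof (cases "N = 0")
  case True
  then show ?thesis by (auto intro!: integral_nonneg integrable_continuous_interval continuous_intros)
next
  case False
  note ic = integrable_continuous_interval
  define E where "E = {n. a n \<noteq> 0}"
  have "\<exists>b. card {n\<in>E. n \<le> b} = (\<Sum>i<j. 4 ^ i)" if "j \<le> N" for j
  proof (rule initial_segment_card)
    have "(\<Sum>i<j. 4 ^ i) \<le> (\<Sum>i<N. 4 ^ i :: nat)" using that by (intro sum_mono2) auto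
    then show "(\<Sum>i<j. 4 ^ i) \<le> card E" using N by (simp add: E_def)
  qed (use fin in \<open>simp add: E_def\<close>)
  then have "\<forall>j. \<exists>b. j \<le> N \<longrightarrow> card {n\<in>E. n \<le> b} = (\<Sum>i<j. 4 ^ i)" by blast
  from this[THEN choice] obtain \<tau> where \<tau>: "\<And>j. j \<le> N \<Longrightarrow> card {n\<in>E. n \<le> \<tau> j} = (\<Sum>i<j. 4 ^ i)"
    by blast
  define s where "s n = sgn (a n)" for n
  interpret sign_blocks E s N \<tau>
    by unfold_locales (use fin \<tau> in \<open>auto simp: E_def s_def abs_sgn_eq\<close>)
  have "\<exists>d c. (\<forall>t. Re (\<Sum>k\<le>d. of_real (c k) * ee (- int k) t) = (norm (f j t))\<^sup>2) \<and>
    integral {0..1} (\<lambda>t. (norm (\<Sum>k\<le>d. of_real (c k) * ee (- int k) t))\<^sup>2)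
      \<le> 4 * integral {0..1} (\<lambda>t. (norm (f j t)) ^ 4)" for j
    unfolding f_def by (rule one_sided_completion) simp
  then have "\<forall>j. \<exists>d c. (\<forall>t. Re (\<Sum>k\<le>d. of_real (c k) * ee (- int k) t) = (norm (f j t))\<^sup>2) \<and>
    integral {0..1} (\<lambda>t. (norm (\<Sum>k\<le>d. of_real (c k) * ee (- int k) t))\<^sup>2)
      \<le> 4 * integral {0..1} (\<lambda>t. (norm (f j t)) ^ 4)" by blast
  from this[THEN choice] obtain d where "\<forall>j. \<exists>c. (\<forall>t. Re (\<Sum>k\<le>d j. of_real (c k) * ee (- int k) t) = (norm (f j t))\<^sup>2) \<and>
    integral {0..1} (\<lambda>t. (norm (\<Sum>k\<le>d j. of_real (c k) * ee (- int k) t))\<^sup>2)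
      \<le> 4 * integral {0..1} (\<lambda>t. (norm (f j t)) ^ 4)" ..
  from this[THEN choice] obtain c where dc: "\<And>j t. Re (\<Sum>k\<le>d j. of_real (c j k) * ee (- int k) t) = (norm (f j t))\<^sup>2"
    "\<And>j. integral {0..1} (\<lambda>t. (norm (\<Sum>k\<le>d j. of_real (c j k) * ee (- int k) t))\<^sup>2)
      \<le> 4 * integral {0..1} (\<lambda>t. (norm (f j t)) ^ 4)"
    by blast
  interpret completed_blocks E s N \<tau> d c
    by unfold_locales (use dc in auto)
  have contF: "continuous_on S (F k)" for S k
    unfolding F_def[abs_def] by (intro continuous_intros)
  have "2 / 3 * real N \<le> Re (integral {0..1} (\<lambda>t. F N t * cnj (tp a t)))"
    by (rule main_term_ge) (use a in \<open>auto simp: E_def s_def sgn_mult_abs\<close>)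
  moreover have "norm (integral {0..1} (\<lambda>t. F N t * cnj (tp v t))) \<le> real N / 6"
  proof -
    have "F N t * cnj (tp v t) = (\<Sum>j<N. G j t * cnj (tp v t))" for t
      by (simp add: F_def G_def sum_distrib_right)
    then have "integral {0..1} (\<lambda>t. F N t * cnj (tp v t)) = (\<Sum>j<N. integral {0..1} (\<lambda>t. G j t * cnj (tp v t)))"
      by (simp only:, subst integral_sum) (auto intro!: ic continuous_intros)
    also have "norm \<dots> \<le> (\<Sum>j<N. \<epsilon> * (2 * real L + 2))"
      by (intro sum_norm_le perturbation_le) (use fin v \<epsilon> near in \<open>auto simp: E_def\<close>)
    also have "\<dots> \<le> (\<Sum>j<N. 1 / 6)" by (intro sum_mono \<epsilon>)
    finally show ?thesis by simp
  qed
  moreover have "integral {0..1} (\<lambda>t. F N t * cnj (tp a t - tp v t)) =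
      integral {0..1} (\<lambda>t. F N t * cnj (tp a t)) - integral {0..1} (\<lambda>t. F N t * cnj (tp v t))"
    unfolding complex_cnj_diff right_diff_distrib
    by (intro integral_diff ic continuous_intros contF)
  moreover have "norm (integral {0..1} (\<lambda>t. F N t * cnj (tp a t - tp v t)))
      \<le> integral {0..1} (\<lambda>t. 5 * sqrt (real N) * norm (tp a t - tp v t))"
  proof (rule integral_norm_bound_integral)
    fix t
    have "norm (F N t) \<le> sqrt (real N) + 4 * real N / sqrt (real N)"
      using False by (intro norm_F_le) auto
    also have "\<dots> = 5 * sqrt (real N)"
      using False by (simp add: field_simps flip: power2_eq_square)
    finally show "norm (F N t * cnj (tp a t - tp v t)) \<le> 5 * sqrt (real N) * norm (tp a t - tp v t)"
      unfolding norm_mult complex_mod_cnj by (intro mult_right_mono) auto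
  qed (intro ic continuous_intros contF)+
  moreover have "Re x \<le> norm x" for x :: complex by (rule complex_Re_le_cmod)
  moreover have "real N / 2 \<le> 2 / 3 * real N - real N / 6" by simp
  ultimately have "real N / 2 \<le> integral {0..1} (\<lambda>t. 5 * sqrt (real N) * norm (tp a t - tp v t))"
    by (smt (verit) minus_complex.sel(1))
  then have "sqrt (real N) * sqrt (real N) \<le> sqrt (real N) * (10 * integral {0..1} (\<lambda>t. norm (tp a t - tp v t)))"
    by simp
  then show ?thesis using False by (subst (asm) mult_le_cancel_left_pos) auto
qed

section \<open>Division by polynomials with small roots\<close>

text \<open>Descending induction on Horner's recursion, with j the distance from the top degree. The
  bounds C \<eta>^(n - k) are those of a product of n linear factors with roots of size \<eta>; the
  quotient satisfies bounds of the same shape with n - 1 in place of n.\<close>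

lemma synthetic_div_coeff_bound:
  fixes G :: "real poly"
  assumes \<eta>: "\<bar>x\<bar> \<le> \<eta>" and C: "C \<ge> 0"
    and G: "degree G \<le> n" "\<And>k. k \<le> n \<Longrightarrow> \<bar>coeff G k\<bar> \<le> C * \<eta> ^ (n - k)"
  shows "k + j = n \<Longrightarrow> \<bar>coeff (synthetic_div G x) k\<bar> \<le> real j * C * \<eta> ^ (j - 1)"
proof (induction j arbitrary: k)
  case 0
  have "coeff (synthetic_div G x) k = 0"
  proof (cases "degree G = 0")
    case True
    then show ?thesis by (metis coeff_0 synthetic_div_eq_0_iff)
  next
    case False
    then show ?thesis using 0 G(1) by (intro coeff_eq_0) (simp add: degree_synthetic_div)
  qed
  then show ?case by simp
next
  case (Suc j)
  have "\<eta> \<ge> 0" using \<eta> by linarith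
  have "coeff (G + smult x (synthetic_div G x)) (Suc k) = coeff (synthetic_div G x) k"
    by (simp add: synthetic_div_correct)
  then have "coeff (synthetic_div G x) k = coeff G (Suc k) + x * coeff (synthetic_div G x) (Suc k)"
    by simp
  then have "\<bar>coeff (synthetic_div G x) k\<bar> \<le> \<bar>coeff G (Suc k)\<bar> + \<bar>x\<bar> * \<bar>coeff (synthetic_div G x) (Suc k)\<bar>"
    by (metis abs_mult abs_triangle_ineq)
  also have "\<dots> \<le> C * \<eta> ^ j + \<eta> * (real j * C * \<eta> ^ (j - 1))"
    using G(2)[of "Suc k"] Suc.prems Suc.IH[of "Suc k"] \<eta> \<open>\<eta> \<ge> 0\<close> C
    by (intro add_mono mult_mono) auto
  also have "\<eta> * (real j * C * \<eta> ^ (j - 1)) = real j * C * \<eta> ^ j"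
    by (cases j) auto
  finally show ?case by (simp add: algebra_simps)
qed

lemma poly_abs_le:
  fixes G :: "real poly"
  assumes \<eta>: "\<bar>x\<bar> \<le> \<eta>" and C: "C \<ge> 0"
    and G: "degree G \<le> n" "\<And>k. k \<le> n \<Longrightarrow> \<bar>coeff G k\<bar> \<le> C * \<eta> ^ (n - k)"
  shows "\<bar>poly G x\<bar> \<le> C * (real n + 1) * \<eta> ^ n"
proof -
  have "poly G x = (\<Sum>k\<le>n. coeff G k * x ^ k)"
    unfolding poly_altdef by (rule sum.mono_neutral_left) (use G in \<open>auto simp: le_degree\<close>)
  also have "\<bar>\<dots>\<bar> \<le> (\<Sum>k\<le>n. C * \<eta> ^ n)"
  proof (rule order_trans[OF sum_abs sum_mono])
    fix k assume k: "k \<in> {..n}"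
    have "\<bar>coeff G k * x ^ k\<bar> \<le> C * \<eta> ^ (n - k) * \<eta> ^ k"
      unfolding abs_mult power_abs using G(2)[of k] k \<eta> C
      by (intro mult_mono power_mono) (auto intro: order_trans[OF abs_ge_zero])
    also have "\<dots> = C * \<eta> ^ n" using k by (simp flip: power_add)
    finally show "\<bar>coeff G k * x ^ k\<bar> \<le> C * \<eta> ^ n" .
  qed
  also have "\<dots> = C * (real n + 1) * \<eta> ^ n" by (simp add: algebra_simps)
  finally show ?thesis .
qed

text \<open>Induction on the roots, with one synthetic division each; C grows by a factor n + 1 per
  division while the homogeneous shape of the bounds persists. The weights 4^k for the remainder are
  those of \<open>psdiff_le\<close>, where one second difference can enlarge a sequence by a factor
  of 4.\<close>

lemma divide_by_small_roots:
  fixes G :: "real poly" and C \<eta> :: real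
  assumes "\<And>x. x \<in> set xs \<Longrightarrow> \<bar>x\<bar> \<le> \<eta>" "0 < \<eta>" "\<eta> \<le> 1" "C \<ge> 0" "length xs \<le> n"
    "degree G \<le> n" "\<And>k. k \<le> n \<Longrightarrow> \<bar>coeff G k\<bar> \<le> C * \<eta> ^ (n - k)"
  shows "\<exists>\<Psi> \<rho>. (\<forall>y. poly G y = (\<Prod>x\<leftarrow>xs. y - x) * poly \<Psi> y + poly \<rho> y) \<and>
    degree \<Psi> \<le> n - length xs \<and>
    (\<forall>k \<le> n - length xs. \<bar>coeff \<Psi> k\<bar> \<le> C * (real n + 1) ^ length xs * \<eta> ^ (n - length xs - k)) \<and>
    degree \<rho> \<le> length xs \<and>
    (\<Sum>k\<le>length xs. \<bar>coeff \<rho> k\<bar> * 4 ^ k)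
      \<le> real (length xs) * 5 ^ length xs * C * (real n + 1) ^ length xs * \<eta> ^ (n - length xs)"
  using assms
proof (induction xs arbitrary: G n C)
  case Nil
  then show ?case by (intro exI[of _ G] exI[of _ 0]) auto
next
  case (Cons x xs)
  define K where "K = length xs"
  define G' where "G' = synthetic_div G x"
  define g where "g = poly G x"
  define C' where "C' = C * (real n + 1)"
  have n: "n \<ge> 1" "K \<le> n - 1" using Cons.prems by (auto simp: K_def)
  have \<eta>: "\<eta> > 0" "\<eta> \<le> 1" "\<bar>x\<bar> \<le> \<eta>" "C \<ge> 0" using Cons.prems by auto
  have C': "C' \<ge> 0" using \<eta> by (simp add: C'_def)
  have dG': "degree G' \<le> n - 1" using Cons.prems by (simp add: G'_def degree_synthetic_div)
  have cG': "\<bar>coeff G' k\<bar> \<le> C' * \<eta> ^ (n - 1 - k)" if "k \<le> n - 1" for k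
  proof -
    have "\<bar>coeff G' k\<bar> \<le> real (n - k) * C * \<eta> ^ (n - k - 1)"
      unfolding G'_def by (rule synthetic_div_coeff_bound) (use Cons.prems that n in auto)
    also have "\<dots> \<le> C' * \<eta> ^ (n - k - 1)"
      unfolding C'_def using \<eta> by (intro mult_right_mono) (auto simp: mult.commute intro!: mult_left_mono)
    finally show ?thesis by (simp add: diff_commute)
  qed
  have eq: "poly G y = (y - x) * poly G' y + g" for y
    using arg_cong[OF synthetic_div_correct[of G x], of "\<lambda>p. poly p y"]
    by (simp add: G'_def g_def algebra_simps)
  have g: "\<bar>g\<bar> \<le> C' * \<eta> ^ n"
    unfolding g_def C'_def by (rule poly_abs_le) (use Cons.prems in auto)
  obtain \<Psi> \<rho> where IH: "\<And>y. poly G' y = (\<Prod>x\<leftarrow>xs. y - x) * poly \<Psi> y + poly \<rho> y"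
    "degree \<Psi> \<le> n - 1 - K"
    "\<And>k. k \<le> n - 1 - K \<Longrightarrow> \<bar>coeff \<Psi> k\<bar> \<le> C' * (real (n - 1) + 1) ^ K * \<eta> ^ (n - 1 - K - k)"
    "degree \<rho> \<le> K"
    "(\<Sum>k\<le>K. \<bar>coeff \<rho> k\<bar> * 4 ^ k) \<le> real K * 5 ^ K * C' * (real (n - 1) + 1) ^ K * \<eta> ^ (n - 1 - K)"
    using Cons.IH[of C' "n - 1" G'] Cons.prems C' n dG' cG' unfolding K_def by auto
  have nK: "n - 1 - K = n - Suc K" by simp
  have C'n: "C' * (real (n - 1) + 1) ^ K \<le> C * (real n + 1) ^ Suc K"
  proof -
    have "C' * (real (n - 1) + 1) ^ K \<le> C' * (real n + 1) ^ K"
      using C' by (intro mult_left_mono power_mono) auto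
    then show ?thesis by (simp add: C'_def mult_ac)
  qed
  \<comment> \<open>Inserting the decomposition of the quotient leaves the remainder (y - x) \<rho>
    + g. Multiplication by y - x enlarges the weighted norm by at most 4 + |x| \<le> 5.\<close>
  define \<rho>' where "\<rho>' = pCons g \<rho> - smult x \<rho>"
  have "poly G y = (\<Prod>x\<leftarrow>x # xs. y - x) * poly \<Psi> y + poly \<rho>' y" for y
    by (simp add: eq IH(1) \<rho>'_def algebra_simps)
  moreover have "\<bar>coeff \<Psi> k\<bar> \<le> C * (real n + 1) ^ Suc K * \<eta> ^ (n - Suc K - k)" if "k \<le> n - Suc K" for k
    by (rule order_trans[OF IH(3)[unfolded nK, OF that] mult_right_mono[OF C'n]]) (use \<eta> in auto)
  moreover have "degree \<rho>' \<le> Suc K"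
    unfolding \<rho>'_def using IH(4)
    by (intro degree_diff_le) (auto intro: order_trans[OF degree_smult_le] simp: degree_pCons_le[THEN order_trans])
  moreover have "(\<Sum>k\<le>Suc K. \<bar>coeff \<rho>' k\<bar> * 4 ^ k)
      \<le> real (Suc K) * 5 ^ Suc K * C * (real n + 1) ^ Suc K * \<eta> ^ (n - Suc K)"
  proof -
    define S where "S = (\<Sum>k\<le>K. \<bar>coeff \<rho> k\<bar> * 4 ^ k)"
    define Q where "Q = 5 ^ K * (C * (real n + 1) ^ Suc K) * \<eta> ^ (n - Suc K)"
    have "(\<Sum>k\<le>Suc K. \<bar>coeff \<rho>' k\<bar> * 4 ^ k)
        \<le> (\<Sum>k\<le>Suc K. \<bar>coeff (pCons g \<rho>) k\<bar> * 4 ^ k + \<bar>x\<bar> * (\<bar>coeff \<rho> k\<bar> * 4 ^ k))"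
    proof (rule sum_mono)
      fix k
      have "\<bar>coeff \<rho>' k\<bar> \<le> \<bar>coeff (pCons g \<rho>) k\<bar> + \<bar>x\<bar> * \<bar>coeff \<rho> k\<bar>"
        unfolding \<rho>'_def coeff_diff coeff_smult by (metis abs_mult abs_triangle_ineq4)
      then have "\<bar>coeff \<rho>' k\<bar> * 4 ^ k \<le> (\<bar>coeff (pCons g \<rho>) k\<bar> + \<bar>x\<bar> * \<bar>coeff \<rho> k\<bar>) * 4 ^ k"
        by (rule mult_right_mono) auto
      then show "\<bar>coeff \<rho>' k\<bar> * 4 ^ k \<le> \<bar>coeff (pCons g \<rho>) k\<bar> * 4 ^ k + \<bar>x\<bar> * (\<bar>coeff \<rho> k\<bar> * 4 ^ k)"
        by (simp add: algebra_simps)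
    qed
    also have "\<dots> = (\<Sum>k\<le>Suc K. \<bar>coeff (pCons g \<rho>) k\<bar> * 4 ^ k) + \<bar>x\<bar> * (\<Sum>k\<le>Suc K. \<bar>coeff \<rho> k\<bar> * 4 ^ k)"
      by (simp add: sum.distrib sum_distrib_left distrib_left)
    also have "(\<Sum>k\<le>Suc K. \<bar>coeff \<rho> k\<bar> * 4 ^ k) = S"
      using IH(4) by (simp add: S_def coeff_eq_0)
    also have "(\<Sum>k\<le>Suc K. \<bar>coeff (pCons g \<rho>) k\<bar> * 4 ^ k) = \<bar>g\<bar> + 4 * S"
      by (simp add: sum.atMost_Suc_shift S_def sum_distrib_left mult_ac del: sum.atMost_Suc)
    also have "\<bar>g\<bar> + 4 * S + \<bar>x\<bar> * S \<le> \<bar>g\<bar> + 5 * S"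
    proof -
      have "S \<ge> 0" by (simp add: S_def sum_nonneg)
      then have "\<bar>x\<bar> * S \<le> 1 * S" using \<eta> by (intro mult_right_mono) auto
      then show ?thesis by simp
    qed
    also have "\<bar>g\<bar> + 5 * S \<le> Q + 5 * (real K * Q)"
    proof -
      have "S \<le> real K * Q"
      proof -
        have "S \<le> real K * 5 ^ K * (C' * (real (n - 1) + 1) ^ K) * \<eta> ^ (n - Suc K)"
          using IH(5) by (simp add: S_def mult.assoc)
        also have "\<dots> \<le> real K * 5 ^ K * (C * (real n + 1) ^ Suc K) * \<eta> ^ (n - Suc K)"
          using \<eta> C'n by (intro mult_right_mono mult_left_mono) auto
        finally show ?thesis by (simp add: Q_def mult_ac)
      qed
      moreover have "\<bar>g\<bar> \<le> Q"
      proof -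
        have "C' \<le> C * (real n + 1) ^ Suc K"
          unfolding C'_def using \<eta> power_increasing[of 1 "Suc K" "real n + 1"]
          by (intro mult_left_mono) auto
        also have "\<dots> \<le> 5 ^ K * (C * (real n + 1) ^ Suc K)"
          using \<eta> mult_right_mono[of 1 "5 ^ K" "C * (real n + 1) ^ Suc K"] by simp
        finally have "C' * \<eta> ^ n \<le> 5 ^ K * (C * (real n + 1) ^ Suc K) * \<eta> ^ (n - Suc K)"
          using \<eta> by (intro mult_mono power_decreasing) auto
        then show ?thesis using g by (simp add: Q_def)
      qed
      ultimately show ?thesis by simp
    qed
    also have "Q + 5 * (real K * Q) \<le> real (Suc K) * 5 * Q"
    proof -
      have "Q \<ge> 0" using \<eta> by (simp add: Q_def)
      then show ?thesis by (simp add: algebra_simps)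
    qed
    also have "real (Suc K) * 5 * Q = real (Suc K) * 5 ^ Suc K * C * (real n + 1) ^ Suc K * \<eta> ^ (n - Suc K)"
      by (simp only: Q_def power_Suc mult_ac)
    finally show ?thesis .
  qed
  ultimately show ?case
    using IH(2) by (intro exI[of _ \<Psi>] exI[of _ \<rho>']) (auto simp: K_def)
qed

text \<open>A monomial satisfies the hypotheses of \<open>divide_by_small_roots\<close> with C = 1.
  The quotient only has to be bounded for y between 0 and 4, the range of 2 - 2 cos, so \<eta> is
  replaced by 4 in its estimate; the remainder keeps the tiny factor.\<close>

lemma power_mod_small_roots:
  assumes xs: "\<And>x. x \<in> set xs \<Longrightarrow> \<bar>x\<bar> \<le> \<eta>" and \<eta>: "0 < \<eta>" "\<eta> \<le> 1" and r: "length xs \<le> r"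
  shows "\<exists>\<Psi> \<rho> :: real poly. (\<forall>y. y ^ r = (\<Prod>x\<leftarrow>xs. y - x) * poly \<Psi> y + poly \<rho> y) \<and>
    (\<forall>y. 0 \<le> y \<and> y \<le> 4 \<longrightarrow> \<bar>poly \<Psi> y\<bar> \<le> (real r + 1) ^ Suc (length xs) * 4 ^ r) \<and>
    degree \<rho> \<le> length xs \<and>
    (\<Sum>k\<le>length xs. \<bar>coeff \<rho> k\<bar> * 4 ^ k)
      \<le> real (length xs) * 5 ^ length xs * (real r + 1) ^ length xs * \<eta> ^ (r - length xs)"
proof -
  let ?K = "length xs"
  have "\<exists>\<Psi> \<rho>. (\<forall>y. poly (monom 1 r) y = (\<Prod>x\<leftarrow>xs. y - x) * poly \<Psi> y + poly \<rho> y) \<and>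
    degree \<Psi> \<le> r - ?K \<and>
    (\<forall>k \<le> r - ?K. \<bar>coeff \<Psi> k\<bar> \<le> 1 * (real r + 1) ^ ?K * \<eta> ^ (r - ?K - k)) \<and>
    degree \<rho> \<le> ?K \<and>
    (\<Sum>k\<le>?K. \<bar>coeff \<rho> k\<bar> * 4 ^ k) \<le> real ?K * 5 ^ ?K * 1 * (real r + 1) ^ ?K * \<eta> ^ (r - ?K)"
    by (rule divide_by_small_roots) (use assms in \<open>auto simp: degree_monom_eq\<close>)
  then obtain \<Psi> \<rho> where *: "\<And>y. poly (monom 1 r) y = (\<Prod>x\<leftarrow>xs. y - x) * poly \<Psi> y + poly \<rho> y"
    "degree \<Psi> \<le> r - ?K"
    "\<And>k. k \<le> r - ?K \<Longrightarrow> \<bar>coeff \<Psi> k\<bar> \<le> 1 * (real r + 1) ^ ?K * \<eta> ^ (r - ?K - k)"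
    "degree \<rho> \<le> ?K"
    "(\<Sum>k\<le>?K. \<bar>coeff \<rho> k\<bar> * 4 ^ k) \<le> real ?K * 5 ^ ?K * 1 * (real r + 1) ^ ?K * \<eta> ^ (r - ?K)"
    by blast
  have "\<bar>poly \<Psi> y\<bar> \<le> (real r + 1) ^ Suc ?K * 4 ^ r" if y: "0 \<le> y" "y \<le> 4" for y
  proof -
    have "\<bar>coeff \<Psi> k\<bar> \<le> (real r + 1) ^ ?K * 4 ^ (r - ?K - k)" if "k \<le> r - ?K" for k
    proof -
      have "\<eta> ^ (r - ?K - k) \<le> 4 ^ (r - ?K - k)" using \<eta> by (intro power_mono) auto
      then have "1 * (real r + 1) ^ ?K * \<eta> ^ (r - ?K - k) \<le> (real r + 1) ^ ?K * 4 ^ (r - ?K - k)"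
        by (simp add: mult_left_mono)
      then show ?thesis using *(3)[OF that] by linarith
    qed
    then have "\<bar>poly \<Psi> y\<bar> \<le> (real r + 1) ^ ?K * (real (r - ?K) + 1) * 4 ^ (r - ?K)"
      using y *(2) by (intro poly_abs_le) auto
    also have "\<dots> \<le> (real r + 1) ^ ?K * (real r + 1) * 4 ^ r"
      by (intro mult_mono power_increasing) auto
    finally show ?thesis by (simp add: mult_ac)
  qed
  then show ?thesis using * by (intro exI[of _ \<Psi>] exI[of _ \<rho>]) (auto simp: poly_monom)
qed

section \<open>Sign changes and vanishing differences\<close>

lemma constant_sign_if_no_zero:
  fixes f :: "real \<Rightarrow> real"
  assumes cont: "continuous_on {a..b} f" and nz: "\<And>x. a < x \<Longrightarrow> x < b \<Longrightarrow> f x \<noteq> 0"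
  shows "\<exists>\<sigma>\<in>{1, -1}. \<forall>x\<in>{a..b}. \<sigma> * f x \<ge> 0"
proof (rule ccontr)
  assume "\<not> ?thesis"
  then obtain u v where uv: "u \<in> {a..b}" "v \<in> {a..b}" "f u < 0" "f v > 0"
    by (auto simp: not_le)
  have "\<exists>w. min u v \<le> w \<and> w \<le> max u v \<and> f w = 0"
  proof (cases "u \<le> v")
    case True
    then show ?thesis
      using IVT'[of f u 0 v] uv continuous_on_subset[OF cont, of "{u..v}"] by fastforce
  next
    case False
    then show ?thesis
      using IVT2'[of f u 0 v] uv continuous_on_subset[OF cont, of "{v..u}"] by fastforce
  qed
  then obtain w where w: "min u v \<le> w" "w \<le> max u v" "f w = 0" by blast
  have "w \<noteq> u" "w \<noteq> v" using w uv by auto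
  then have "a < w" "w < b" using w uv by (auto simp: min_def max_def split: if_splits)
  then show False using nz w by blast
qed

text \<open>The last zero is put into \<open>S\<close> iff the sign changes there.\<close>
lemma sign_change_set:
  fixes f :: "real \<Rightarrow> real"
  assumes "continuous_on {0..b} f" "0 \<le> b" "b \<le> pi" "finite {x. 0 < x \<and> x < b \<and> f x = 0}"
  shows "\<exists>S. S \<subseteq> {x. 0 < x \<and> x < b \<and> f x = 0} \<and>
    (\<exists>\<sigma>\<in>{1, -1}. \<forall>x\<in>{0..b}. \<sigma> * (f x * (\<Prod>s\<in>S. cos x - cos s)) \<ge> 0)"
  using assms
proof (induction "card {x. 0 < x \<and> x < b \<and> f x = 0}" arbitrary: b)
  case 0
  then have "f x \<noteq> 0" if "0 < x" "x < b" for x using that by auto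
  from constant_sign_if_no_zero[OF 0(2) this] show ?case by (intro exI[of _ "{}"]) auto
next
  case (Suc n)
  define Z where "Z b = {x. 0 < x \<and> x < b \<and> f x = 0}" for b
  have Z: "finite (Z b)" "card (Z b) = Suc n" using Suc.prems Suc.hyps by (auto simp: Z_def)
  then have "Z b \<noteq> {}" by auto
  define z where "z = Max (Z b)"
  have z: "z \<in> Z b" "\<And>x. x \<in> Z b \<Longrightarrow> x \<le> z"
    using Z \<open>Z b \<noteq> {}\<close> by (auto simp: z_def)
  then have z': "0 < z" "z < b" "f z = 0" by (auto simp: Z_def)
  have "Z b = insert z (Z z)" using z z' by (force simp: Z_def)
  moreover have "z \<notin> Z z" by (simp add: Z_def)
  ultimately have "card (Z z) = n" "finite (Z z)" using Z by auto
  have "\<exists>S. S \<subseteq> {x. 0 < x \<and> x < z \<and> f x = 0} \<and>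
    (\<exists>\<sigma>\<in>{1, -1}. \<forall>x\<in>{0..z}. \<sigma> * (f x * (\<Prod>s\<in>S. cos x - cos s)) \<ge> 0)"
  proof (rule Suc.hyps(1))
    show "continuous_on {0..z} f" using z' by (intro continuous_on_subset[OF Suc.prems(1)]) auto
  qed (use \<open>card (Z z) = n\<close> \<open>finite (Z z)\<close> z' Suc.prems in \<open>auto simp: Z_def\<close>)
  then obtain S \<sigma> where S: "S \<subseteq> Z z" "\<sigma> \<in> {1, -1}"
      "\<And>x. x \<in> {0..z} \<Longrightarrow> \<sigma> * (f x * (\<Prod>s\<in>S. cos x - cos s)) \<ge> 0"
    unfolding Z_def by blast
  have "\<exists>\<tau>\<in>{1, -1}. \<forall>x\<in>{z..b}. \<tau> * f x \<ge> 0"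
  proof (rule constant_sign_if_no_zero)
    show "continuous_on {z..b} f" using z' by (intro continuous_on_subset[OF Suc.prems(1)]) auto
    show "f x \<noteq> 0" if "z < x" "x < b" for x
      using z(2)[of x] z' that by (auto simp: Z_def)
  qed
  then obtain \<tau> where \<tau>: "\<tau> \<in> {1, -1}" "\<And>x. x \<in> {z..b} \<Longrightarrow> \<tau> * f x \<ge> 0" by blast
  have finS: "finite S" using S(1) \<open>finite (Z z)\<close> finite_subset by blast
  \<comment> \<open>All elements of S lie below z and cosine decreases on [0, pi], so to the right
    of z the product has the sign (-1)^(card S).\<close>
  define \<kappa> :: real where "\<kappa> = (-1) ^ card S"
  have \<kappa>: "\<kappa> \<in> {1, -1}" by (cases "even (card S)") (auto simp: \<kappa>_def)
  have prod: "\<kappa> * (\<Prod>s\<in>S. cos x - cos s) \<ge> 0" if "x \<in> {z..b}" for x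
  proof -
    have "\<kappa> * (\<Prod>s\<in>S. cos x - cos s) = (\<Prod>s\<in>S. cos s - cos x)"
      using finS by (simp add: \<kappa>_def flip: prod_constant prod.distrib)
    also have "\<dots> \<ge> 0"
      using that S(1) z' Suc.prems by (intro prod_nonneg) (force simp: Z_def intro!: cos_monotone_0_pi_le)
    finally show ?thesis .
  qed
  have sgn: "\<tau> * f x * (\<kappa> * (\<Prod>s\<in>S. cos x - cos s)) \<ge> 0" if "x \<in> {z..b}" for x
    using \<tau>(2)[OF that] prod[OF that] by (rule mult_nonneg_nonneg)
  show ?case
  proof (cases "\<sigma> = \<tau> * \<kappa>")
    case True
    have "\<sigma> * (f x * (\<Prod>s\<in>S. cos x - cos s)) \<ge> 0" if "x \<in> {0..b}" for x
      using S(3)[of x] sgn[of x] that True by (cases "x \<le> z") (auto simp: mult_ac)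
    then show ?thesis using S z' by (intro exI[of _ S]) (auto simp: Z_def)
  next
    case False
    then have eq: "\<sigma> = - (\<tau> * \<kappa>)" using S(2) \<tau>(1) \<kappa> by auto
    have "\<sigma> * (f x * (\<Prod>s\<in>insert z S. cos x - cos s)) \<ge> 0" if x: "x \<in> {0..b}" for x
    proof -
      have "z \<notin> S" using S(1) by (auto simp: Z_def)
      then have p: "(\<Prod>s\<in>insert z S. cos x - cos s) = (cos x - cos z) * (\<Prod>s\<in>S. cos x - cos s)"
        using finS by simp
      show ?thesis
      proof (cases "x \<le> z")
        case True
        then have "cos x - cos z \<ge> 0"
          using x z' Suc.prems by (simp add: cos_monotone_0_pi_le)
        then have "(cos x - cos z) * (\<sigma> * (f x * (\<Prod>s\<in>S. cos x - cos s))) \<ge> 0"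
          by (rule mult_nonneg_nonneg) (use S(3)[of x] True x in auto)
        then show ?thesis unfolding p by (simp add: mult_ac)
      next
        case False
        then have "cos z - cos x \<ge> 0"
          using x z' Suc.prems by (simp add: cos_monotone_0_pi_le)
        then have "(cos z - cos x) * (\<tau> * f x * (\<kappa> * (\<Prod>s\<in>S. cos x - cos s))) \<ge> 0"
          by (rule mult_nonneg_nonneg) (use sgn[of x] False x in auto)
        then show ?thesis unfolding p eq by (simp add: algebra_simps)
      qed
    qed
    then show ?thesis using S z' by (intro exI[of _ "insert z S"]) (auto simp: Z_def)
  qed
qed

section \<open>Differences with step m of bounded integer sequences\<close>

definition fdiff :: "int \<Rightarrow> (int \<Rightarrow> int) \<Rightarrow> int \<Rightarrow> int" where
  "fdiff m g n = g (n + m) - g n"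

text \<open>The action on Fourier coefficients of multiplication by 2 - 2 cos(m \<theta>). It is
  polymorphic because it is applied to integer sequences, for integrality, and to real ones, for
  estimates.\<close>

definition sdiff :: "int \<Rightarrow> (int \<Rightarrow> 'a::comm_ring_1) \<Rightarrow> int \<Rightarrow> 'a" where
  "sdiff m g n = 2 * g n - g (n - m) - g (n + m)"

lemma funpow_sdiff: "(sdiff m ^^ r) g n = (-1) ^ r * (fdiff m ^^ (2 * r)) g (n - int r * m)"
proof (induction r arbitrary: n)
  case (Suc r)
  define X where "X = (fdiff m ^^ (2 * r)) g"
  have "(sdiff m ^^ r) g = (\<lambda>n. (-1) ^ r * X (n - int r * m))"
    using Suc by (simp add: X_def fun_eq_iff)
  then have "(sdiff m ^^ Suc r) g n = sdiff m (\<lambda>n. (-1) ^ r * X (n - int r * m)) n"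
    by simp
  also have "\<dots> = (-1) ^ Suc r * fdiff m (fdiff m X) (n - int (Suc r) * m)"
    by (simp add: sdiff_def fdiff_def algebra_simps)
  finally show ?case by (simp add: X_def)
qed simp

lemma funpow_fdiff_bounded:
  assumes "\<And>n. \<bar>g n\<bar> \<le> R"
  shows "\<bar>(fdiff m ^^ d) g n\<bar> \<le> 2 ^ d * R"
proof (induction d arbitrary: n)
  case (Suc d)
  show ?case using Suc[of n] Suc[of "n + m"] by (simp add: fdiff_def)
qed (use assms in simp)

text \<open>If a difference u of positive order has vanishing difference on a long stretch, it is
  constant along progressions of step m. A nonzero integer constant would make the difference of the
  next lower order grow linearly beyond its bound 2^d R. So u vanishes except near the right end,
  and the order can be lowered repeatedly, at a cost that doubles with the order.\<close>

lemma vanishing_difference: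
  assumes R: "\<And>n. \<bar>g n\<bar> \<le> R" and m: "m > 0"
    and "\<And>n. a \<le> n \<Longrightarrow> n \<le> b \<Longrightarrow> (fdiff m ^^ Suc d) g n = 0"
    and "a \<le> n" "n \<le> b - 2 ^ Suc d * R * m"
  shows "fdiff m g n = 0"
  using assms(3-)
proof (induction d arbitrary: b n)
  case 0
  have "R \<ge> 0" using R[of 0] by linarith
  then have "n \<le> b" using 0 m by (smt (verit) mult_nonneg_nonneg zero_le_power)
  then show ?case using 0 by simp
next
  case (Suc d)
  have "R \<ge> 0" using R[of 0] by linarith
  define w where "w = (fdiff m ^^ d) g"
  define u where "u = fdiff m w"
  have const: "u (k + m) = u k" if "a \<le> k" "k \<le> b" for k
  proof -
    have "fdiff m u k = 0" using Suc.prems(1)[OF that] by (simp add: u_def w_def)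
    then show ?thesis by (simp add: fdiff_def)
  qed
  have "u k = 0" if k: "a \<le> k" "k \<le> b - 2 ^ Suc d * R * m" for k
  proof (rule ccontr)
    assume "u k \<noteq> 0"
    have iter: "u (k + int i * m) = u k \<and> w (k + int i * m) = w k + int i * u k"
      if "k + (int i - 1) * m \<le> b" for i
      using that
    proof (induction i)
      case (Suc i)
      have "k + int i * m \<le> b" using Suc.prems by simp
      moreover have "k + (int i - 1) * m \<le> b" using calculation m by (simp add: algebra_simps)
      moreover have "a \<le> k + int i * m" using k m by (simp add: add_increasing2)
      ultimately have "u (k + int i * m + m) = u k" "w (k + int i * m) = w k + int i * u k" "u (k + int i * m) = u k"
        using Suc.IH const[of "k + int i * m"] by auto
      moreover have "w (k + int i * m + m) = w (k + int i * m) + u (k + int i * m)"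
        by (simp add: u_def fdiff_def)
      ultimately show ?case by (simp add: algebra_simps)
    qed auto
    \<comment> \<open>This many steps make the linear growth exceed the oscillation 2 * 2^d R by
      one, and the last step still starts at or below b.\<close>
    define i where "i = nat (2 ^ Suc d * R) + 1"
    have i: "int i = 2 ^ Suc d * R + 1" using \<open>R \<ge> 0\<close> by (simp add: i_def)
    have "k + (int i - 1) * m \<le> b" using k unfolding i by simp
    then have "int i * u k = w (k + int i * m) - w k" using iter by simp
    moreover have "\<bar>w j\<bar> \<le> 2 ^ d * R" for j
      unfolding w_def by (rule funpow_fdiff_bounded) (rule R)
    then have "\<bar>w k\<bar> \<le> 2 ^ d * R" "\<bar>w (k + int i * m)\<bar> \<le> 2 ^ d * R" by blast+
    ultimately have "\<bar>int i * u k\<bar> \<le> 2 * (2 ^ d * R)" by linarith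
    moreover have "int i * 1 \<le> \<bar>int i * u k\<bar>"
      unfolding abs_mult using \<open>u k \<noteq> 0\<close> by (intro mult_mono) auto
    ultimately show False using i by simp
  qed
  then have "fdiff m g n = 0" if "n \<le> b - 2 ^ Suc d * R * m - 2 ^ Suc d * R * m"
    using Suc.IH[of "b - 2 ^ Suc d * R * m" n] Suc.prems(2) that by (simp add: u_def w_def)
  then show ?case using Suc.prems by (simp add: algebra_simps)
qed

text \<open>The margin has two parts: r m, as \<open>sdiff\<close> is centred whereas
  \<open>fdiff\<close> looks forward, and 2^(2r) R m, which \<open>vanishing_difference\<close>
  loses at the right end.\<close>

lemma periodic_near_if_sdiff_vanishes:
  assumes R: "\<And>n. \<bar>g n\<bar> \<le> R" and m: "m > 0" and r: "r > 0"
    and vanish: "\<And>n. \<bar>n - n0\<bar> \<le> w + (int r + 2 ^ (2 * r) * R) * m \<Longrightarrow> (sdiff m ^^ r) g n = 0"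
    and n: "\<bar>n - n0\<bar> \<le> w"
  shows "g (n + m) = g n"
proof -
  define L where "L = w + (int r + 2 ^ (2 * r) * R) * m"
  have "R \<ge> 0" using R[of 0] by linarith
  then have rm: "int r * m \<ge> 0" "2 ^ (2 * r) * R * m \<ge> 0" using m by auto
  have Suc: "Suc (2 * r - 1) = 2 * r" using r by simp
  have "fdiff m g n = 0"
  proof (rule vanishing_difference[where a = "n0 - L - int r * m" and b = "n0 + L - int r * m" and d = "2 * r - 1", OF R m])
    fix k assume "n0 - L - int r * m \<le> k" "k \<le> n0 + L - int r * m"
    then have "\<bar>k + int r * m - n0\<bar> \<le> L" by linarith
    from vanish[OF this[unfolded L_def]] show "(fdiff m ^^ Suc (2 * r - 1)) g k = 0"
      unfolding Suc by (simp add: funpow_sdiff)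
  next
    show "n0 - L - int r * m \<le> n" using n rm by (simp add: L_def algebra_simps)
    show "n \<le> n0 + L - int r * m - 2 ^ Suc (2 * r - 1) * R * m"
      unfolding Suc using n by (simp add: L_def algebra_simps)
  qed
  then show ?thesis by (simp add: fdiff_def)
qed

section \<open>Sums of few sines\<close>

lemma integral_cos_le:
  assumes "a > 0" "u \<le> v"
  shows "\<bar>integral {u..v} (\<lambda>x::real. cos (a * x))\<bar> \<le> 2 / a"
proof -
  have "((\<lambda>x. cos (a * x)) has_integral (sin (a * v) / a - sin (a * u) / a)) {u..v}"
    using assms
    by (intro fundamental_theorem_of_calculus)
       (auto intro!: derivative_eq_intros simp flip: has_real_derivative_iff_has_vector_derivative)
  then have "\<bar>integral {u..v} (\<lambda>x. cos (a * x))\<bar> = \<bar>sin (a * v) - sin (a * u)\<bar> / a"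
    using assms by (simp add: integral_unique abs_divide flip: diff_divide_distrib)
  also have "\<dots> \<le> 2 / a"
    using assms sin_le_one[of "a * v"] sin_ge_minus_one[of "a * v"] sin_le_one[of "a * u"] sin_ge_minus_one[of "a * u"]
    by (intro divide_right_mono) linarith+
  finally show ?thesis .
qed

lemma integral_sin_le:
  assumes "a > 0" "u \<le> v"
  shows "\<bar>integral {u..v} (\<lambda>x::real. sin (a * x))\<bar> \<le> 2 / a"
proof -
  have "((\<lambda>x. sin (a * x)) has_integral (- cos (a * v) / a - (- cos (a * u) / a))) {u..v}"
    using assms
    by (intro fundamental_theorem_of_calculus)
       (auto intro!: derivative_eq_intros simp flip: has_real_derivative_iff_has_vector_derivative)
  then have "\<bar>integral {u..v} (\<lambda>x. sin (a * x))\<bar> = \<bar>cos (a * u) - cos (a * v)\<bar> / a"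
    using assms by (simp add: integral_unique abs_divide flip: diff_divide_distrib)
  also have "\<dots> \<le> 2 / a"
    using assms cos_le_one[of "a * v"] cos_ge_minus_one[of "a * v"] cos_le_one[of "a * u"] cos_ge_minus_one[of "a * u"]
    by (intro divide_right_mono) linarith+
  finally show ?thesis .
qed

text \<open>Pigeonhole: the windows from H0 T^(3k-1) to H0 T^(3k+1) are pairwise disjoint, the
  exponent 3 leaving a gap between neighbours, and there is one window more than there are
  points.\<close>

lemma scale_avoiding:
  fixes Q :: "real set"
  assumes Q: "finite Q" and T: "T > 1" and H0: "H0 > 0"
  shows "\<exists>k\<in>{1..card Q + 1}. \<forall>q\<in>Q. q < H0 * T ^ (3 * k) / T \<or> q > H0 * T ^ (3 * k) * T"
proof (rule ccontr)
  define J where "J q = {k\<in>{1..card Q + 1}. H0 * T ^ (3 * k) / T \<le> q \<and> q \<le> H0 * T ^ (3 * k) * T}" for q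
  assume "\<not> ?thesis"
  then have "{1..card Q + 1} \<subseteq> (\<Union>q\<in>Q. J q)" by (fastforce simp: J_def not_less)
  then have "card {1..card Q + 1} \<le> card (\<Union>q\<in>Q. J q)"
    using Q by (intro card_mono) (auto simp: J_def)
  also have "\<dots> \<le> (\<Sum>q\<in>Q. card (J q))" using Q by (rule card_UN_le)
  also have "\<dots> \<le> (\<Sum>q\<in>Q. 1)"
  proof (rule sum_mono)
    fix q
    have False if "k \<in> J q" "l \<in> J q" "k < l" for k l
    proof -
      have "H0 * T ^ (3 * l) / T \<le> H0 * T ^ (3 * k) * T" using that by (auto simp: J_def)
      then have "T ^ (3 * l) \<le> T ^ (3 * k) * T * T" using H0 T by (simp add: field_simps)
      also have "\<dots> = T ^ (3 * k + 2)" by (simp add: power_add power2_eq_square)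
      finally have "3 * l \<le> 3 * k + 2" using T power_le_imp_le_exp by blast
      then show False using \<open>k < l\<close> by simp
    qed
    then have "is_singleton (J q) \<or> J q = {}"
      by (metis is_singletonI' linorder_neqE_nat)
    then show "card (J q) \<le> 1" by (auto simp: is_singleton_altdef)
  qed
  finally show False by simp
qed

text \<open>The gap condition makes "closer than h" an equivalence relation. Replacing each y by a
  representative of its class changes the sum by at most 2h per term, and the new sum vanishes since
  every class has total weight 0.\<close>

lemma cluster_decomposition:
  fixes \<tau> y :: "'i \<Rightarrow> real" and h :: real
  assumes I: "finite I" and \<tau>: "\<And>i. i \<in> I \<Longrightarrow> \<bar>\<tau> i\<bar> \<le> 2" and h: "h > 0"
    and gap: "\<And>i j. i \<in> I \<Longrightarrow> j \<in> I \<Longrightarrow> \<bar>y i - y j\<bar> < 2 * h \<Longrightarrow> \<bar>y i - y j\<bar> < h"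
    and zero: "\<And>i. i \<in> I \<Longrightarrow> (\<Sum>j\<in>{j\<in>I. \<bar>y j - y i\<bar> < h}. \<tau> j) = 0"
  shows "\<bar>\<Sum>i\<in>I. \<tau> i * y i\<bar> \<le> 2 * real (card I) * h"
proof -
  define C where "C i = {j\<in>I. \<bar>y j - y i\<bar> < h}" for i
  \<comment> \<open>The minimum serves as representative because it depends on the set
    \<open>C i\<close> alone.\<close>
  define y' where "y' i = Min (y ` C i)" for i
  have C: "finite (C i)" for i using I by (simp add: C_def)
  have in_C: "i \<in> C i" if "i \<in> I" for i using that h by (simp add: C_def)
  have C_eq: "C i = C j" if "i \<in> I" "j \<in> C i" for i j
  proof -
    have "C j \<subseteq> C i" if "i \<in> I" "j \<in> C i" for i j
    proof
      fix l assume "l \<in> C j"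
      then have "\<bar>y l - y i\<bar> < 2 * h" "l \<in> I" using \<open>j \<in> C i\<close> by (auto simp: C_def)
      then show "l \<in> C i" using gap[of l i] \<open>i \<in> I\<close> by (auto simp: C_def)
    qed
    moreover have "j \<in> I" "i \<in> C j" using that by (auto simp: C_def abs_minus_commute)
    ultimately show ?thesis using that by blast
  qed
  have y': "\<exists>l\<in>C i. y' i = y l" if "i \<in> I" for i
  proof -
    have "Min (y ` C i) \<in> y ` C i" using C[of i] in_C[OF that] by (intro Min_in) auto
    then show ?thesis by (auto simp: y'_def)
  qed
  have fiber: "{j\<in>I. y' j = y' i} = C i" if "i \<in> I" for i
  proof (intro equalityI subsetI)
    fix j assume "j \<in> {j\<in>I. y' j = y' i}"
    then have j: "j \<in> I" "y' j = y' i" by auto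
    from y'[OF that] obtain l where l: "l \<in> C i" "y' i = y l" by blast
    from y'[OF j(1)] obtain l' where l': "l' \<in> C j" "y' j = y l'" by blast
    have "l' \<in> C l" using l l' j h by (auto simp: C_def)
    then have "l' \<in> C i" using C_eq[OF that l(1)] by simp
    have "l' \<in> I" using l' by (auto simp: C_def)
    have "C i = C l'" "C j = C l'" using C_eq[OF that \<open>l' \<in> C i\<close>] C_eq[OF j(1) l'(1)] by auto
    then show "j \<in> C i" using in_C[OF j(1)] by simp
  next
    fix j assume "j \<in> C i"
    then have "C i = C j" "j \<in> I" using C_eq[OF that] by (auto simp: C_def)
    then show "j \<in> {j\<in>I. y' j = y' i}" by (simp add: y'_def)
  qed
  have "(\<Sum>i\<in>I. \<tau> i * y' i) = (\<Sum>v\<in>y' ` I. \<Sum>i\<in>{i\<in>I. y' i = v}. \<tau> i * y' i)"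
    by (rule sum.group[symmetric]) (use I in auto)
  also have "\<dots> = 0"
  proof (rule sum.neutral, rule ballI)
    fix v assume "v \<in> y' ` I"
    then obtain i where i: "i \<in> I" "v = y' i" by auto
    have "(\<Sum>j\<in>{j\<in>I. y' j = v}. \<tau> j * y' j) = (\<Sum>j\<in>C i. \<tau> j * v)"
      using fiber[OF i(1)] i by (intro sum.cong) auto
    also have "\<dots> = (\<Sum>j\<in>C i. \<tau> j) * v" by (simp add: sum_distrib_right)
    also have "(\<Sum>j\<in>C i. \<tau> j) = 0" using zero[OF i(1)] by (simp add: C_def)
    finally show "(\<Sum>j\<in>{j\<in>I. y' j = v}. \<tau> j * y' j) = 0" by simp
  qed
  finally have "(\<Sum>i\<in>I. \<tau> i * y i) = (\<Sum>i\<in>I. \<tau> i * (y i - y' i))"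
    by (simp add: right_diff_distrib sum_subtractf)
  also have "\<bar>\<dots>\<bar> \<le> (\<Sum>i\<in>I. 2 * h)"
  proof (rule order_trans[OF sum_abs sum_mono])
    fix i assume "i \<in> I"
    then obtain l where "l \<in> C i" "y' i = y l" using y' by blast
    then have "\<bar>y i - y' i\<bar> \<le> h" by (auto simp: C_def)
    then show "\<bar>\<tau> i * (y i - y' i)\<bar> \<le> 2 * h"
      unfolding abs_mult using \<tau>[OF \<open>i \<in> I\<close>] by (intro mult_mono) auto
  qed
  finally show ?thesis by simp
qed

text \<open>At a scale \<open>H\<close> that is far from all frequencies, their differences and the zeros, the sum has
  mean almost zero on \<open>{1 / (2 * H)..1 / H}\<close>, but correlates with a single sine.\<close>
lemma sine_sum_sign_change:
  fixes \<tau> y :: "'i \<Rightarrow> real" and I :: "'i set"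
  defines "g \<equiv> \<lambda>x. \<Sum>i\<in>I. \<tau> i * sin (y i * x)"
  assumes I: "finite I" and \<tau>: "\<And>i. i \<in> I \<Longrightarrow> \<bar>\<tau> i\<bar> \<le> 2" and y: "\<And>i. i \<in> I \<Longrightarrow> y i \<ge> 0"
    and int: "\<And>i. i \<in> I \<Longrightarrow> \<tau> i \<in> \<int>"
    and T: "T \<ge> 100 * (real (card I) + 1)" and H: "H > 0"
    and scale: "\<And>i. i \<in> I \<Longrightarrow> y i < H / T \<or> y i > H * T"
      "\<And>i j. i \<in> I \<Longrightarrow> j \<in> I \<Longrightarrow> \<bar>y i - y j\<bar> < H / T \<or> \<bar>y i - y j\<bar> > H * T"
    and nz: "\<And>x. 1 / (2 * H) < x \<Longrightarrow> x < 1 / H \<Longrightarrow> g x \<noteq> 0"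
  shows "\<bar>\<Sum>i\<in>I. \<tau> i * y i\<bar> < H"
proof -
  note ic = integrable_continuous_interval
  define u v len where "u = 1 / (2 * H)" and "v = 1 / H" and "len = 1 / (2 * H)"
  define M where "M = real (card I)"
  have M: "M \<ge> 0" by (simp add: M_def)
  have T': "T \<ge> 100" "T > 50 * M" "T > 0" using T M by (auto simp: M_def)
  have uv: "0 < u" "u \<le> v" "v - u = len" "len > 0" using H by (auto simp: u_def v_def len_def field_simps)
  have lT: "2 / (H * T) = 4 * len / T" using H by (simp add: len_def field_simps)
  \<comment> \<open>By the choice of the scale, the other frequencies are below H / T, and their
    sines are at most 1 / T on the interval from u to v.\<close>
  define High where "High = {i\<in>I. y i > H * T}"
  have finHigh: "finite High" using I by (simp add: High_def)
  have HT: "H / T < H * T" "2 * (H / T) \<le> H * T"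
  proof -
    have "H * 2 \<le> H * (T * T)" using H T' mult_mono[of 2 T 1 T] by (intro mult_left_mono) auto
    then show "2 * (H / T) \<le> H * T" using T' by (simp add: field_simps)
    then show "H / T < H * T" using H T' by (smt (verit) divide_pos_pos)
  qed
  define C where "C i = {j\<in>I. \<bar>y j - y i\<bar> < H / T}" for i
  have C_High: "C i = {j\<in>High. \<bar>y j - y i\<bar> < H / T}" if "i \<in> High" for i
    using that scale(1) HT by (fastforce simp: C_def High_def)
  consider "\<And>i. i \<in> High \<Longrightarrow> (\<Sum>j\<in>C i. \<tau> j) = 0" | i where "i \<in> High" "(\<Sum>j\<in>C i. \<tau> j) \<noteq> 0"
    by blast
  then show ?thesis
  proof cases
    \<comment> \<open>If all clusters of high frequencies cancel, high and low frequencies each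
      contribute at most 2 M H / T to the sum to be bounded.\<close>
    case 1
    have "\<bar>\<Sum>i\<in>High. \<tau> i * y i\<bar> \<le> 2 * real (card High) * (H / T)"
    proof (rule cluster_decomposition[OF finHigh])
      show "\<bar>y i - y j\<bar> < H / T" if "i \<in> High" "j \<in> High" "\<bar>y i - y j\<bar> < 2 * (H / T)" for i j
        using scale(2)[of i j] that HT by (auto simp: High_def)
      show "(\<Sum>j\<in>{j\<in>High. \<bar>y j - y i\<bar> < H / T}. \<tau> j) = 0" if "i \<in> High" for i
        using 1[OF that] C_High[OF that] by simp
    qed (use \<tau> H T' in \<open>auto simp: High_def\<close>)
    also have "\<dots> \<le> 2 * M * (H / T)"
      using I H T' by (intro mult_right_mono mult_left_mono) (auto simp: M_def High_def intro: card_mono)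
    finally have high: "\<bar>\<Sum>i\<in>High. \<tau> i * y i\<bar> \<le> 2 * M * (H / T)" .
    have "\<bar>\<Sum>i\<in>I - High. \<tau> i * y i\<bar> \<le> (\<Sum>i\<in>I - High. 2 * (H / T))"
    proof (rule order_trans[OF sum_abs sum_mono])
      fix i assume "i \<in> I - High"
      then have "\<bar>y i\<bar> \<le> H / T" using scale(1)[of i] y[of i] by (auto simp: High_def)
      then show "\<bar>\<tau> i * y i\<bar> \<le> 2 * (H / T)"
        unfolding abs_mult using \<tau>[of i] \<open>i \<in> I - High\<close> by (intro mult_mono) auto
    qed
    also have "\<dots> = 2 * real (card (I - High)) * (H / T)" by simp
    also have "\<dots> \<le> 2 * M * (H / T)"
      using I H T' by (intro mult_right_mono mult_left_mono) (auto simp: M_def intro: card_mono)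
    finally have low: "\<bar>\<Sum>i\<in>I - High. \<tau> i * y i\<bar> \<le> 2 * M * (H / T)" .
    have "(\<Sum>i\<in>I. \<tau> i * y i) = (\<Sum>i\<in>I - High. \<tau> i * y i) + (\<Sum>i\<in>High. \<tau> i * y i)"
      by (rule sum.subset_diff) (use I in \<open>auto simp: High_def\<close>)
    then have "\<bar>\<Sum>i\<in>I. \<tau> i * y i\<bar> \<le> 4 * M * (H / T)" using low high by linarith
    also have "\<dots> < H"
    proof -
      have "4 * M < T" using T' M by linarith
      then have "H * (4 * M) < H * T" using H by simp
      then show ?thesis using T' by (simp add: field_simps)
    qed
    finally show ?thesis .
  next
    case (2 i)
    define Y where "Y = y i"
    have Y: "Y > H * T" "i \<in> I" using 2 by (auto simp: Y_def High_def)
    have HT0: "H * T > 0" using H T' by simp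
    have large_freq: "2 / a \<le> 4 * len / T" if "a > H * T" for a
      unfolding lT[symmetric] using that HT0 by (intro divide_left_mono) auto
    define s where "s j = integral {u..v} (\<lambda>x. sin (y j * x) * sin (Y * x))" for j
    \<comment> \<open>Product to sum: y j + Y exceeds H T, so its cosine averages out. The
      difference is either above H T, with the same effect, or below H / T, where its cosine is
      nearly 1. So testing with sin(Y x) isolates the cluster of Y.\<close>
    have s: "\<bar>2 * s j - (if j \<in> C i then len else 0)\<bar> \<le> 8 * len / T" if "j \<in> I" for j
    proof -
      define a where "a = \<bar>y j - Y\<bar>"
      have "2 * (sin (y j * x) * sin (Y * x)) = cos (a * x) - cos ((y j + Y) * x)" for x
      proof -
        have "cos (a * x) = cos ((y j - Y) * x)"
          by (cases "y j \<ge> Y") (auto simp: a_def left_diff_distrib, metis cos_minus minus_diff_eq)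
        then show ?thesis by (simp add: left_diff_distrib distrib_right cos_add cos_diff)
      qed
      then have "2 * s j = integral {u..v} (\<lambda>x. cos (a * x) - cos ((y j + Y) * x))"
        unfolding s_def by (subst integral_mult_right[symmetric]) simp
      also have "\<dots> = integral {u..v} (\<lambda>x. cos (a * x)) - integral {u..v} (\<lambda>x. cos ((y j + Y) * x))"
        by (intro integral_diff ic continuous_intros)
      finally have eq: "2 * s j = \<dots>" .
      have "\<bar>integral {u..v} (\<lambda>x. cos ((y j + Y) * x))\<bar> \<le> 2 / (y j + Y)"
        using Y y[OF that] HT0 uv by (intro integral_cos_le) auto
      also have "\<dots> \<le> 4 * len / T" using Y y[OF that] by (intro large_freq) auto
      finally have plus: "\<bar>integral {u..v} (\<lambda>x. cos ((y j + Y) * x))\<bar> \<le> 4 * len / T" .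
      show ?thesis
      proof (cases "j \<in> C i")
        case True
        then have a: "0 \<le> a" "a < H / T" by (auto simp: C_def a_def Y_def)
        have "\<bar>integral {u..v} (\<lambda>x. cos (a * x)) - len\<bar> = \<bar>integral {u..v} (\<lambda>x. cos (a * x) - 1)\<bar>"
          using uv by (subst integral_diff) (auto intro!: ic continuous_intros)
        also have "\<dots> = norm (integral {u..v} (\<lambda>x. cos (a * x) - 1))" by simp
        also have "\<dots> \<le> integral {u..v} (\<lambda>x. 1 / T)"
        proof (rule integral_norm_bound_integral)
          fix x assume x: "x \<in> {u..v}"
          have "a * x \<le> (H / T) * (1 / H)"
            using a x uv H T' by (intro mult_mono) (auto simp: v_def)
          then have ax: "0 \<le> a * x" "a * x \<le> 1 / T" using a x uv H by auto
          have "1 - cos (a * x) = 2 * (sin (a * x / 2))\<^sup>2"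
            using cos_double_sin[of "a * x / 2"] by simp
          also have "\<dots> \<le> 2 * (a * x / 2)\<^sup>2"
            by (intro mult_left_mono abs_le_square_iff[THEN iffD1, OF abs_sin_x_le_abs_x]) auto
          also have "2 * (a * x / 2)\<^sup>2 = (a * x) * (a * x) / 2" by (simp add: power2_eq_square)
          also have "\<dots> \<le> (1 / T) * 1 / 2"
            using ax T' by (intro divide_right_mono mult_mono) (auto intro: order_trans)
          also have "\<dots> \<le> 1 / T" using T' by (simp add: field_simps)
          finally have "1 - cos (a * x) \<le> 1 / T" .
          then show "norm (cos (a * x) - 1) \<le> 1 / T" using cos_le_one[of "a * x"] by simp
        qed (intro ic continuous_intros)+
        also have "\<dots> = len / T" using uv by simp
        finally have "\<bar>integral {u..v} (\<lambda>x. cos (a * x)) - len\<bar> \<le> len / T" .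
        moreover have "4 * len / T = 4 * (len / T)" "8 * len / T = 8 * (len / T)" "len / T \<ge> 0"
          using uv T' by auto
        ultimately have "\<bar>2 * s j - len\<bar> \<le> 8 * len / T" using plus unfolding eq by linarith
        then show ?thesis using True by simp
      next
        case False
        then have "a > H * T" using scale(2)[OF that Y(2)] that by (auto simp: C_def a_def Y_def)
        then have "\<bar>integral {u..v} (\<lambda>x. cos (a * x))\<bar> \<le> 4 * len / T"
          using integral_cos_le[of a u v] large_freq[of a] uv HT0 by force
        then show ?thesis using False eq plus by simp
      qed
    qed
    have cont: "continuous_on S g" for S unfolding g_def by (intro continuous_intros)
    define P where "P = integral {u..v} (\<lambda>x. g x * sin (Y * x))"
    have "P = (\<Sum>j\<in>I. \<tau> j * s j)"
    proof -
      have "g x * sin (Y * x) = (\<Sum>j\<in>I. \<tau> j * (sin (y j * x) * sin (Y * x)))" for x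
        by (simp add: g_def sum_distrib_right mult.assoc)
      then show ?thesis
        unfolding P_def s_def by (simp only:, subst integral_sum) (auto intro!: ic continuous_intros I)
    qed
    then have "2 * P - len * (\<Sum>j\<in>C i. \<tau> j) = (\<Sum>j\<in>I. \<tau> j * (2 * s j)) - (\<Sum>j\<in>I. \<tau> j * (if j \<in> C i then len else 0))"
    proof -
      have "(\<Sum>j\<in>I. \<tau> j * (if j \<in> C i then len else 0)) = (\<Sum>j\<in>C i. \<tau> j * len)"
        using I by (intro sum.mono_neutral_cong_right) (auto simp: C_def)
      moreover assume "P = (\<Sum>j\<in>I. \<tau> j * s j)"
      ultimately show ?thesis by (simp add: sum_distrib_left mult_ac)
    qed
    also have "\<dots> = (\<Sum>j\<in>I. \<tau> j * (2 * s j - (if j \<in> C i then len else 0)))"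
      by (simp only: right_diff_distrib sum_subtractf)
    also have "\<bar>\<dots>\<bar> \<le> (\<Sum>j\<in>I. 2 * (8 * len / T))"
    proof (rule order_trans[OF sum_abs sum_mono])
      fix j assume "j \<in> I"
      then show "\<bar>\<tau> j * (2 * s j - (if j \<in> C i then len else 0))\<bar> \<le> 2 * (8 * len / T)"
        unfolding abs_mult using \<tau> s by (intro mult_mono) auto
    qed
    also have "\<dots> = 16 * M * (len / T)" by (simp add: M_def)
    finally have P: "\<bar>2 * P - len * (\<Sum>j\<in>C i. \<tau> j)\<bar> \<le> 16 * M * (len / T)" .
    \<comment> \<open>A nonzero cluster weight is an integer, hence at least 1 in modulus.\<close>
    have "len * 1 \<le> \<bar>len * (\<Sum>j\<in>C i. \<tau> j)\<bar>"
      unfolding abs_mult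
    proof (intro mult_mono)
      have "(\<Sum>j\<in>C i. \<tau> j) \<in> \<int>" using int by (intro Ints_sum) (auto simp: C_def)
      then show "1 \<le> \<bar>\<Sum>j\<in>C i. \<tau> j\<bar>" using 2(2) by (rule Ints_nonzero_abs_ge1)
    qed (use uv in auto)
    with P have P_ge: "\<bar>2 * P\<bar> \<ge> len - 16 * M * (len / T)" by linarith
    have "\<bar>integral {u..v} g\<bar> \<le> (\<Sum>j\<in>I. 2 * (4 * len / T))"
    proof -
      have "integral {u..v} g = (\<Sum>j\<in>I. \<tau> j * integral {u..v} (\<lambda>x. sin (y j * x)))"
        unfolding g_def by (subst integral_sum) (auto intro!: ic continuous_intros I)
      also have "\<bar>\<dots>\<bar> \<le> (\<Sum>j\<in>I. 2 * (4 * len / T))"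
      proof (rule order_trans[OF sum_abs sum_mono])
        fix j assume j: "j \<in> I"
        have "\<bar>integral {u..v} (\<lambda>x. sin (y j * x))\<bar> \<le> 4 * len / T"
        proof (cases "y j > H * T")
          case True
          then show ?thesis using integral_sin_le[of "y j" u v] large_freq[of "y j"] uv HT0 by force
        next
          case False
          then have yj: "y j < H / T" "0 \<le> y j" using scale(1)[OF j] y[OF j] by auto
          have "\<bar>integral {u..v} (\<lambda>x. sin (y j * x))\<bar> = norm (integral {u..v} (\<lambda>x. sin (y j * x)))" by simp
          also have "\<dots> \<le> integral {u..v} (\<lambda>x. 1 / T)"
          proof (rule integral_norm_bound_integral)
            fix x assume x: "x \<in> {u..v}"
            have "y j * x \<le> (H / T) * (1 / H)"
              using yj x uv H T' by (intro mult_mono) (auto simp: v_def)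
            then have "0 \<le> y j * x" "y j * x \<le> 1 / T" using yj x uv H by auto
            then show "norm (sin (y j * x)) \<le> 1 / T"
              using abs_sin_x_le_abs_x[of "y j * x"] by simp
          qed (intro ic continuous_intros)+
          also have "\<dots> = len / T" using uv by simp
          also have "\<dots> \<le> 4 * len / T" using uv T' by (intro divide_right_mono) auto
          finally show ?thesis .
        qed
        then show "\<bar>\<tau> j * integral {u..v} (\<lambda>x. sin (y j * x))\<bar> \<le> 2 * (4 * len / T)"
          unfolding abs_mult using \<tau>[OF j] by (intro mult_mono) auto
      qed
      finally show ?thesis .
    qed
    also have "\<dots> = 8 * M * (len / T)" by (simp add: M_def)
    finally have g_le: "\<bar>integral {u..v} g\<bar> \<le> 8 * M * (len / T)" .
    obtain \<sigma> where \<sigma>: "\<sigma> \<in> {1, -1}" "\<And>x. x \<in> {u..v} \<Longrightarrow> \<sigma> * g x \<ge> 0"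
    proof -
      have "\<exists>\<sigma>\<in>{1, -1}. \<forall>x\<in>{u..v}. \<sigma> * g x \<ge> 0"
        by (rule constant_sign_if_no_zero[OF cont]) (use nz in \<open>auto simp: u_def v_def\<close>)
      then show ?thesis using that by blast
    qed
    \<comment> \<open>As g has one sign, |P| is at most the modulus of its integral. The lower bound
      for |P| and the upper bound for that integral then force T \<le> 32 M, contrary to T > 50
      M.\<close>
    have "\<bar>P\<bar> = norm P" by simp
    also have "\<dots> \<le> integral {u..v} (\<lambda>x. \<sigma> * g x)"
      unfolding P_def
    proof (rule integral_norm_bound_integral)
      fix x assume x: "x \<in> {u..v}"
      have "\<bar>g x\<bar> * \<bar>sin (Y * x)\<bar> \<le> \<bar>g x\<bar> * 1" by (intro mult_left_mono) auto
      moreover have "\<bar>g x\<bar> = \<sigma> * g x" using \<sigma>(1) \<sigma>(2)[OF x] by auto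
      ultimately show "norm (g x * sin (Y * x)) \<le> \<sigma> * g x" by (simp add: abs_mult)
    qed (intro ic continuous_intros cont)+
    also have "\<dots> = \<sigma> * integral {u..v} g" by simp
    also have "\<dots> \<le> \<bar>integral {u..v} g\<bar>" using \<sigma>(1) by auto
    finally have "len - 16 * M * (len / T) \<le> 16 * M * (len / T)"
      using g_le P_ge by simp
    then have "len * T \<le> len * (32 * M)" using T' by (simp add: field_simps)
    then have "T \<le> 32 * M" using uv by simp
    then show ?thesis using T' M by linarith
  qed
qed

text \<open>The points to be avoided are the frequencies, their pairwise differences and the
  reciprocals of the zeros; their number gives the exponent of T. Scales H \<ge> H0 suffice because
  the interval up to 1 / H then stays inside the range where the zeros are known.\<close>

lemma sine_sum_frequency_bound:
  fixes \<tau> y :: "'i \<Rightarrow> real" and b :: real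
  assumes I: "finite I" and \<tau>: "\<And>i. i \<in> I \<Longrightarrow> \<bar>\<tau> i\<bar> \<le> 2" and y: "\<And>i. i \<in> I \<Longrightarrow> y i \<ge> 0"
    and int: "\<And>i. i \<in> I \<Longrightarrow> \<tau> i \<in> \<int>"
    and T: "T \<ge> 100 * (real (card I) + 1)" and H0: "H0 > 0" "1 / H0 \<le> b"
    and Z: "finite Z"
    and zeros: "\<And>x. 0 < x \<Longrightarrow> x < b \<Longrightarrow> (\<Sum>i\<in>I. \<tau> i * sin (y i * x)) = 0 \<Longrightarrow> x \<in> Z"
  shows "\<bar>\<Sum>i\<in>I. \<tau> i * y i\<bar> < H0 * T ^ (3 * (card I + (card I)\<^sup>2 + card Z + 1))"
proof -
  have T1: "T \<ge> 100" using T by simp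
  define Q where "Q = y ` I \<union> (\<lambda>p. \<bar>y (fst p) - y (snd p)\<bar>) ` (I \<times> I) \<union> (\<lambda>x. 1 / x) ` Z"
  have Q: "finite Q" using I Z by (simp add: Q_def)
  have cardQ: "card Q \<le> card I + (card I)\<^sup>2 + card Z"
  proof -
    have "card (y ` I) \<le> card I" "card ((\<lambda>x. 1 / x) ` Z) \<le> card Z"
      "card ((\<lambda>p. \<bar>y (fst p) - y (snd p)\<bar>) ` (I \<times> I)) \<le> (card I)\<^sup>2"
      using I Z card_image_le[of "I \<times> I" "\<lambda>p. \<bar>y (fst p) - y (snd p)\<bar>"]
      by (auto intro: card_image_le simp: card_cartesian_product power2_eq_square)
    then show ?thesis
      unfolding Q_def using card_Un_le[of "y ` I \<union> (\<lambda>p. \<bar>y (fst p) - y (snd p)\<bar>) ` (I \<times> I)" "(\<lambda>x. 1 / x) ` Z"]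
        card_Un_le[of "y ` I" "(\<lambda>p. \<bar>y (fst p) - y (snd p)\<bar>) ` (I \<times> I)"] by linarith
  qed
  obtain k where k: "k \<in> {1..card Q + 1}"
    "\<And>q. q \<in> Q \<Longrightarrow> q < H0 * T ^ (3 * k) / T \<or> q > H0 * T ^ (3 * k) * T"
    using scale_avoiding[OF Q, of T H0] T1 H0 by auto
  define H where "H = H0 * T ^ (3 * k)"
  have H: "H > 0" "H \<ge> H0" using H0 T1 by (auto simp: H_def)
  have "\<bar>\<Sum>i\<in>I. \<tau> i * y i\<bar> < H"
  proof (rule sine_sum_sign_change[OF I \<tau> y int T H(1)])
    show "y i < H / T \<or> y i > H * T" if "i \<in> I" for i
      using k(2)[of "y i"] that by (auto simp: Q_def H_def)
    show "\<bar>y i - y j\<bar> < H / T \<or> \<bar>y i - y j\<bar> > H * T" if "i \<in> I" "j \<in> I" for i j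
      using k(2)[of "\<bar>y i - y j\<bar>"] that by (force simp: Q_def H_def)
    show "(\<Sum>i\<in>I. \<tau> i * sin (y i * x)) \<noteq> 0" if x: "1 / (2 * H) < x" "x < 1 / H" for x
    proof
      assume "(\<Sum>i\<in>I. \<tau> i * sin (y i * x)) = 0"
      moreover have "0 < x" using x H by (smt (verit) divide_pos_pos)
      moreover have "1 / H \<le> 1 / H0" using H H0 by (intro divide_left_mono) auto
      ultimately have "x \<in> Z" using x H0 by (intro zeros) auto
      \<comment> \<open>The reciprocal of a zero in the interval would lie between H and 2H, well
        inside the avoided window from H / T to H T.\<close>
      then have "1 / x < H / T \<or> 1 / x > H * T" using k(2)[of "1 / x"] by (auto simp: Q_def H_def)
      moreover have "H < 1 / x" "1 / x < 2 * H"
        using x H \<open>0 < x\<close> by (auto simp: field_simps)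
      moreover have "H / T \<le> H" "2 * H \<le> H * T" using H T1 by (auto simp: field_simps)
      ultimately show False by linarith
    qed
  qed auto
  also have "H \<le> H0 * T ^ (3 * (card I + (card I)\<^sup>2 + card Z + 1))"
    unfolding H_def using k(1) cardQ T1 H0 by (intro mult_left_mono power_increasing) auto
  finally show ?thesis .
qed

section \<open>Coefficient sequences\<close>

lemma finite_supp_shift:
  fixes a :: "int \<Rightarrow> 'a::zero"
  assumes "finite {n. a n \<noteq> 0}"
  shows "finite {n. a (n + k) \<noteq> 0}"
proof -
  have "{n. a (n + k) \<noteq> 0} = (\<lambda>n. n - k) ` {n. a n \<noteq> 0}"
    by (force simp: image_iff intro: exI[of _ "_ + k"])
  then show ?thesis using assms by simp
qed

lemma tp_shift: "tp (\<lambda>n. a (n - k)) t = ee k t * tp a t"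
  unfolding tp_def sum_distrib_left
  by (rule sum.reindex_bij_witness[of _ "\<lambda>n. n + k" "\<lambda>n. n - k"])
     (auto simp: ee_add[symmetric] mult.left_commute)

lemma tp_add:
  assumes "finite {n. a n \<noteq> 0}" "finite {n. b n \<noteq> 0}"
  shows "tp (\<lambda>n. a n + b n) t = tp a t + tp b t"
proof -
  let ?S = "{n. a n \<noteq> 0} \<union> {n. b n \<noteq> 0}"
  have S: "finite ?S" using assms by simp
  have "tp (\<lambda>n. a n + b n) t = (\<Sum>n\<in>?S. of_real (a n + b n) * ee n t)"
    by (rule tp_eq_sum[OF S]) auto
  also have "\<dots> = (\<Sum>n\<in>?S. of_real (a n) * ee n t) + (\<Sum>n\<in>?S. of_real (b n) * ee n t)"
    by (simp add: distrib_right sum.distrib)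
  also have "\<dots> = tp a t + tp b t"
    by (subst (1 2) tp_eq_sum[OF S]) auto
  finally show ?thesis .
qed

lemma tp_scale: "tp (\<lambda>n. x * a n) t = of_real x * tp a t"
proof (cases "x = 0")
  case False
  then show ?thesis by (simp add: tp_def sum_distrib_left mult.assoc)
qed (simp add: tp_def)

lemma finite_supp_add:
  fixes a b :: "int \<Rightarrow> real"
  assumes "finite {n. a n \<noteq> 0}" "finite {n. b n \<noteq> 0}"
  shows "finite {n. a n + b n \<noteq> 0}"
  by (rule finite_subset[OF _ finite_UnI[OF assms]]) auto

lemma finite_supp_scale:
  fixes a :: "int \<Rightarrow> real"
  assumes "finite {n. a n \<noteq> 0}"
  shows "finite {n. x * a n \<noteq> 0}"
  by (rule finite_subset[OF _ assms]) auto

lemma sdiff_as_sum: "sdiff m a = (\<lambda>n. 2 * a n + ((-1) * a (n - m) + (-1) * a (n - (- m))))"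
  for a :: "int \<Rightarrow> real"
  by (simp add: sdiff_def fun_eq_iff)

lemma finite_supp_shift':
  fixes a :: "int \<Rightarrow> 'a::zero"
  assumes "finite {n. a n \<noteq> 0}"
  shows "finite {n. a (n - k) \<noteq> 0}"
  using finite_supp_shift[OF assms, of "- k"] by simp

lemma finite_supp_sdiff:
  fixes a :: "int \<Rightarrow> real"
  assumes "finite {n. a n \<noteq> 0}"
  shows "finite {n. sdiff m a n \<noteq> 0}"
  unfolding sdiff_as_sum by (intro finite_supp_add finite_supp_scale finite_supp_shift' assms)

lemma tp_sdiff:
  assumes "finite {n. a n \<noteq> 0}"
  shows "tp (sdiff m a) t = of_real (2 - 2 * cos (2 * pi * of_int m * t)) * tp a t"
proof -
  have "tp (sdiff m a) t = 2 * tp a t + (- (ee m t * tp a t) + - (ee (- m) t * tp a t))"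
  proof -
    have 1: "finite {n. (-1) * a (n - k) \<noteq> 0}" for k
      by (intro finite_supp_scale finite_supp_shift' assms)
    have 2: "finite {n. 2 * a n \<noteq> 0}" by (intro finite_supp_scale assms)
    show ?thesis
      unfolding sdiff_as_sum tp_add[OF 2 finite_supp_add[OF 1 1]] tp_add[OF 1 1] tp_scale tp_shift by simp
  qed
  also have "\<dots> = (2 - (ee m t + ee (- m) t)) * tp a t" by (simp add: algebra_simps)
  also have "ee m t + ee (- m) t = of_real (2 * cos (2 * pi * of_int m * t))"
    by (simp add: ee_def complex_eq_iff)
  finally show ?thesis by simp
qed

lemma finite_supp_funpow_sdiff:
  fixes a :: "int \<Rightarrow> real"
  shows "finite {n. a n \<noteq> 0} \<Longrightarrow> finite {n. (sdiff m ^^ k) a n \<noteq> 0}"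
proof (induction k)
  case (Suc k)
  then show ?case using finite_supp_sdiff[of "(sdiff m ^^ k) a" m] by simp
qed simp

lemma tp_funpow_sdiff:
  assumes "finite {n. a n \<noteq> 0}"
  shows "tp ((sdiff m ^^ k) a) t = of_real ((2 - 2 * cos (2 * pi * of_int m * t)) ^ k) * tp a t"
  by (induction k) (simp_all add: tp_sdiff finite_supp_funpow_sdiff assms)

lemma funpow_sdiff_le:
  fixes a :: "int \<Rightarrow> real"
  assumes "\<And>n. \<bar>a n\<bar> \<le> R"
  shows "\<bar>(sdiff m ^^ k) a n\<bar> \<le> 4 ^ k * R"
proof (induction k arbitrary: n)
  case (Suc k)
  show ?case using Suc[of n] Suc[of "n - m"] Suc[of "n + m"] by (simp add: sdiff_def)
qed (use assms in simp)

lemma funpow_sdiff_supp: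
  fixes a :: "int \<Rightarrow> real"
  assumes "(sdiff m ^^ k) a n \<noteq> 0" "m \<ge> 0"
  shows "\<exists>n'. a n' \<noteq> 0 \<and> \<bar>n - n'\<bar> \<le> int k * m"
  using assms(1)
proof (induction k arbitrary: n)
  case (Suc k)
  let ?b = "(sdiff m ^^ k) a"
  from Suc.prems have "?b n \<noteq> 0 \<or> ?b (n - m) \<noteq> 0 \<or> ?b (n + m) \<noteq> 0"
    by (auto simp: sdiff_def[of m ?b])
  then obtain l where l: "?b l \<noteq> 0" "\<bar>n - l\<bar> \<le> m" using assms(2) by force
  from Suc.IH[OF l(1)] obtain n' where "a n' \<noteq> 0" "\<bar>l - n'\<bar> \<le> int k * m" by blast
  then show ?case using l(2) by (intro exI[of _ n']) (auto simp: algebra_simps)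
qed auto

lemma of_int_funpow_sdiff:
  "real_of_int ((sdiff m ^^ k) g n) = (sdiff m ^^ k) (\<lambda>n. real_of_int (g n)) n"
proof (induction k arbitrary: n)
  case (Suc k)
  then show ?case by (simp add: sdiff_def)
qed simp

text \<open>The polynomial \<rho> evaluated at the operator \<open>sdiff m\<close>, that is,
  multiplication of the function by \<rho>(2 - 2 cos(m \<theta>)). K is an upper bound for the
  degree, which fixes the range of summation.\<close>

definition psdiff :: "real poly \<Rightarrow> nat \<Rightarrow> int \<Rightarrow> (int \<Rightarrow> real) \<Rightarrow> int \<Rightarrow> real" where
  "psdiff \<rho> K m a n = (\<Sum>k\<le>K. coeff \<rho> k * (sdiff m ^^ k) a n)"

lemma tp_sum:
  assumes "\<And>i. i \<in> I \<Longrightarrow> finite {n. a i n \<noteq> 0}" "finite I"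
  shows "finite {n. (\<Sum>i\<in>I. a i n) \<noteq> (0::real)} \<and> tp (\<lambda>n. \<Sum>i\<in>I. a i n) t = (\<Sum>i\<in>I. tp (a i) t)"
  using assms(2,1)
proof (induction I rule: finite_induct)
  case empty
  then show ?case by (simp add: tp_def)
next
  case (insert i I)
  have i: "finite {n. a i n \<noteq> 0}" by (rule insert.prems) simp
  have "finite {n. (\<Sum>i\<in>I. a i n) \<noteq> 0} \<and> tp (\<lambda>n. \<Sum>i\<in>I. a i n) t = (\<Sum>i\<in>I. tp (a i) t)"
    by (rule insert.IH) (rule insert.prems, simp)
  then have IH: "finite {n. (\<Sum>i\<in>I. a i n) \<noteq> 0}" "tp (\<lambda>n. \<Sum>i\<in>I. a i n) t = (\<Sum>i\<in>I. tp (a i) t)"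
    by blast+
  show ?case using finite_supp_add[OF i IH(1)] tp_add[OF i IH(1), of t] IH(2) insert.hyps by simp
qed

lemma psdiff_tp:
  assumes "finite {n. a n \<noteq> 0}" "degree \<rho> \<le> K"
  shows "finite {n. psdiff \<rho> K m a n \<noteq> 0}"
    "tp (psdiff \<rho> K m a) t = of_real (poly \<rho> (2 - 2 * cos (2 * pi * of_int m * t))) * tp a t"
proof -
  have fin: "finite {n. coeff \<rho> k * (sdiff m ^^ k) a n \<noteq> 0}" for k
    by (intro finite_supp_scale finite_supp_funpow_sdiff assms)
  note * = tp_sum[of "{..K}" "\<lambda>k n. coeff \<rho> k * (sdiff m ^^ k) a n", OF fin]
  show "finite {n. psdiff \<rho> K m a n \<noteq> 0}" using * by (simp add: psdiff_def)
  let ?x = "2 - 2 * cos (2 * pi * of_int m * t)"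
  have "tp (psdiff \<rho> K m a) t = (\<Sum>k\<le>K. of_real (coeff \<rho> k * ?x ^ k) * tp a t)"
    using * by (simp add: psdiff_def[abs_def] tp_scale tp_funpow_sdiff assms mult.assoc)
  also have "\<dots> = of_real (\<Sum>k\<le>K. coeff \<rho> k * ?x ^ k) * tp a t"
    by (simp add: sum_distrib_right)
  also have "(\<Sum>k\<le>K. coeff \<rho> k * ?x ^ k) = poly \<rho> ?x"
    unfolding poly_altdef by (rule sum.mono_neutral_right) (use assms in \<open>auto simp: le_degree\<close>)
  finally show "tp (psdiff \<rho> K m a) t = of_real (poly \<rho> ?x) * tp a t" .
qed

lemma psdiff_le:
  assumes "\<And>n. \<bar>a n\<bar> \<le> R"
  shows "\<bar>psdiff \<rho> K m a n\<bar> \<le> (\<Sum>k\<le>K. \<bar>coeff \<rho> k\<bar> * 4 ^ k) * R"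
  unfolding psdiff_def sum_distrib_right
proof (rule order_trans[OF sum_abs sum_mono])
  fix k
  show "\<bar>coeff \<rho> k * (sdiff m ^^ k) a n\<bar> \<le> \<bar>coeff \<rho> k\<bar> * 4 ^ k * R"
  proof -
    have "\<bar>(sdiff m ^^ k) a n\<bar> \<le> 4 ^ k * R" by (rule funpow_sdiff_le) (rule assms)
    then have "\<bar>coeff \<rho> k\<bar> * \<bar>(sdiff m ^^ k) a n\<bar> \<le> \<bar>coeff \<rho> k\<bar> * (4 ^ k * R)"
      by (rule mult_left_mono) simp
    then show ?thesis by (simp add: abs_mult mult.assoc)
  qed
qed

lemma psdiff_supp:
  assumes "psdiff \<rho> K m a n \<noteq> 0" "m \<ge> 0"
  shows "\<exists>n'. a n' \<noteq> 0 \<and> \<bar>n - n'\<bar> \<le> int K * m"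
proof -
  obtain k where k: "k \<le> K" "(sdiff m ^^ k) a n \<noteq> 0"
  proof (rule ccontr)
    assume "\<not> thesis"
    then have "\<forall>k\<in>{..K}. coeff \<rho> k * (sdiff m ^^ k) a n = 0" using that by auto
    then have "psdiff \<rho> K m a n = 0" unfolding psdiff_def by (rule sum.neutral)
    then show False using assms(1) by simp
  qed
  from funpow_sdiff_supp[OF k(2) assms(2)] obtain n' where "a n' \<noteq> 0" "\<bar>n - n'\<bar> \<le> int k * m" by blast
  moreover have "int k * m \<le> int K * m" using k assms by (intro mult_right_mono) auto
  ultimately show ?thesis by (intro exI[of _ n']) auto
qed

text \<open>The Fourier coefficients of twice the cosine polynomial, doubled so that they are
  integers. An element 0 of A is counted by both summands and gives the coefficient 2 at frequency
  0.\<close>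

definition coef :: "nat set \<Rightarrow> int \<Rightarrow> int" where
  "coef A n = (\<Sum>a\<in>A. (if n = int a then 1 else 0) + (if n = - int a then 1 else 0))"

definition coef_supp :: "nat set \<Rightarrow> int set" where
  "coef_supp A = int ` A \<union> (\<lambda>a. - int a) ` A"

lemma coef_le:
  assumes "finite A"
  shows "\<bar>coef A n\<bar> \<le> 2"
proof -
  have 1: "(n = int a) = (a = nat n \<and> n \<ge> 0)" "(n = - int a) = (a = nat (- n) \<and> n \<le> 0)" for a
    by auto
  have 2: "\<bar>\<Sum>a\<in>A. if a = b \<and> P then 1 else 0 :: int\<bar> \<le> 1" for b P
    using assms by (cases P) (auto simp: sum.delta)
  show ?thesis
    unfolding coef_def sum.distrib 1 using 2[of "nat n" "n \<ge> 0"] 2[of "nat (- n)" "n \<le> 0"] by linarith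
qed

lemma finite_coef_supp: "finite A \<Longrightarrow> finite (coef_supp A)"
  by (simp add: coef_supp_def)

lemma coef_eq_0: "n \<notin> coef_supp A \<Longrightarrow> coef A n = 0"
  by (auto simp: coef_def coef_supp_def intro!: sum.neutral)

lemma sum_coef:
  fixes \<phi> :: "int \<Rightarrow> 'b::{comm_ring_1}"
  assumes "finite A"
  shows "(\<Sum>n\<in>coef_supp A. of_int (coef A n) * \<phi> n) = (\<Sum>a\<in>A. \<phi> (int a) + \<phi> (- int a))"
proof -
  have fin: "finite (coef_supp A)" using assms by (rule finite_coef_supp)
  have "(\<Sum>n\<in>coef_supp A. of_int (coef A n) * \<phi> n)
      = (\<Sum>n\<in>coef_supp A. \<Sum>a\<in>A. (if n = int a then \<phi> (int a) else 0) + (if n = - int a then \<phi> (- int a) else 0))"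
    by (intro sum.cong refl) (auto simp: coef_def sum_distrib_right intro!: sum.cong)
  also have "\<dots> = (\<Sum>a\<in>A. \<Sum>n\<in>coef_supp A. (if n = int a then \<phi> (int a) else 0) + (if n = - int a then \<phi> (- int a) else 0))"
    by (rule sum.swap)
  also have "\<dots> = (\<Sum>a\<in>A. \<phi> (int a) + \<phi> (- int a))"
    using fin by (intro sum.cong refl) (simp add: sum.distrib sum.delta coef_supp_def)
  finally show ?thesis .
qed

lemma finite_supp_coef:
  assumes "finite A"
  shows "finite {n. real_of_int (coef A n) \<noteq> 0}"
  using finite_coef_supp[OF assms] by (rule rev_finite_subset) (use coef_eq_0 in auto)

lemma tp_coef:
  assumes "finite A"
  shows "tp (\<lambda>n. real_of_int (coef A n)) t = of_real (2 * cosine_poly A (2 * pi * t))"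
proof -
  have "tp (\<lambda>n. real_of_int (coef A n)) t = (\<Sum>n\<in>coef_supp A. of_int (coef A n) * ee n t)"
    by (subst tp_eq_sum[OF finite_coef_supp[OF assms]]) (use coef_eq_0 in auto)
  also have "\<dots> = (\<Sum>a\<in>A. ee (int a) t + ee (- int a) t)" by (rule sum_coef[OF assms])
  also have "\<dots> = (\<Sum>a\<in>A. of_real (2 * cos (real a * (2 * pi * t))))"
    by (intro sum.cong refl) (simp add: ee_def complex_eq_iff mult_ac)
  finally show ?thesis by (simp add: cosine_poly_def sum_distrib_left)
qed

section \<open>Trigonometric inequalities and simultaneous approximation\<close>

lemma abs_sin_mult_le: "\<bar>sin (real m * t)\<bar> \<le> real m * \<bar>sin t\<bar>"
proof (induction m)
  case (Suc m)
  have "sin (real (Suc m) * t) = sin (real m * t) * cos t + cos (real m * t) * sin t"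
    by (simp add: distrib_right sin_add add.commute)
  also have "\<bar>\<dots>\<bar> \<le> \<bar>sin (real m * t)\<bar> * \<bar>cos t\<bar> + \<bar>cos (real m * t)\<bar> * \<bar>sin t\<bar>"
    by (metis abs_mult abs_triangle_ineq)
  also have "\<dots> \<le> \<bar>sin (real m * t)\<bar> * 1 + 1 * \<bar>sin t\<bar>"
    by (intro add_mono mult_left_mono mult_right_mono) auto
  finally show ?case using Suc by (simp add: distrib_right)
qed simp

text \<open>A Lipschitz bound for the Chebyshev polynomial that expresses cos(m x) by cos x, read
  off from the product formula for differences of cosines. It trades the roots of the divisor in X
  for the sign changes in cos, at a factor 2 m^2 each.\<close>

lemma abs_cos_mult_diff_le: "\<bar>cos (real m * x) - cos (real m * y)\<bar> \<le> (real m)\<^sup>2 * \<bar>cos x - cos y\<bar>"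
proof -
  define u v where "u = (x + y) / 2" and "v = (y - x) / 2"
  have eq: "cos (real m * x) - cos (real m * y) = 2 * (sin (real m * u) * sin (real m * v))" for m
    by (simp add: cos_diff_cos u_def v_def algebra_simps)
  have "\<bar>sin (real m * u)\<bar> * \<bar>sin (real m * v)\<bar> \<le> (real m * \<bar>sin u\<bar>) * (real m * \<bar>sin v\<bar>)"
    by (intro mult_mono abs_sin_mult_le) auto
  moreover have e1: "cos x - cos y = 2 * (sin u * sin v)" using eq[of 1] by simp
  ultimately show ?thesis
    unfolding eq[of m] e1 abs_mult by (simp add: power2_eq_square mult_ac)
qed

lemma two_minus_two_cos_le: "2 - 2 * cos y \<le> (y::real)\<^sup>2"
proof -
  have "2 - 2 * cos y = 4 * (sin (y / 2))\<^sup>2"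
    using cos_double_sin[of "y / 2"] by simp
  also have "\<dots> \<le> 4 * (y / 2)\<^sup>2"
    by (intro mult_left_mono abs_le_square_iff[THEN iffD1, OF abs_sin_x_le_abs_x]) auto
  finally show ?thesis by (simp add: power2_eq_square)
qed

lemma dirichlet_cos:
  fixes S :: "real set"
  assumes "finite S"
  shows "\<exists>m>0. m \<le> 256 ^ card S \<and> (\<forall>s\<in>S. 2 - 2 * cos (real m * s) \<le> 1 / 2 ^ 10)"
proof -
  obtain h where h: "bij_betw h {0..<card S} S"
    using ex_bij_betw_nat_finite[OF assms] by blast
  obtain q p where q: "0 < q" "q \<le> int (256 ^ card S)"
    and p: "\<And>i. i < card S \<Longrightarrow> \<bar>of_int q * (h i / (2 * pi)) - of_int (p i)\<bar> < 1 / real 256"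
    using Dirichlet_approx_simult[of 256 "card S" "\<lambda>i. h i / (2 * pi)"] by auto
  define m where "m = nat q"
  have m: "m > 0" "m \<le> 256 ^ card S" "real m = of_int q" using q by (auto simp: m_def nat_le_iff)
  have "2 - 2 * cos (real m * s) \<le> 1 / 2 ^ 10" if "s \<in> S" for s
  proof -
    have "s \<in> h ` {0..<card S}" using h \<open>s \<in> S\<close> by (simp add: bij_betw_def)
    then obtain i where i: "i < card S" "s = h i" by auto
    define y where "y = real m * s - 2 * pi * of_int (p i)"
    have "y = 2 * pi * (of_int q * (h i / (2 * pi)) - of_int (p i))"
      by (simp add: y_def i m field_simps)
    then have "\<bar>y\<bar> = 2 * pi * \<bar>of_int q * (h i / (2 * pi)) - of_int (p i)\<bar>"
      by (simp add: abs_mult)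
    also have "\<dots> \<le> 2 * pi * (1 / 256)" using p[OF i(1)] by (intro mult_left_mono) auto
    \<comment> \<open>The denominator 256 is chosen for this: the distance to a multiple of 2 pi is
      at most 8/256 = 1/32, whose square is 2^-10.\<close>
    also have "\<dots> \<le> 2 * 4 * (1 / 256)" using pi_less_4 by simp
    finally have "\<bar>y\<bar> \<le> 1 / 32" by simp
    then have "y\<^sup>2 \<le> (1 / 32)\<^sup>2" by (metis abs_le_square_iff abs_of_nonneg zero_le_divide_1_iff zero_le_numeral)
    moreover have "cos (real m * s) = cos y"
    proof -
      have "real m * s = y + of_int (p i) * (2 * pi)" by (simp add: y_def)
      then show ?thesis using cos.plus_of_int[of y "p i"] by simp
    qed
    moreover have "(1 / 32)\<^sup>2 = (1 / 2 ^ 10 :: real)" by (simp add: power2_eq_square)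
    ultimately show ?thesis using two_minus_two_cos_le[of y] by simp
  qed
  then show ?thesis using m by blast
qed

text \<open>The polynomial itself has coefficients in {0, 1/2, 1}. A factor cos - cos s averages the
  two neighbouring coefficients and adds a multiple of modulus at most 1 of the old one, so it at
  most doubles the bound.\<close>

lemma coefficients_mult_cos_diff:
  assumes "finite A" "finite S"
  shows "\<exists>a. finite {n. a n \<noteq> 0} \<and> (\<forall>n. \<bar>a n\<bar> \<le> 2 ^ card S) \<and>
    (\<forall>t. tp a t = of_real (cosine_poly A (2 * pi * t) * (\<Prod>s\<in>S. cos (2 * pi * t) - cos s)))"
  using assms(2)
proof (induction S rule: finite_induct)
  case empty
  define a where "a n = 1 / 2 * real_of_int (coef A n)" for n
  have "finite {n. a n \<noteq> 0}"
    unfolding a_def by (intro finite_supp_scale finite_supp_coef assms)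
  moreover have "tp a t = of_real (cosine_poly A (2 * pi * t))" for t
    unfolding a_def tp_scale tp_coef[OF assms(1)] by simp
  moreover have "\<bar>a n\<bar> \<le> 1" for n
    using coef_le[OF assms(1), of n] by (simp add: a_def abs_mult)
  ultimately show ?case by (intro exI[of _ a]) auto
next
  case (insert s S)
  then obtain a where a: "finite {n. a n \<noteq> 0}" "\<And>n. \<bar>a n\<bar> \<le> 2 ^ card S"
    "\<And>t. tp a t = of_real (cosine_poly A (2 * pi * t) * (\<Prod>s\<in>S. cos (2 * pi * t) - cos s))"
    by blast
  define b where "b = (\<lambda>n. (1 / 2 * a (n - 1) + 1 / 2 * a (n - (- 1))) + (- cos s) * a n)"
  have 1: "finite {n. 1 / 2 * a (n - k) \<noteq> 0}" for k
    by (intro finite_supp_scale finite_supp_shift' a)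
  have 2: "finite {n. - cos s * a n \<noteq> 0}" by (intro finite_supp_scale a)
  have "finite {n. b n \<noteq> 0}" unfolding b_def by (intro finite_supp_add 1 2)
  moreover have "\<bar>b n\<bar> \<le> 2 ^ card (insert s S)" for n
  proof -
    have "\<bar>(- cos s) * a n\<bar> \<le> 1 * 2 ^ card S"
      unfolding abs_mult using a(2) by (intro mult_mono) auto
    then show ?thesis
      using a(2)[of "n - 1"] a(2)[of "n + 1"] insert.hyps unfolding b_def by simp
  qed
  moreover have "tp b t = of_real (cosine_poly A (2 * pi * t) * (\<Prod>s\<in>insert s S. cos (2 * pi * t) - cos s))" for t
  proof -
    have "tp b t = (of_real (1 / 2) * (ee 1 t + ee (- 1) t) - of_real (cos s)) * tp a t"
      unfolding b_def tp_add[OF finite_supp_add[OF 1 1] 2] tp_add[OF 1 1] tp_scale tp_shift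
      by (simp add: algebra_simps)
    also have "ee 1 t + ee (- 1) t = of_real (2 * cos (2 * pi * t))"
      by (simp add: ee_def complex_eq_iff)
    also have "(of_real (1 / 2) * of_real (2 * cos (2 * pi * t)) - of_real (cos s)) * tp a t =
        complex_of_real ((cos (2 * pi * t) - cos s) * (cosine_poly A (2 * pi * t) * (\<Prod>s\<in>S. cos (2 * pi * t) - cos s)))"
      by (simp add: a)
    finally show ?thesis using insert.hyps by (simp add: mult_ac)
  qed
  ultimately show ?case by blast
qed

lemma cosine_poly_reflect: "cosine_poly A (2 * pi - x) = cosine_poly A x"
proof -
  have "cos (real a * (2 * pi - x)) = cos (real a * x)" for a
    using cos.plus_of_nat[of "- (real a * x)" a] by (simp add: algebra_simps)
  then show ?thesis by (simp add: cosine_poly_def)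
qed

lemma continuous_on_cosine_poly [continuous_intros]: "continuous_on S (cosine_poly A)"
  unfolding cosine_poly_def[abs_def] by (intro continuous_intros)

lemma integral_sign_multiplied_le:
  assumes A: "finite A" and S: "finite S" and \<sigma>: "\<sigma> \<in> {1, -1}"
    and sign: "\<And>x. x \<in> {0..pi} \<Longrightarrow> \<sigma> * (cosine_poly A x * (\<Prod>s\<in>S. cos x - cos s)) \<ge> 0"
  shows "integral {0..1} (\<lambda>t. \<bar>cosine_poly A (2 * pi * t) * (\<Prod>s\<in>S. cos (2 * pi * t) - cos s)\<bar>) \<le> 2 ^ card S"
proof -
  define F where "F t = cosine_poly A (2 * pi * t) * (\<Prod>s\<in>S. cos (2 * pi * t) - cos s)" for t
  obtain a where a: "finite {n. a n \<noteq> 0}" "\<And>n. \<bar>a n\<bar> \<le> 2 ^ card S" "\<And>t. tp a t = of_real (F t)"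
    using coefficients_mult_cos_diff[OF A S] unfolding F_def by blast
  have "\<bar>F t\<bar> = \<sigma> * F t" if "t \<in> {0..1}" for t
  proof -
    have "\<sigma> * F t \<ge> 0"
    proof (cases "2 * pi * t \<le> pi")
      case True
      then show ?thesis using sign[of "2 * pi * t"] that by (simp add: F_def)
    next
      \<comment> \<open>Both factors are even about pi, which carries the sign from [0, pi] to the
        second half of the period.\<close>
      case False
      have "2 * pi * t \<le> 2 * pi" using that by simp
      then have "\<sigma> * (cosine_poly A (2 * pi - 2 * pi * t) * (\<Prod>s\<in>S. cos (2 * pi - 2 * pi * t) - cos s)) \<ge> 0"
        using False by (intro sign) auto
      moreover have "cos (2 * pi - 2 * pi * t) = cos (2 * pi * t)" by simp
      ultimately show ?thesis by (simp only: cosine_poly_reflect F_def)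
    qed
    then show ?thesis using \<sigma> by auto
  qed
  then have "integral {0..1} (\<lambda>t. \<bar>F t\<bar>) = integral {0..1} (\<lambda>t. \<sigma> * F t)"
    by (intro integral_cong) auto
  also have "\<dots> = \<sigma> * integral {0..1} F" by simp
  also have "\<dots> \<le> \<bar>integral {0..1} F\<bar>" using \<sigma> by auto
  also have "integral {0..1} F = a 0"
  proof -
    have "integral {0..1} (tp a) = of_real (a 0)"
      using integral_mult_ee[OF a(1), of "\<lambda>n. of_real (a n)" 0] by (simp add: tp_def[abs_def])
    then have "integral {0..1} (\<lambda>t. complex_of_real (F t)) = of_real (a 0)"
      by (simp add: a(3)[abs_def])
    moreover have "F integrable_on {0..1}"
      unfolding F_def[abs_def]
      by (intro integrable_continuous_interval continuous_intros continuous_on_compose2[OF continuous_on_cosine_poly]) auto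
    then have "((\<lambda>t. complex_of_real (F t)) has_integral of_real (integral {0..1} F)) {0..1}"
      using has_integral_linear[OF integrable_integral bounded_linear_of_real] by (simp add: o_def)
    ultimately show ?thesis by (metis integral_unique of_real_eq_iff)
  qed
  finally show ?thesis using a(2)[of 0] by (simp add: F_def)
qed

section \<open>Numerical bounds and the sparse high difference\<close>

lemma square_plus_1_le_power2: "(K + 3)\<^sup>2 + 1 \<le> (2::nat) ^ (K + 4)"
proof (induction K)
  case (Suc K)
  have "(Suc K + 3)\<^sup>2 + 1 \<le> 2 * ((K + 3)\<^sup>2 + 1)"
    by (simp add: power2_eq_square algebra_simps)
  also have "\<dots> \<le> 2 * 2 ^ (K + 4)" using Suc by (intro mult_left_mono) auto
  also have "\<dots> = 2 ^ (Suc K + 4)" by (simp only: add_Suc power_Suc)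
  finally show ?case .
qed auto

text \<open>On the left is the L^1 bound of \<open>sparse_high_difference\<close>: 8 from X \<le> 4
  and the doubled polynomial, then the bound for the quotient, K Lipschitz factors 2 m^2, and 2^K
  for the sign-corrected polynomial. The quadratic terms of the exponent add up to 19 K^2, of which
  16 K^2 stems from m.\<close>

lemma multiplier_bound:
  fixes K m :: nat
  assumes "m \<le> 256 ^ K"
  shows "8 * ((real ((K + 3)\<^sup>2) + 1) ^ Suc K * 4 ^ (K + 3)\<^sup>2) * (2 * (real m)\<^sup>2) ^ K * 2 ^ K
    \<le> 2 ^ (20 * (K + 3)\<^sup>2)"
proof -
  have "real ((K + 3)\<^sup>2) + 1 = real ((K + 3)\<^sup>2 + 1)" by simp
  also have "\<dots> \<le> real (2 ^ (K + 4))" by (intro of_nat_mono square_plus_1_le_power2)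
  finally have 1: "real ((K + 3)\<^sup>2) + 1 \<le> 2 ^ (K + 4)" by simp
  have "real m \<le> real (256 ^ K)" using assms by (rule of_nat_mono)
  also have "\<dots> = (2 ^ 8) ^ K" by simp
  finally have "real m \<le> 2 ^ (8 * K)" by (simp only: power_mult)
  then have "2 * (real m)\<^sup>2 \<le> 2 * (2 ^ (8 * K))\<^sup>2" by (intro mult_left_mono power_mono) auto
  also have "\<dots> = 2 ^ (16 * K + 1)" by (simp flip: power_mult)
  finally have 2: "2 * (real m)\<^sup>2 \<le> 2 ^ (16 * K + 1)" .
  have "8 * ((real ((K + 3)\<^sup>2) + 1) ^ Suc K * 4 ^ (K + 3)\<^sup>2) * (2 * (real m)\<^sup>2) ^ K * 2 ^ K
    \<le> 8 * ((2 ^ (K + 4)) ^ Suc K * 4 ^ (K + 3)\<^sup>2) * (2 ^ (16 * K + 1)) ^ K * 2 ^ K"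
    using 1 2 by (intro mult_mono mult_left_mono mult_right_mono power_mono) auto
  also have "\<dots> = 2 ^ 3 * ((2 ^ (K + 4)) ^ Suc K * (2 ^ 2) ^ (K + 3)\<^sup>2) * (2 ^ (16 * K + 1)) ^ K * 2 ^ K"
    by simp
  also have "\<dots> = 2 ^ (3 + ((K + 4) * Suc K + 2 * (K + 3)\<^sup>2) + (16 * K + 1) * K + K)"
    by (simp only: power_add[symmetric] power_mult[symmetric])
  also have "\<dots> \<le> 2 ^ (20 * (K + 3)\<^sup>2)"
    by (intro power_increasing) (auto simp: power2_eq_square algebra_simps)
  finally show ?thesis .
qed

text \<open>The first factor is the size \<epsilon> of the remainder coefficients, with K + 1
  instead of K to keep it positive for K = 0; the second is 2L + 2. The decisive comparison is
  2^(-10 (q - K)) against the 4^q in L and the 2^(K^2) from the divisions.\<close>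

lemma perturbation_bound:
  fixes K m :: nat
  defines "q \<equiv> (K + 3)\<^sup>2"
  assumes m: "m \<le> 256 ^ K"
  shows "(8 * ((real K + 1) * 5 ^ K * (real q + 1) ^ K * (1 / 2 ^ 10) ^ (q - K))) *
    (2 * real ((K + 1) * m + (Suc q + 2 * 4 ^ Suc q) * m) + 2) \<le> 1 / 6"
proof -
  have "real q + 1 = real ((K + 3)\<^sup>2 + 1)" by (simp add: q_def)
  also have "\<dots> \<le> real (2 ^ (K + 4))" by (intro of_nat_mono square_plus_1_le_power2)
  finally have q: "real q + 1 \<le> 2 ^ (K + 4)" by simp
  have K: "real K + 1 \<le> 2 ^ K"
  proof -
    have "Suc K \<le> 2 ^ K" by (metis less_exp Suc_leI)
    then have "real (Suc K) \<le> real (2 ^ K)" by (rule of_nat_mono)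
    then show ?thesis by simp
  qed
  have Kq: "K + 1 + Suc q \<le> 4 ^ Suc q"
  proof -
    have "K \<le> q" by (simp add: q_def power2_eq_square algebra_simps)
    then have "K + 1 + Suc q \<le> 2 * Suc q" by simp
    also have "\<dots> \<le> 2 * 2 ^ Suc q" using less_exp[of "Suc q"] by simp
    also have "\<dots> \<le> 2 ^ Suc q * 2 ^ Suc q" by (intro mult_right_mono) auto
    also have "\<dots> = 4 ^ Suc q" by (simp flip: power_mult_distrib)
    finally show ?thesis .
  qed
  have "(K + 1) * m + (Suc q + 2 * 4 ^ Suc q) * m = (K + 1 + Suc q + 2 * 4 ^ Suc q) * m"
    by (simp add: algebra_simps)
  also have "\<dots> \<le> (3 * 4 ^ Suc q) * 256 ^ K"
    using Kq m by (intro mult_mono) auto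
  finally have "2 * ((K + 1) * m + (Suc q + 2 * 4 ^ Suc q) * m) + 2 \<le> 6 * 4 ^ Suc q * 256 ^ K + 2"
    by simp
  also have "\<dots> \<le> 8 * 4 ^ Suc q * (256::nat) ^ K"
  proof -
    have "(1::nat) * 1 \<le> 4 ^ Suc q * 256 ^ K" by (intro mult_mono) auto
    then show ?thesis by simp
  qed
  finally have "real (2 * ((K + 1) * m + (Suc q + 2 * 4 ^ Suc q) * m) + 2) \<le> real (8 * 4 ^ Suc q * 256 ^ K)"
    by (rule of_nat_mono)
  then have L: "2 * real ((K + 1) * m + (Suc q + 2 * 4 ^ Suc q) * m) + 2 \<le> 8 * 4 ^ Suc q * 256 ^ K"
    by simp
  have "(8 * ((real K + 1) * 5 ^ K * (real q + 1) ^ K * (1 / 2 ^ 10) ^ (q - K))) *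
      (2 * real ((K + 1) * m + (Suc q + 2 * 4 ^ Suc q) * m) + 2)
    \<le> (8 * (2 ^ K * 8 ^ K * (2 ^ (K + 4)) ^ K * (1 / 2 ^ 10) ^ (q - K))) * (8 * 4 ^ Suc q * 256 ^ K)"
    using q K L by (intro mult_mono mult_left_mono mult_right_mono power_mono) auto
  also have "\<dots> = (2 ^ 3 * (2 ^ K * (2 ^ 3) ^ K * (2 ^ (K + 4)) ^ K)) * (2 ^ 3 * (2 ^ 2) ^ Suc q * (2 ^ 8) ^ K) / (2 ^ 10) ^ (q - K)"
    by (simp add: power_divide mult_ac)
  also have "\<dots> = 2 ^ (3 + (K + 3 * K + (K + 4) * K) + (3 + 2 * Suc q + 8 * K)) / 2 ^ (10 * (q - K))"
    by (simp only: power_add[symmetric] power_mult[symmetric])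
  also have "\<dots> \<le> 1 / 2 ^ 3"
  proof -
    have "3 + (K + 3 * K + (K + 4) * K) + (3 + 2 * Suc q + 8 * K) + 3 \<le> 10 * (q - K)"
    proof -
      have "K \<le> q" by (simp add: q_def power2_eq_square algebra_simps)
      have "3 + (K + 3 * K + (K + 4) * K) + (3 + 2 * Suc q + 8 * K) + 3 + 10 * K \<le> 10 * q"
        by (simp add: q_def power2_eq_square algebra_simps)
      then show ?thesis using \<open>K \<le> q\<close> by linarith
    qed
    then have "(2::real) ^ (3 + (K + 3 * K + (K + 4) * K) + (3 + 2 * Suc q + 8 * K) + 3) \<le> 2 ^ (10 * (q - K))"
      by (intro power_increasing) auto
    then have "(2::real) ^ (3 + (K + 3 * K + (K + 4) * K) + (3 + 2 * Suc q + 8 * K)) * 2 ^ 3 \<le> 2 ^ (10 * (q - K))"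
      by (simp only: power_add)
    then show ?thesis by (simp add: pos_divide_le_eq pos_le_divide_eq del: power_Suc)
  qed
  also have "\<dots> \<le> 1 / 6" by simp
  finally show ?thesis .
qed

text \<open>Contrapositive of \<open>periodic_near_if_sdiff_vanishes\<close> with R = 2 and w = 0.
  It serves twice: to keep the remainder near the support of the integer polynomial, and to count
  the breaks of periodicity.\<close>

lemma break_near_difference:
  assumes "finite A" "m > 0" "coef A (n + int m) \<noteq> coef A n" "r > 0"
  shows "\<exists>e. (sdiff (int m) ^^ r) (coef A) e \<noteq> 0 \<and> \<bar>n - e\<bar> \<le> int ((r + 2 * 4 ^ r) * m)"
proof (rule ccontr)
  assume *: "\<not> ?thesis"
  have "coef A (n + int m) = coef A n"
  proof (rule periodic_near_if_sdiff_vanishes[where R = 2 and r = r and w = 0 and ?n0.0 = n])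
    fix k assume "\<bar>k - n\<bar> \<le> 0 + (int r + 2 ^ (2 * r) * 2) * int m"
    moreover have "(2::int) ^ (2 * r) = 4 ^ r" by (subst power_mult) simp
    ultimately have "\<bar>n - k\<bar> \<le> int ((r + 2 * 4 ^ r) * m)"
      by (simp add: abs_minus_commute mult_ac)
    then show "(sdiff (int m) ^^ r) (coef A) k = 0" using * by blast
  qed (use assms coef_le in auto)
  then show False using assms(3) by contradiction
qed

text \<open>With f the cosine polynomial, a belongs to 2 f X^(q+1) and v to 2 f X \<rho>(X). Their
  difference is 2 f X times the quotient times the product of the X - x s, whose L^1 norm is at most
  2^(20 q) by the sign condition; \<open>littlewood_perturbed\<close> then bounds the support of
  a.\<close>

lemma sparse_high_difference:
  fixes A :: "nat set" and S :: "real set"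
  defines "K \<equiv> card S" and "q \<equiv> (card S + 3)\<^sup>2"
  assumes A: "finite A" and S: "finite S" and \<sigma>: "\<sigma> \<in> {1, -1}"
    and sign: "\<And>x. x \<in> {0..pi} \<Longrightarrow> \<sigma> * (cosine_poly A x * (\<Prod>s\<in>S. cos x - cos s)) \<ge> 0"
    and m: "m > 0" "m \<le> 256 ^ K" "\<And>s. s \<in> S \<Longrightarrow> 2 - 2 * cos (real m * s) \<le> 1 / 2 ^ 10"
  shows "card {n. (sdiff (int m) ^^ Suc q) (coef A) n \<noteq> 0} \<le> 4 ^ 2 ^ (41 * q)"
proof -
  define r where "r = Suc q"
  define c where "c n = real_of_int (coef A n)" for n
  define a where "a = (sdiff (int m) ^^ r) c"
  have a_int: "a n = real_of_int ((sdiff (int m) ^^ r) (coef A) n)" for n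
    unfolding a_def c_def by (rule of_int_funpow_sdiff[symmetric])
  have finc: "finite {n. c n \<noteq> 0}" unfolding c_def by (rule finite_supp_coef[OF A])
  have fina: "finite {n. a n \<noteq> 0}" unfolding a_def by (rule finite_supp_funpow_sdiff[OF finc])
  define X where "X t = 2 - 2 * cos (2 * pi * of_int (int m) * t)" for t :: real
  define x where "x s = 2 - 2 * cos (real m * s)" for s
  obtain sl where sl: "set sl = S" "distinct sl" using finite_distinct_list[OF S] by blast
  have len: "length sl = K" using sl distinct_card by (fastforce simp: K_def)
  have "\<exists>\<Psi> \<rho> :: real poly. (\<forall>y. y ^ q = (\<Prod>z\<leftarrow>map x sl. y - z) * poly \<Psi> y + poly \<rho> y) \<and>
    (\<forall>y. 0 \<le> y \<and> y \<le> 4 \<longrightarrow> \<bar>poly \<Psi> y\<bar> \<le> (real q + 1) ^ Suc (length (map x sl)) * 4 ^ q) \<and>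
    degree \<rho> \<le> length (map x sl) \<and>
    (\<Sum>k\<le>length (map x sl). \<bar>coeff \<rho> k\<bar> * 4 ^ k)
      \<le> real (length (map x sl)) * 5 ^ length (map x sl) * (real q + 1) ^ length (map x sl) * (1 / 2 ^ 10) ^ (q - length (map x sl))"
  proof (rule power_mod_small_roots)
    show "\<bar>z\<bar> \<le> 1 / 2 ^ 10" if z: "z \<in> set (map x sl)" for z
    proof -
      obtain s where "s \<in> S" "z = x s" using z sl by auto
      then show ?thesis using m(3)[of s] cos_le_one[of "real m * s"] by (simp add: x_def)
    qed
    show "length (map x sl) \<le> q" unfolding length_map len by (simp add: q_def K_def power2_eq_square algebra_simps)
  qed auto
  then obtain \<Psi> \<rho> :: "real poly" where
    div: "\<And>y. y ^ q = (\<Prod>z\<leftarrow>map x sl. y - z) * poly \<Psi> y + poly \<rho> y"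
    and \<Psi>: "\<And>y. 0 \<le> y \<Longrightarrow> y \<le> 4 \<Longrightarrow> \<bar>poly \<Psi> y\<bar> \<le> (real q + 1) ^ Suc K * 4 ^ q"
    and \<rho>: "degree \<rho> \<le> K"
      "(\<Sum>k\<le>K. \<bar>coeff \<rho> k\<bar> * 4 ^ k) \<le> real K * 5 ^ K * (real q + 1) ^ K * (1 / 2 ^ 10) ^ (q - K)"
    unfolding length_map len by blast
  have prod_list: "(\<Prod>z\<leftarrow>map x sl. y - z) = (\<Prod>s\<in>S. y - x s)" for y
    using prod.distinct_set_conv_list[OF sl(2), of "\<lambda>s. y - x s"] sl(1) by (simp add: o_def)
  \<comment> \<open>One factor X is kept outside the division: \<open>c1\<close> vanishes wherever c
    has no break of m-periodicity nearby, and so does every sequence obtained from it by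
    \<open>psdiff\<close>.\<close>
  define c1 where "c1 = sdiff (int m) c"
  have finc1: "finite {n. c1 n \<noteq> 0}" unfolding c1_def by (rule finite_supp_sdiff[OF finc])
  define v where "v = psdiff \<rho> K (int m) c1"
  have finv: "finite {n. v n \<noteq> 0}" unfolding v_def by (rule psdiff_tp[OF finc1 \<rho>(1)])
  define L1 L where "L1 = (r + 2 * 4 ^ r) * m" and "L = (K + 1) * m + L1"
  define \<epsilon> where "\<epsilon> = 8 * ((real K + 1) * 5 ^ K * (real q + 1) ^ K * (1 / 2 ^ 10) ^ (q - K))"
  have breaks_near: "\<exists>e. a e \<noteq> 0 \<and> \<bar>n - e\<bar> \<le> int L1" if "coef A (n + int m) \<noteq> coef A n" for n
    using break_near_difference[OF A m(1) that, of r] by (auto simp: a_int L1_def r_def)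
  have "sqrt (real N) \<le> 10 * integral {0..1} (\<lambda>t. norm (tp a t - tp v t))"
    if N: "(\<Sum>i<N. 4 ^ i) \<le> card {n. a n \<noteq> 0}" for N
  proof (rule littlewood_perturbed[OF fina finv, where \<epsilon> = \<epsilon> and L = L])
    show "1 \<le> \<bar>a n\<bar>" if "a n \<noteq> 0" for n
      using that unfolding a_int by (intro Ints_nonzero_abs_ge1) auto
    show "\<epsilon> > 0" by (simp add: \<epsilon>_def)
    show "\<bar>v n\<bar> \<le> \<epsilon>" for n
    proof -
      have "\<bar>c1 n\<bar> \<le> 8" for n
        using coef_le[OF A, of n] coef_le[OF A, of "n - int m"] coef_le[OF A, of "n + int m"]
        unfolding c1_def sdiff_def c_def by linarith
      then have "\<bar>v n\<bar> \<le> (\<Sum>k\<le>K. \<bar>coeff \<rho> k\<bar> * 4 ^ k) * 8" unfolding v_def by (rule psdiff_le)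
      also have "\<dots> \<le> (real K * 5 ^ K * (real q + 1) ^ K * (1 / 2 ^ 10) ^ (q - K)) * 8"
        using \<rho>(2) by (intro mult_right_mono) auto
      also have "\<dots> \<le> ((real K + 1) * 5 ^ K * (real q + 1) ^ K * (1 / 2 ^ 10) ^ (q - K)) * 8"
        by (intro mult_right_mono) auto
      finally show ?thesis by (simp add: \<epsilon>_def)
    qed
    show "\<epsilon> * (2 * real L + 2) \<le> 1 / 6"
      using perturbation_bound[of m K] m(2) unfolding \<epsilon>_def L_def L1_def r_def q_def K_def by simp
    show "\<exists>e. a e \<noteq> 0 \<and> \<bar>n - e\<bar> \<le> int L" if vn: "v n \<noteq> 0" for n
    proof -
      obtain n' where n': "c1 n' \<noteq> 0" "\<bar>n - n'\<bar> \<le> int K * int m"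
        using psdiff_supp[of \<rho> K "int m" c1 n] vn unfolding v_def by auto
      \<comment> \<open>A nonzero second difference needs a break at n' or at n' - m, and every
        break is within L1 of the support of a.\<close>
      have "c1 n' = (c n' - c (n' - int m)) - (c (n' + int m) - c n')"
        by (simp add: c1_def sdiff_def)
      then have "coef A (n' + int m) \<noteq> coef A n' \<or> coef A (n' - int m + int m) \<noteq> coef A (n' - int m)"
        using n'(1) by (auto simp: c_def)
      moreover have "\<bar>n' - n'\<bar> \<le> int m" "\<bar>n' - (n' - int m)\<bar> \<le> int m" by simp_all
      ultimately obtain l where l: "coef A (l + int m) \<noteq> coef A l" "\<bar>n' - l\<bar> \<le> int m" by blast
      obtain e where e: "a e \<noteq> 0" "\<bar>l - e\<bar> \<le> int L1" using breaks_near[OF l(1)] by blast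
      have "int L = int K * int m + int m + int L1" by (simp add: L_def algebra_simps)
      then have "\<bar>n - e\<bar> \<le> int L" using n'(2) l(2) e(2) by linarith
      then show ?thesis using e(1) by blast
    qed
  qed (use N in auto)
  moreover have "integral {0..1} (\<lambda>t. norm (tp a t - tp v t)) \<le> 2 ^ (20 * q)"
  proof -
    define W where "W = 8 * ((real q + 1) ^ Suc K * 4 ^ q) * (2 * (real m)\<^sup>2) ^ K"
    define F where "F t = cosine_poly A (2 * pi * t) * (\<Prod>s\<in>S. cos (2 * pi * t) - cos s)" for t
    have contF: "continuous_on U F" for U
      unfolding F_def[abs_def]
      by (intro continuous_intros continuous_on_compose2[OF continuous_on_cosine_poly]) auto
    have "integral {0..1} (\<lambda>t. norm (tp a t - tp v t)) \<le> integral {0..1} (\<lambda>t. W * \<bar>F t\<bar>)"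
    proof (rule integral_le)
      fix t :: real
      have X: "0 \<le> X t" "X t \<le> 4"
        using cos_le_one[of "2 * pi * of_int (int m) * t"] cos_ge_minus_one[of "2 * pi * of_int (int m) * t"]
        unfolding X_def by linarith+
      let ?f = "2 * cosine_poly A (2 * pi * t)"
      have tpc: "tp c t = of_real ?f" unfolding c_def[abs_def] by (rule tp_coef[OF A])
      have "tp a t - tp v t = of_real (X t ^ r * ?f - poly \<rho> (X t) * (X t * ?f))"
        unfolding a_def v_def c1_def
        by (simp add: psdiff_tp(2)[OF finc1[unfolded c1_def] \<rho>(1)] tp_funpow_sdiff[OF finc] tp_sdiff[OF finc] tpc X_def)
      also have "X t ^ r * ?f - poly \<rho> (X t) * (X t * ?f) = X t * (\<Prod>s\<in>S. X t - x s) * poly \<Psi> (X t) * ?f"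
        using div[of "X t"] unfolding prod_list r_def by (simp add: algebra_simps)
      finally have "norm (tp a t - tp v t) = X t * (\<Prod>s\<in>S. \<bar>X t - x s\<bar>) * \<bar>poly \<Psi> (X t)\<bar> * \<bar>?f\<bar>"
        by (simp only: norm_of_real abs_mult abs_prod abs_of_nonneg[OF X(1)])
      also have "\<dots> \<le> 4 * ((2 * (real m)\<^sup>2) ^ K * (\<Prod>s\<in>S. \<bar>cos (2 * pi * t) - cos s\<bar>)) * ((real q + 1) ^ Suc K * 4 ^ q) * \<bar>?f\<bar>"
      proof (intro mult_mono)
        have "(\<Prod>s\<in>S. \<bar>X t - x s\<bar>) \<le> (\<Prod>s\<in>S. 2 * (real m)\<^sup>2 * \<bar>cos (2 * pi * t) - cos s\<bar>)"
        proof (rule prod_mono, intro conjI)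
          fix s
          have gen: "\<bar>(2 - 2 * a) - (2 - 2 * b)\<bar> = 2 * \<bar>a - b\<bar>" for a b :: real
            by (cases "a \<le> b") auto
          have "2 * pi * real_of_int (int m) * t = real m * (2 * pi * t)" by simp
          then have X': "X t = 2 - 2 * cos (real m * (2 * pi * t))" by (simp only: X_def)
          have "\<bar>X t - x s\<bar> = 2 * \<bar>cos (real m * (2 * pi * t)) - cos (real m * s)\<bar>"
            unfolding X' x_def by (rule gen)
          also have "\<dots> \<le> 2 * ((real m)\<^sup>2 * \<bar>cos (2 * pi * t) - cos s\<bar>)"
            by (intro mult_left_mono abs_cos_mult_diff_le) auto
          finally show "\<bar>X t - x s\<bar> \<le> 2 * (real m)\<^sup>2 * \<bar>cos (2 * pi * t) - cos s\<bar>" by simp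
        qed auto
        also have "\<dots> = (2 * (real m)\<^sup>2) ^ K * (\<Prod>s\<in>S. \<bar>cos (2 * pi * t) - cos s\<bar>)"
          by (simp add: prod.distrib K_def)
        finally show "(\<Prod>s\<in>S. \<bar>X t - x s\<bar>) \<le> \<dots>" .
      qed (use X \<Psi> in \<open>auto intro!: prod_nonneg mult_nonneg_nonneg\<close>)
      also have "\<dots> = W * \<bar>F t\<bar>"
        by (simp add: W_def F_def abs_mult abs_prod)
      finally show "norm (tp a t - tp v t) \<le> W * \<bar>F t\<bar>" .
    qed (intro integrable_continuous_interval continuous_intros contF)+
    also have "\<dots> = W * integral {0..1} (\<lambda>t. \<bar>F t\<bar>)" by simp
    also have "\<dots> \<le> W * 2 ^ K"
      unfolding F_def K_def using integral_sign_multiplied_le[OF A S \<sigma> sign]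
      by (intro mult_left_mono) (auto simp: W_def)
    also have "\<dots> \<le> 2 ^ (20 * q)"
      using multiplier_bound[OF m(2)] unfolding W_def q_def K_def by simp
    finally show ?thesis .
  qed
  ultimately have bound: "sqrt (real N) \<le> 10 * 2 ^ (20 * q)" if "(\<Sum>i<N. 4 ^ i) \<le> card {n. a n \<noteq> 0}" for N
    using that by (meson mult_left_mono order_trans zero_le_numeral)
  \<comment> \<open>The bound on sqrt N gives N \<le> 100 * 2^(40 q), which is less than 2^(41 q)
    because q \<ge> 9.\<close>
  define N :: nat where "N = 2 ^ (41 * q)"
  have "\<not> (\<Sum>i<N. 4 ^ i) \<le> card {n. a n \<noteq> 0}"
  proof
    assume "(\<Sum>i<N. 4 ^ i) \<le> card {n. a n \<noteq> 0}"
    then have "(sqrt (real N))\<^sup>2 \<le> (10 * 2 ^ (20 * q))\<^sup>2" using bound by (intro power_mono) auto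
    also have "\<dots> = 100 * 2 ^ (40 * q)" by (simp add: power_mult_distrib flip: power_mult)
    also have "\<dots> < 2 ^ 7 * 2 ^ (40 * q)" by (intro mult_strict_right_mono) auto
    also have "\<dots> = 2 ^ (7 + 40 * q)" by (simp only: power_add)
    also have "\<dots> \<le> 2 ^ (41 * q)"
    proof (intro power_increasing)
      have "3\<^sup>2 \<le> q" unfolding q_def by (intro power_mono) auto
      then show "7 + 40 * q \<le> 41 * q" by simp
    qed auto
    finally show False by (simp add: N_def)
  qed
  moreover have "(\<Sum>i<N. 4 ^ i) \<le> (4::nat) ^ N" by (induction N) auto
  ultimately have "card {n. a n \<noteq> 0} \<le> 4 ^ N" by linarith
  moreover have "{n. a n \<noteq> 0} = {n. (sdiff (int m) ^^ Suc q) (coef A) n \<noteq> 0}"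
    by (simp add: a_int r_def)
  ultimately show ?thesis by (simp add: N_def)
qed

section \<open>Few zeros force few elements\<close>

lemma coef_nonneg: "coef A n \<ge> 0"
  by (auto simp: coef_def intro!: sum_nonneg)

text \<open>Summation by parts: the shift passes from the coefficients to \<phi>, and each a is then
  counted at its two frequencies. On the left only the breaks survive. It is applied with a sine and
  with the frequency itself as \<phi>.\<close>

lemma sum_coef_diff:
  fixes \<phi> :: "int \<Rightarrow> real" and m :: int
  assumes A: "finite A"
  defines "D \<equiv> {n. coef A (n + m) \<noteq> coef A n}"
  shows "finite D"
    "(\<Sum>n\<in>D. of_int (coef A n - coef A (n + m)) * \<phi> n) = (\<Sum>a\<in>A. \<phi> (int a) - \<phi> (int a - m) + (\<phi> (- int a) - \<phi> (- int a - m)))"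
proof -
  let ?S = "coef_supp A"
  define B where "B = ?S \<union> (\<lambda>n. n - m) ` ?S"
  have fin: "finite B" "finite ?S" using finite_coef_supp[OF A] by (auto simp: B_def)
  have "n \<in> B" if "coef A (n + m) \<noteq> coef A n" for n
  proof (rule ccontr)
    assume "n \<notin> B"
    then have "n \<notin> ?S" "n + m \<notin> ?S" by (auto simp: B_def image_iff dest: spec[of _ "n + m"])
    then show False using that by (simp add: coef_eq_0)
  qed
  then have D: "D \<subseteq> B" by (auto simp: D_def)
  then show "finite D" using fin finite_subset by blast
  have "(\<Sum>n\<in>D. of_int (coef A n - coef A (n + m)) * \<phi> n) = (\<Sum>n\<in>B. of_int (coef A n - coef A (n + m)) * \<phi> n)"
    using fin D by (intro sum.mono_neutral_left) (auto simp: D_def)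
  also have "\<dots> = (\<Sum>n\<in>B. of_int (coef A n) * \<phi> n) - (\<Sum>n\<in>B. of_int (coef A (n + m)) * \<phi> n)"
    by (simp add: left_diff_distrib sum_subtractf)
  also have "(\<Sum>n\<in>B. of_int (coef A n) * \<phi> n) = (\<Sum>n\<in>?S. of_int (coef A n) * \<phi> n)"
    using fin coef_eq_0 by (intro sum.mono_neutral_right) (auto simp: B_def)
  also have "(\<Sum>n\<in>B. of_int (coef A (n + m)) * \<phi> n) = (\<Sum>n\<in>(\<lambda>n. n - m) ` ?S. of_int (coef A (n + m)) * \<phi> n)"
  proof (rule sum.mono_neutral_right)
    show "\<forall>n\<in>B - (\<lambda>n. n - m) ` ?S. of_int (coef A (n + m)) * \<phi> n = 0"
    proof
      fix n assume "n \<in> B - (\<lambda>n. n - m) ` ?S"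
      then have "n + m \<notin> ?S" by (auto simp: image_iff dest: bspec[of _ _ "n + m"])
      then show "of_int (coef A (n + m)) * \<phi> n = 0" by (simp add: coef_eq_0)
    qed
  qed (use fin in \<open>auto simp: B_def\<close>)
  also have "\<dots> = (\<Sum>n\<in>?S. of_int (coef A n) * \<phi> (n - m))"
    by (subst sum.reindex) (auto simp: inj_on_def)
  also have "(\<Sum>n\<in>?S. of_int (coef A n) * \<phi> n) - \<dots> = (\<Sum>n\<in>?S. of_int (coef A n) * (\<phi> n - \<phi> (n - m)))"
    by (simp add: right_diff_distrib sum_subtractf)
  also have "\<dots> = (\<Sum>a\<in>A. \<phi> (int a) - \<phi> (int a - m) + (\<phi> (- int a) - \<phi> (- int a - m)))"
    by (rule sum_coef[OF A])
  finally show "(\<Sum>n\<in>D. of_int (coef A n - coef A (n + m)) * \<phi> n) = \<dots>" .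
qed

lemma card_le_of_few_breaks:
  fixes A :: "nat set" and Z :: "real set" and m :: nat
  assumes A: "finite A" and m: "m > 0"
    and Z: "finite Z" "\<And>x. 0 < x \<Longrightarrow> x < 2 * pi \<Longrightarrow> cosine_poly A x = 0 \<Longrightarrow> x \<in> Z"
  defines "d \<equiv> card {n. coef A (n + int m) \<noteq> coef A n}"
  shows "real (card A) < (100 * (real d + 1)) ^ (3 * (d + d\<^sup>2 + card Z + 1))"
proof -
  define D where "D = {n. coef A (n + int m) \<noteq> coef A n}"
  have finD: "finite D" unfolding D_def by (rule sum_coef_diff[OF A])
  \<comment> \<open>The shift by m / 2 centres the difference: sin((n + m/2) x) - sin((n - m/2) x) =
    2 sin(m x / 2) cos(n x). The sign of u goes into \<tau>, so that the frequencies y are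
    nonnegative.\<close>
  define u where "u n = of_int n + real m / 2" for n :: int
  define \<tau> where "\<tau> n = of_int (coef A n - coef A (n + int m)) * sgn (u n)" for n
  define y where "y n = \<bar>u n\<bar>" for n
  have sin_eq: "(\<Sum>n\<in>D. \<tau> n * sin (y n * x)) = 4 * sin (real m * x / 2) * cosine_poly A x" for x
  proof -
    have "sgn (u n) * sin (y n * x) = sin (u n * x)" for n
      by (auto simp: y_def sgn_if abs_if)
    then have "(\<Sum>n\<in>D. \<tau> n * sin (y n * x)) = (\<Sum>n\<in>D. of_int (coef A n - coef A (n + int m)) * sin (u n * x))"
      by (simp add: \<tau>_def mult.assoc)
    also have "\<dots> = (\<Sum>a\<in>A. sin (u (int a) * x) - sin (u (int a - int m) * x) + (sin (u (- int a) * x) - sin (u (- int a - int m) * x)))"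
      unfolding D_def by (rule sum_coef_diff(2)[OF A])
    also have "\<dots> = (\<Sum>a\<in>A. 4 * sin (real m * x / 2) * cos (real a * x))"
    proof (intro sum.cong refl)
      fix a
      have "sin (u n * x) - sin (u (n - int m) * x) = 2 * sin (real m * x / 2) * cos (of_int n * x)" for n
      proof -
        have "u n * x = of_int n * x + real m * x / 2" "u (n - int m) * x = of_int n * x - real m * x / 2"
          by (simp_all add: u_def field_simps)
        then show ?thesis by (simp add: sin_add sin_diff)
      qed
      note this[of "int a"] this[of "- int a"]
      then show "sin (u (int a) * x) - sin (u (int a - int m) * x) + (sin (u (- int a) * x) - sin (u (- int a - int m) * x))
          = 4 * sin (real m * x / 2) * cos (real a * x)" by simp
    qed
    finally show ?thesis by (simp add: cosine_poly_def sum_distrib_left)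
  qed
  have "(\<Sum>n\<in>D. \<tau> n * y n) = 2 * real m * real (card A)"
  proof -
    have "sgn (u n) * y n = u n" for n by (auto simp: y_def sgn_if)
    then have "(\<Sum>n\<in>D. \<tau> n * y n) = (\<Sum>n\<in>D. of_int (coef A n - coef A (n + int m)) * u n)"
      by (simp add: \<tau>_def mult.assoc)
    also have "\<dots> = (\<Sum>a\<in>A. u (int a) - u (int a - int m) + (u (- int a) - u (- int a - int m)))"
      unfolding D_def by (rule sum_coef_diff(2)[OF A])
    also have "\<dots> = 2 * real m * real (card A)" by (simp add: u_def)
    finally show ?thesis .
  qed
  moreover have "\<bar>\<Sum>n\<in>D. \<tau> n * y n\<bar> < real m * (100 * (real (card D) + 1)) ^ (3 * (card D + (card D)\<^sup>2 + card Z + 1))"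
  proof (rule sine_sum_frequency_bound[OF finD, where b = "2 * pi / real m" and Z = Z])
    show "\<bar>\<tau> n\<bar> \<le> 2" for n
    proof -
      \<comment> \<open>Nonnegativity of the coefficients enters here: two numbers between 0 and 2
        differ by at most 2.\<close>
      have "\<bar>coef A n - coef A (n + int m)\<bar> \<le> 2"
        using coef_le[OF A, of n] coef_le[OF A, of "n + int m"] coef_nonneg[of A n] coef_nonneg[of A "n + int m"]
        by linarith
      then have "\<bar>real_of_int (coef A n - coef A (n + int m))\<bar> * \<bar>sgn (u n)\<bar> \<le> 2 * 1"
        by (intro mult_mono) (auto simp: abs_sgn_eq)
      then show ?thesis by (simp only: \<tau>_def abs_mult)
    qed
    show "\<tau> n \<in> \<int>" for n by (auto simp: \<tau>_def sgn_if)
    show "1 / real m \<le> 2 * pi / real m" using m pi_gt3 by (intro divide_right_mono) auto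
    \<comment> \<open>Before 2 pi / m the factor sin(m x / 2) is positive, so the sine sum has no
      zeros besides those of the cosine polynomial.\<close>
    show "x \<in> Z" if x: "0 < x" "x < 2 * pi / real m" "(\<Sum>n\<in>D. \<tau> n * sin (y n * x)) = 0" for x
    proof -
      have "real m * x < 2 * pi" using x m by (simp add: field_simps)
      then have "sin (real m * x / 2) > 0" using x m by (intro sin_gt_zero) auto
      then have "cosine_poly A x = 0" using x(3) sin_eq[of x] by simp
      moreover have "2 * pi / real m \<le> 2 * pi / 1" using m by (intro divide_left_mono) auto
      ultimately show ?thesis using x by (intro Z(2)) auto
    qed
  qed (use m Z in \<open>auto simp: y_def\<close>)
  \<comment> \<open>Starting the scales at H0 = m matches the factor m of the first moment, so the
    bound on A does not involve m.\<close>
  ultimately have "real m * (2 * real (card A)) < real m * (100 * (real d + 1)) ^ (3 * (d + d\<^sup>2 + card Z + 1))"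
    by (simp add: D_def d_def mult_ac)
  then show ?thesis using m by simp
qed

text \<open>Every break lies within L of the sparse set E. Since L is only exponential in p, the
  factor 2L + 1 is absorbed by the double exponential, turning the base 4 into 8. The sign changes S
  may be fewer than the zeros, so p is replaced by q only at the end.\<close>

lemma few_breaks:
  fixes A :: "nat set" and Z :: "real set"
  defines "q \<equiv> (card Z + 3)\<^sup>2"
  assumes A: "finite A" and Z: "finite Z" "\<And>x. 0 < x \<Longrightarrow> x < pi \<Longrightarrow> cosine_poly A x = 0 \<Longrightarrow> x \<in> Z"
  shows "\<exists>m>0. card {n. coef A (n + int m) \<noteq> coef A n} \<le> 8 ^ 2 ^ (41 * q)"
proof -
  have fin: "finite {x. 0 < x \<and> x < pi \<and> cosine_poly A x = 0}"
    using Z(1) by (rule rev_finite_subset) (use Z(2) in auto)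
  have "\<exists>S. S \<subseteq> {x. 0 < x \<and> x < pi \<and> cosine_poly A x = 0} \<and>
    (\<exists>\<sigma>\<in>{1, -1}. \<forall>x\<in>{0..pi}. \<sigma> * (cosine_poly A x * (\<Prod>s\<in>S. cos x - cos s)) \<ge> 0)"
    by (rule sign_change_set[OF continuous_on_cosine_poly _ _ fin]) auto
  then obtain S \<sigma> where S: "S \<subseteq> {x. 0 < x \<and> x < pi \<and> cosine_poly A x = 0}" "\<sigma> \<in> {1, -1}"
    "\<And>x. x \<in> {0..pi} \<Longrightarrow> \<sigma> * (cosine_poly A x * (\<Prod>s\<in>S. cos x - cos s)) \<ge> 0"
    by blast
  have "S \<subseteq> Z" using S(1) Z(2) by auto
  then have finS: "finite S" and cardS: "card S \<le> card Z"
    using Z(1) by (auto intro: finite_subset card_mono)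
  define K p where "K = card S" and "p = (card S + 3)\<^sup>2"
  have "p \<le> q" unfolding p_def q_def using cardS by (intro power_mono) auto
  obtain m where m: "m > 0" "m \<le> 256 ^ K" "\<And>s. s \<in> S \<Longrightarrow> 2 - 2 * cos (real m * s) \<le> 1 / 2 ^ 10"
    using dirichlet_cos[OF finS] unfolding K_def by blast
  define E where "E = {n. (sdiff (int m) ^^ Suc p) (coef A) n \<noteq> 0}"
  have cardE: "card E \<le> 4 ^ 2 ^ (41 * p)"
    unfolding E_def p_def by (rule sparse_high_difference[OF A finS S(2,3)]) (use m in \<open>auto simp: K_def\<close>)
  have finE: "finite E"
  proof -
    have "E = {n. (sdiff (int m) ^^ Suc p) (\<lambda>n. real_of_int (coef A n)) n \<noteq> 0}"
      unfolding E_def of_int_funpow_sdiff[symmetric] by simp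
    then show ?thesis by (simp only: finite_supp_funpow_sdiff[OF finite_supp_coef[OF A]])
  qed
  define L where "L = (Suc p + 2 * 4 ^ Suc p) * m"
  have "card {n. coef A (n + int m) \<noteq> coef A n} \<le> card E * (2 * L + 1)"
  proof (rule card_near_le[OF finE])
    fix n assume "n \<in> {n. coef A (n + int m) \<noteq> coef A n}"
    then show "\<exists>e\<in>E. \<bar>n - e\<bar> \<le> int L"
      using break_near_difference[OF A m(1), of n "Suc p"] unfolding E_def L_def by blast
  qed
  also have "\<dots> \<le> 4 ^ 2 ^ (41 * p) * 2 ^ 2 ^ (41 * p)"
  proof (intro mult_mono cardE)
    have "Suc p \<le> 4 ^ Suc p"
    proof -
      have "Suc p < 2 ^ Suc p" by (rule less_exp)
      also have "(2::nat) ^ Suc p \<le> 4 ^ Suc p" by (rule power_mono) auto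
      finally show ?thesis by (rule less_imp_le)
    qed
    then have "L \<le> (3 * 4 ^ Suc p) * 256 ^ K"
      unfolding L_def using m by (intro mult_mono) auto
    moreover have "(1::nat) * 1 \<le> 4 ^ Suc p * 256 ^ K" by (intro mult_mono) auto
    ultimately have "2 * L + 1 \<le> 8 * (4 ^ Suc p * 256 ^ K)" by linarith
    also have "\<dots> = 2 ^ 3 * ((2 ^ 2) ^ Suc p * (2 ^ 8) ^ K)" by simp
    also have "\<dots> = 2 ^ (3 + (2 * Suc p + 8 * K))" by (simp only: power_add power_mult)
    also have "\<dots> \<le> 2 ^ 2 ^ (41 * p)"
    proof (rule power_increasing)
      have "3\<^sup>2 \<le> p" unfolding p_def by (intro power_mono) auto
      moreover have "K \<le> p" by (simp add: p_def K_def power2_eq_square algebra_simps)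
      ultimately have "3 + (2 * Suc p + 8 * K) \<le> 41 * p" by simp
      also have "\<dots> \<le> 2 ^ (41 * p)" using less_exp[of "41 * p"] by linarith
      finally show "3 + (2 * Suc p + 8 * K) \<le> 2 ^ (41 * p)" .
    qed auto
    finally show "2 * L + 1 \<le> 2 ^ 2 ^ (41 * p)" .
  qed auto
  also have "\<dots> = 8 ^ 2 ^ (41 * p)" by (simp flip: power_mult_distrib)
  also have "\<dots> \<le> 8 ^ 2 ^ (41 * q)"
    using \<open>p \<le> q\<close> by (intro power_increasing) auto
  finally show ?thesis using m(1) by blast
qed

text \<open>With P = 8^y the base is at most P^2 = 2^(6 y) and the exponent at most P^3; then 6 y
  P^3 \<le> P^4 = 2^(12 y).\<close>

lemma iterated_exponential_bound:
  fixes d k :: nat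
  defines "y \<equiv> 2 ^ (41 * (k + 3)\<^sup>2)"
  assumes d: "d \<le> 8 ^ y"
  shows "(100 * (real d + 1)) ^ (3 * (d + d\<^sup>2 + k + 1)) \<le> 2 ^ 2 ^ (12 * y)"
proof -
  define P :: nat where "P = 8 ^ y"
  have y_ge: "y \<ge> 41 * (k + 3)\<^sup>2" unfolding y_def by (rule less_imp_le[OF less_exp])
  have "3\<^sup>2 \<le> (k + 3)\<^sup>2" by (intro power_mono) auto
  then have "y \<ge> 41 * 9" using y_ge by simp
  have "y \<le> 2 ^ y" by (rule less_imp_le[OF less_exp])
  have "k + 1 \<le> y" using y_ge by (simp add: power2_eq_square algebra_simps)
  have P3: "6 * y \<le> P"
  proof -
    have "6 \<le> (2::nat) ^ y" using \<open>y \<ge> 41 * 9\<close> \<open>y \<le> 2 ^ y\<close> by linarith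
    then have "6 * y \<le> 2 ^ y * 2 ^ y" using \<open>y \<le> 2 ^ y\<close> by (intro mult_mono) auto
    also have "\<dots> = 4 ^ y" by (simp flip: power_mult_distrib)
    also have "\<dots> \<le> P" unfolding P_def by (intro power_mono) auto
    finally show ?thesis .
  qed
  have Pbig: "P \<ge> 256" "k + 1 \<le> P" using P3 \<open>y \<ge> 41 * 9\<close> \<open>k + 1 \<le> y\<close> by linarith+
  have dP: "d \<le> P" using d by (simp add: P_def)
  have "100 * (d + 1) \<le> P * P"
  proof -
    have "100 * (d + 1) \<le> 256 * P" using dP Pbig by simp
    also have "\<dots> \<le> P * P" using Pbig by (intro mult_right_mono) auto
    finally show ?thesis .
  qed
  then have "real (100 * (d + 1)) \<le> real (P * P)" by (rule of_nat_mono)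
  then have T: "100 * (real d + 1) \<le> real P * real P" by simp
  have e: "3 * (d + d\<^sup>2 + k + 1) \<le> P ^ 3"
  proof -
    have "d\<^sup>2 \<le> P\<^sup>2" unfolding P_def using d by (intro power_mono) auto
    moreover have "P \<le> P\<^sup>2" using Pbig by (simp add: power2_eq_square)
    ultimately have "d + d\<^sup>2 + (k + 1) \<le> P\<^sup>2 + P\<^sup>2 + P\<^sup>2"
      using dP Pbig by (intro add_mono) auto
    then have "3 * (d + d\<^sup>2 + k + 1) \<le> 9 * P\<^sup>2" by simp
    also have "\<dots> \<le> P * P\<^sup>2" using Pbig by (intro mult_right_mono) auto
    finally show ?thesis by (simp add: power3_eq_cube power2_eq_square mult.assoc)
  qed
  have "(100 * (real d + 1)) ^ (3 * (d + d\<^sup>2 + k + 1)) \<le> (real P * real P) ^ (3 * (d + d\<^sup>2 + k + 1))"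
    using T by (intro power_mono) auto
  also have "\<dots> \<le> (real P * real P) ^ (P ^ 3)"
    using e Pbig mult_mono[of 1 "real P" 1 "real P"] by (intro power_increasing) auto
  also have "real P * real P = 2 ^ (6 * y)"
  proof -
    have "real P = (2 ^ 3) ^ y" by (simp add: P_def)
    then have "real P * real P = 2 ^ (3 * y + 3 * y)" by (simp only: power_mult[symmetric] power_add)
    then show ?thesis by simp
  qed
  also have "(2 ^ (6 * y)) ^ (P ^ 3) = (2::real) ^ (6 * y * P ^ 3)" by (simp only: power_mult)
  also have "\<dots> \<le> 2 ^ 2 ^ (12 * y)"
  proof (rule power_increasing)
    have "6 * y * P ^ 3 \<le> P * P ^ 3" using P3 by (intro mult_right_mono) auto
    also have "\<dots> = P ^ 4" by (simp add: eval_nat_numeral)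
    also have "\<dots> = 2 ^ (12 * y)"
    proof -
      have "P ^ 4 = ((2 ^ 3) ^ y) ^ 4" by (simp add: P_def)
      also have "\<dots> = 2 ^ (3 * y * 4)" by (simp only: power_mult)
      finally show ?thesis by (simp add: mult_ac)
    qed
    finally show "6 * y * P ^ 3 \<le> 2 ^ (12 * y)" .
  qed auto
  finally show ?thesis .
qed

text \<open>The zeros are used twice: those in (0, pi) bound the sign changes, those in (0, 2 pi)
  are avoided by the scale. The constant 42 arises from 12 \<le> 2^4 and 4 + 41 q \<le> 42
  q.\<close>

lemma log_log_log_le:
  fixes A :: "nat set"
  assumes A: "finite A" and Z: "finite {\<theta> \<in> {0..2 * pi}. cosine_poly A \<theta> = 0}"
    and big: "log 2 (log 2 (real (card A))) > 0" "log 2 (real (card A)) > 0" "card A > 0"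
  shows "log 2 (log 2 (log 2 (real (card A))))
    \<le> 42 * (real (card {\<theta> \<in> {0..2 * pi}. cosine_poly A \<theta> = 0}) + 3)\<^sup>2"
proof -
  define Z where "Z = {\<theta> \<in> {0..2 * pi}. cosine_poly A \<theta> = 0}"
  define k where "k = card Z"
  define q where "q = (k + 3)\<^sup>2"
  have finZ: "finite Z" using assms(2) by (simp add: Z_def)
  obtain m where m: "m > 0" "card {n. coef A (n + int m) \<noteq> coef A n} \<le> 8 ^ 2 ^ (41 * q)"
    using few_breaks[OF A finZ] unfolding k_def q_def by (auto simp: Z_def)
  have "real (card A) < (100 * (real (card {n. coef A (n + int m) \<noteq> coef A n}) + 1)) ^
      (3 * (card {n. coef A (n + int m) \<noteq> coef A n} + (card {n. coef A (n + int m) \<noteq> coef A n})\<^sup>2 + card Z + 1))"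
    by (rule card_le_of_few_breaks[OF A m(1) finZ]) (auto simp: Z_def)
  also have "\<dots> \<le> 2 ^ 2 ^ (12 * 2 ^ (41 * q))"
    using iterated_exponential_bound[OF m(2)[unfolded q_def]] unfolding k_def q_def .
  finally have "log 2 (real (card A)) \<le> log 2 (2 ^ 2 ^ (12 * 2 ^ (41 * q)))"
    using big by (subst log_le_cancel_iff) auto
  also have "\<dots> = 2 ^ (12 * 2 ^ (41 * q))" by (subst log_pow_cancel) auto
  finally have "log 2 (log 2 (real (card A))) \<le> log 2 (2 ^ (12 * 2 ^ (41 * q)))"
    using big by (subst log_le_cancel_iff) auto
  also have "\<dots> = real (12 * 2 ^ (41 * q))" by (subst log_pow_cancel) auto
  also have "\<dots> \<le> 2 ^ 4 * 2 ^ (41 * q)" by simp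
  also have "\<dots> = 2 ^ (4 + 41 * q)" by (simp only: power_add)
  finally have "log 2 (log 2 (log 2 (real (card A)))) \<le> log 2 (2 ^ (4 + 41 * q))"
    using big by (subst log_le_cancel_iff) auto
  also have "\<dots> = real (4 + 41 * q)" by (subst log_pow_cancel) auto
  also have "\<dots> \<le> real (42 * q)"
  proof -
    have "3\<^sup>2 \<le> q" unfolding q_def by (intro power_mono) auto
    then show ?thesis by simp
  qed
  finally show ?thesis by (simp add: q_def k_def Z_def)
qed

lemma powr_le_sqrt_eventually:
  fixes \<epsilon> :: real
  assumes "\<epsilon> > 0"
  shows "eventually (\<lambda>x. x powr (1 / 2 - \<epsilon>) \<le> sqrt (x / 42) - 3) at_top"
  using assms by real_asymp

theorem theorem1:
  shows "\<forall>\<epsilon>::real. \<epsilon> > 0 \<longrightarrow>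
    (\<exists>N0::nat. \<forall>A::nat set. finite A \<and> card A \<ge> N0 \<longrightarrow>
      (\<exists>Z::real set. finite Z \<and> Z \<subseteq> {\<theta> \<in> {0..2 * pi}. cosine_poly A \<theta> = 0} \<and>
        real (card Z) \<ge> (log 2 (log 2 (log 2 (real (card A))))) powr (1 / 2 - \<epsilon>)))"
proof (intro allI impI)
  fix \<epsilon> :: real assume "\<epsilon> > 0"
  from powr_le_sqrt_eventually[OF this] obtain x0
    where x0: "\<And>x. x \<ge> x0 \<Longrightarrow> x powr (1 / 2 - \<epsilon>) \<le> sqrt (x / 42) - 3"
    by (auto simp: eventually_at_top_linorder)
  have le_log2: "y \<le> log 2 z" "z > 0" if "2 powr y \<le> z" for y z :: real
  proof -
    show "z > 0" using that by (rule less_le_trans[rotated]) simp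
    then show "y \<le> log 2 z" using that by (simp add: le_log_iff)
  qed
  \<comment> \<open>A tower of three exponentials: each use of \<open>le_log2\<close> peels off one
    and also yields the positivity on which the monotonicity of the logarithms depends.\<close>
  define N0 where "N0 = nat \<lceil>2 powr (2 powr (2 powr (max x0 1)))\<rceil>"
  show "\<exists>N0::nat. \<forall>A::nat set. finite A \<and> card A \<ge> N0 \<longrightarrow>
      (\<exists>Z::real set. finite Z \<and> Z \<subseteq> {\<theta> \<in> {0..2 * pi}. cosine_poly A \<theta> = 0} \<and>
        real (card Z) \<ge> (log 2 (log 2 (log 2 (real (card A))))) powr (1 / 2 - \<epsilon>))"
  proof (intro exI[of _ N0] allI impI)
    fix A :: "nat set" assume "finite A \<and> card A \<ge> N0"
    then have A: "finite A" "card A \<ge> N0" by auto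
    define x where "x = log 2 (log 2 (log 2 (real (card A))))"
    have "2 powr (2 powr (2 powr (max x0 1))) \<le> real (card A)"
      using A(2) unfolding N0_def by linarith
    then have 1: "2 powr (2 powr (max x0 1)) \<le> log 2 (real (card A))" "real (card A) > 0"
      using le_log2 by blast+
    then have 2: "2 powr (max x0 1) \<le> log 2 (log 2 (real (card A)))" "log 2 (real (card A)) > 0"
      using le_log2 by blast+
    then have 3: "max x0 1 \<le> x" "log 2 (log 2 (real (card A))) > 0"
      unfolding x_def using le_log2 by blast+
    show "\<exists>Z::real set. finite Z \<and> Z \<subseteq> {\<theta> \<in> {0..2 * pi}. cosine_poly A \<theta> = 0} \<and>
        real (card Z) \<ge> (log 2 (log 2 (log 2 (real (card A))))) powr (1 / 2 - \<epsilon>)"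
    proof (cases "finite {\<theta> \<in> {0..2 * pi}. cosine_poly A \<theta> = 0}")
      case True
      define k where "k = card {\<theta> \<in> {0..2 * pi}. cosine_poly A \<theta> = 0}"
      have "x \<le> 42 * (real k + 3)\<^sup>2"
        unfolding x_def k_def by (rule log_log_log_le[OF A(1) True]) (use 1 2 3 in auto)
      then have "sqrt (x / 42) \<le> sqrt ((real k + 3)\<^sup>2)" by (intro real_sqrt_le_mono) simp
      then have "sqrt (x / 42) - 3 \<le> real k" by simp
      moreover have "x powr (1 / 2 - \<epsilon>) \<le> sqrt (x / 42) - 3" using 3 by (intro x0) auto
      ultimately show ?thesis
        using True unfolding x_def k_def by (intro exI[of _ "{\<theta> \<in> {0..2 * pi}. cosine_poly A \<theta> = 0}"]) auto
    next
      \<comment> \<open>With infinitely many zeros a finite subset of the wanted size is at hand, so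
        finiteness of the zero set need not be established.\<close>
      case False
      then obtain Z where "finite Z" "card Z = nat \<lceil>x powr (1 / 2 - \<epsilon>)\<rceil>"
          "Z \<subseteq> {\<theta> \<in> {0..2 * pi}. cosine_poly A \<theta> = 0}"
        using infinite_arbitrarily_large by blast
      then show ?thesis unfolding x_def by (intro exI[of _ Z]) (auto simp: le_nat_iff of_nat_ceiling)
    qed
  qed
qed

end
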